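(* Let $n\ge1$, let $\mathcal{Q}\subseteq H^2(\mathbb{T}^n)$ be a quotient module, let $X\in\mathcal{B}_1(\mathcal{Q})$ be a module map, and let $\psi=X(P_{\mathcal{Q}}1)$. Let $\mathcal{M}_{\mathcal{Q}}=\mathcal{Q}^{conj}+\mathcal{M}_n+H^2_0(\mathbb{T}^n)$, regarded as a linear subspace of $L^1(\mathbb{T}^n)$ with the norm $\|\cdot\|_1$, and define $X_{\mathcal{Q}}:\mathcal{M}_{\mathcal{Q}}\to\mathbb{C}$ by $X_{\mathcal{Q}}f=\int_{\mathbb{T}^n}\psi f\,d\mu$. Then $X$ is liftable if and only if $X_{\mathcal{Q}}$ is a contractive functional on $(\mathcal{M}_{\mathcal{Q}},\|\cdot\|_1)$.
   Context: $\mathbb{D}$ is the open unit disc, $\mathbb{T}$ the unit circle, $\mu$ the normalized Lebesgue measure on $\mathbb{T}^n$. $H^2(\mathbb{T}^n)$ is the closed subspace of $L^2(\mathbb{T}^n)$ of functions whose Fourier coefficients vanish off $\mathbb{Z}_+^n$ (identified with analytic functions on $\mathbb{D}^n$); $\|\cdot\|_p$ is the $L^p(\mathbb{T}^n,\mu)$ norm. $\mathcal{S}(\mathbb{D}^n)$ is the closed unit ball of $H^\infty(\mathbb{D}^n)$ (sup norm). For $\varphi\in H^\infty(\mathbb{D}^n)$, $T_\varphi f=\varphi f$ on $H^2(\mathbb{T}^n)$. A closed subspace $\mathcal{Q}\subseteq H^2(\mathbb{T}^n)$ is a quotient module if $T_{z_i}^*\mathcal{Q}\subseteq\mathcal{Q}$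 for all $i$; $P_{\mathcal{Q}}$ is the orthogonal projection onto $\mathcal{Q}$, $S_\varphi=P_{\mathcal{Q}}T_\varphi|_{\mathcal{Q}}$. $\mathcal{B}_1(\mathcal{Q})$ denotes the contractions on $\mathcal{Q}$; $X\in\mathcal{B}(\mathcal{Q})$ is a module map if $XS_{z_i}=S_{z_i}X$ for all $i$; a contractive module map $X$ is liftable if $X=S_\varphi$ for some $\varphi\in\mathcal{S}(\mathbb{D}^n)$. $S^{conj}=\{\bar f:f\in S\}$; $H^2_0(\mathbb{T}^n)=\{f\in H^2(\mathbb{T}^n):f(0)=0\}$; $\mathcal{M}_n=L^2(\mathbb{T}^n)\ominus(H^2(\mathbb{T}^n)^{conj}+H^2(\mathbb{T}^n))$ (closed span of monomials $z^k$, $k\in\mathbb{Z}^n$, with at least one positive and at least one negative exponent). Contractive means $|X_{\mathcal{Q}}f|\le\|f\|_1$ for all $f$. *)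

theory Defs
  imports "HOL-Analysis.Analysis"
begin

text \<open>The torus T^n, parametrised by angles: a point is x :: nat => real with
  z_j = cis (x j) for j < n.  Normalised Lebesgue measure mu on T^n is the product of
  the uniform probability measures on [0, 2 pi).\<close>

definition torus :: "nat \<Rightarrow> (nat \<Rightarrow> real) measure" where
  "torus n = PiM {..<n} (\<lambda>_. uniform_measure lborel {0..<2*pi})"

definition zc :: "nat \<Rightarrow> (nat \<Rightarrow> real) \<Rightarrow> complex" where
  "zc j x = cis (x j)"

definition monom :: "nat \<Rightarrow> (nat \<Rightarrow> int) \<Rightarrow> (nat \<Rightarrow> real) \<Rightarrow> complex" where
  "monom n k x = cis (\<Sum>j<n. of_int (k j) * x j)"

definition fourier :: "nat \<Rightarrow> ((nat \<Rightarrow> real) \<Rightarrow> complex) \<Rightarrow> (nat \<Rightarrow> int) \<Rightarrow> complex" where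
  "fourier n f k = (LINT x|torus n. f x * cnj (monom n k x))"

definition L2 :: "nat \<Rightarrow> ((nat \<Rightarrow> real) \<Rightarrow> complex) set" where
  "L2 n = {f. f \<in> borel_measurable (torus n) \<and> integrable (torus n) (\<lambda>x. (cmod (f x))^2)}"

definition l2inner :: "nat \<Rightarrow> ((nat \<Rightarrow> real) \<Rightarrow> complex) \<Rightarrow> ((nat \<Rightarrow> real) \<Rightarrow> complex) \<Rightarrow> complex" where
  "l2inner n f g = (LINT x|torus n. f x * cnj (g x))"

definition l2norm :: "nat \<Rightarrow> ((nat \<Rightarrow> real) \<Rightarrow> complex) \<Rightarrow> real" where
  "l2norm n f = sqrt (LINT x|torus n. (cmod (f x))^2)"

definition l1norm :: "nat \<Rightarrow> ((nat \<Rightarrow> real) \<Rightarrow> complex) \<Rightarrow> real" where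
  "l1norm n f = (LINT x|torus n. cmod (f x))"

definition aeq :: "nat \<Rightarrow> ((nat \<Rightarrow> real) \<Rightarrow> complex) \<Rightarrow> ((nat \<Rightarrow> real) \<Rightarrow> complex) \<Rightarrow> bool" where
  "aeq n f g \<longleftrightarrow> (AE x in torus n. f x = g x)"

definition H2 :: "nat \<Rightarrow> ((nat \<Rightarrow> real) \<Rightarrow> complex) set" where
  "H2 n = {f \<in> L2 n. \<forall>k. (\<exists>j<n. k j < 0) \<longrightarrow> fourier n f k = 0}"

definition H2_0 :: "nat \<Rightarrow> ((nat \<Rightarrow> real) \<Rightarrow> complex) set" where
  "H2_0 n = {f \<in> H2 n. fourier n f (\<lambda>_. 0) = 0}"

text \<open>M_n: closed span of monomials with at least one positive and one negative exponent,
  i.e. Fourier coefficients vanish on Z_+^n and on Z_-^n.\<close>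
definition Mn :: "nat \<Rightarrow> ((nat \<Rightarrow> real) \<Rightarrow> complex) set" where
  "Mn n = {f \<in> L2 n. \<forall>k. ((\<forall>j<n. 0 \<le> k j) \<or> (\<forall>j<n. k j \<le> 0)) \<longrightarrow> fourier n f k = 0}"

text \<open>Closed unit ball of H^infinity(D^n), via boundary values.\<close>
definition Hinf_ball :: "nat \<Rightarrow> ((nat \<Rightarrow> real) \<Rightarrow> complex) set" where
  "Hinf_ball n = {\<phi> \<in> H2 n. AE x in torus n. cmod (\<phi> x) \<le> 1}"

text \<open>Closed linear subspace of L^2 (as a set of representatives closed under a.e. equality).\<close>
definition closed_subspace :: "nat \<Rightarrow> ((nat \<Rightarrow> real) \<Rightarrow> complex) set \<Rightarrow> bool" where
  "closed_subspace n Q \<longleftrightarrow> Q \<subseteq> L2 n \<and> (\<lambda>_. 0) \<in> Q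
     \<and> (\<forall>f\<in>Q. \<forall>g\<in>Q. (\<lambda>x. f x + g x) \<in> Q)
     \<and> (\<forall>c. \<forall>f\<in>Q. (\<lambda>x. c * f x) \<in> Q)
     \<and> (\<forall>f\<in>Q. \<forall>g\<in>L2 n. aeq n f g \<longrightarrow> g \<in> Q)
     \<and> (\<forall>F f. (\<forall>k::nat. F k \<in> Q) \<longrightarrow> f \<in> L2 n
          \<longrightarrow> (\<lambda>k. l2norm n (\<lambda>x. F k x - f x)) \<longlonglongrightarrow> 0 \<longrightarrow> f \<in> Q)"

text \<open>Quotient module: closed subspace of H^2 with T_{z_j}^* Q \<subseteq> Q, where
  T_{z_j}^* f is the g in H^2 with <g,h> = <f, z_j h> for all h in H^2.\<close>
definition quotient_module :: "nat \<Rightarrow> ((nat \<Rightarrow> real) \<Rightarrow> complex) set \<Rightarrow> bool" where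
  "quotient_module n Q \<longleftrightarrow> closed_subspace n Q \<and> Q \<subseteq> H2 n
     \<and> (\<forall>j<n. \<forall>f\<in>Q. \<exists>g\<in>Q. \<forall>h\<in>H2 n. l2inner n g h = l2inner n f (\<lambda>x. zc j x * h x))"

definition is_proj :: "nat \<Rightarrow> ((nat \<Rightarrow> real) \<Rightarrow> complex) set \<Rightarrow> ((nat \<Rightarrow> real) \<Rightarrow> complex)
     \<Rightarrow> ((nat \<Rightarrow> real) \<Rightarrow> complex) \<Rightarrow> bool" where
  "is_proj n Q f p \<longleftrightarrow> p \<in> Q \<and> (\<forall>h\<in>Q. l2inner n (\<lambda>x. f x - p x) h = 0)"

definition contraction_on :: "nat \<Rightarrow> ((nat \<Rightarrow> real) \<Rightarrow> complex) set
     \<Rightarrow> (((nat \<Rightarrow> real) \<Rightarrow> complex) \<Rightarrow> ((nat \<Rightarrow> real) \<Rightarrow> complex)) \<Rightarrow> bool" where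
  "contraction_on n Q X \<longleftrightarrow> (\<forall>f\<in>Q. X f \<in> Q)
     \<and> (\<forall>f\<in>Q. \<forall>g\<in>Q. \<forall>c. aeq n (X (\<lambda>x. c * f x + g x)) (\<lambda>x. c * X f x + X g x))
     \<and> (\<forall>f\<in>Q. l2norm n (X f) \<le> l2norm n f)"

text \<open>Module map: X S_{z_j} = S_{z_j} X, where S_{z_j} f = P_Q (z_j f).\<close>
definition module_map :: "nat \<Rightarrow> ((nat \<Rightarrow> real) \<Rightarrow> complex) set
     \<Rightarrow> (((nat \<Rightarrow> real) \<Rightarrow> complex) \<Rightarrow> ((nat \<Rightarrow> real) \<Rightarrow> complex)) \<Rightarrow> bool" where
  "module_map n Q X \<longleftrightarrow> (\<forall>j<n. \<forall>f\<in>Q. \<forall>p q. is_proj n Q (\<lambda>x. zc j x * f x) p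
       \<longrightarrow> is_proj n Q (\<lambda>x. zc j x * X f x) q \<longrightarrow> aeq n (X p) q)"

definition liftable :: "nat \<Rightarrow> ((nat \<Rightarrow> real) \<Rightarrow> complex) set
     \<Rightarrow> (((nat \<Rightarrow> real) \<Rightarrow> complex) \<Rightarrow> ((nat \<Rightarrow> real) \<Rightarrow> complex)) \<Rightarrow> bool" where
  "liftable n Q X \<longleftrightarrow> (\<exists>\<phi>\<in>Hinf_ball n. \<forall>f\<in>Q. is_proj n Q (\<lambda>x. \<phi> x * f x) (X f))"

definition MQ :: "nat \<Rightarrow> ((nat \<Rightarrow> real) \<Rightarrow> complex) set \<Rightarrow> ((nat \<Rightarrow> real) \<Rightarrow> complex) set" where
  "MQ n Q = {f. \<exists>q\<in>Q. \<exists>m\<in>Mn n. \<exists>h\<in>H2_0 n. f = (\<lambda>x. cnj (q x) + m x + h x)}"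

end

theory Submission
  imports "HOL-Probability.Infinite_Product_Measure" Defs
begin

text \<open>
  If \<open>X = S\<^sub>\<phi>\<close>, then \<open>\<psi> = P\<^sub>Q \<phi>\<close>, because \<open>H\<^sup>2 \<ominus> Q\<close> is invariant under multiplication by
  \<open>\<phi>\<close>: the Fejer means of \<open>\<phi>\<close> are analytic polynomials bounded by 1 that converge weakly to
  \<open>\<phi>\<close>. Hence \<open>\<psi>\<close> and \<open>\<phi>\<close> define the same functional on \<open>M\<^sub>Q\<close>, and \<open>|\<phi>| \<le> 1\<close> makes it
  contractive.

  Conversely, a symbol \<open>\<phi>\<close> is a common point of the unit ball \<open>K\<close> of \<open>L\<^sup>\<infinity>\<close> and the affine space
  \<open>A = \<psi> + (H\<^sup>2 \<ominus> Q)\<close>. Instead of Hahn-Banach and the duality of \<open>L\<^sup>1\<close> and \<open>L\<^sup>\<infinity>\<close>, everything happens in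
  \<open>L\<^sup>2\<close>: the element \<open>d\<close> of minimal norm in the closure of \<open>K - A\<close> is orthogonal to
  \<open>H\<^sup>2 \<ominus> Q\<close>, so its conjugate lies in \<open>M\<^sub>Q\<close>; testing minimality against \<open>- d / |d| - \<psi>\<close> and using
  contractivity gives \<open>d = 0\<close>. Then the bounded convex sets of points of \<open>K\<close> at distance at most
  \<open>1/m\<close> from \<open>A\<close> are nonempty, and the parallelogram law produces a common limit point.
  Finally \<open>X P\<^sub>Q f = P\<^sub>Q (\<phi> f)\<close> holds for monomials since \<open>X\<close> is a module map, and hence on \<open>H\<^sup>2\<close>.
\<close>

section \<open>The torus and its monomials\<close>

text \<open>\<open>Mn n\<close> and \<open>H2_0 n\<close> are invisible to analytic functions:
  integrated against an element of \<open>H2 n\<close> they give 0. So the functional given by an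
  analytic symbol depends only on the inner products of that symbol with \<open>Q\<close>, and
  changing \<psi> by an element orthogonal to \<open>Q\<close> in \<open>H2 n\<close> does not
  affect it. The vector \<open>d\<close> is orthogonal to these changes because K - A is invariant
  under translation by them. Among the points of K, \<open>- d / |d|\<close> has the smallest inner
  product with \<open>d\<close>, namely minus the L1 norm of \<open>d\<close>. The first-order
  condition at \<open>d\<close> bounds its squared L2 norm by minus its L1 norm minus Re <\<psi>,
  d>, and contractivity at the conjugate of \<open>d\<close> makes this bound nonpositive. That
  \<open>d\<close> vanishes says only that K and A are at distance 0; K is not norm compact, so a
  common point needs the second convexity argument. Fejer means enter because multiplication by
  \<phi> is tested against a product of two L2 functions, which is merely integrable: the
  approximating polynomials have to stay uniformly bounded, and L2 convergence would not
  suffice.\<close>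

lemma prob_space_circle: "prob_space (uniform_measure lborel {0..<2*pi})"
  by (rule prob_space_uniform_measure) auto

lemma prob_space_torus: "prob_space (torus n)"
  unfolding torus_def by (intro prob_space_PiM prob_space_circle)

interpretation torus: prob_space "torus n" for n
  by (rule prob_space_torus)

lemma sets_torus [measurable_cong]: "sets (torus n) = sets (PiM {..<n} (\<lambda>_. borel))"
  unfolding torus_def by (rule sets_PiM_cong) auto

lemma space_torus: "space (torus n) = PiE {..<n} (\<lambda>_. UNIV)"
  by (auto simp: torus_def space_PiM)

lemma coordinate_measurable:
  "j < n \<Longrightarrow> (\<lambda>x. x j) \<in> borel_measurable (torus n)"
  by measurable

lemma AE_torus_coordinate:
  assumes "j < n"
  shows "AE x in torus n. 0 \<le> x j \<and> x j < 2*pi"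
  unfolding torus_def using assms
  by (intro AE_PiM_component prob_space_circle)
     (auto intro!: AE_uniform_measureI)

lemma cis_measurable [measurable]: "cis \<in> borel_measurable borel"
  by (intro borel_measurable_continuous_onI continuous_intros)

lemma cnj_measurable [measurable]: "cnj \<in> borel_measurable borel"
  by (intro borel_measurable_continuous_onI continuous_intros)

lemma zc_measurable [measurable]: "j < n \<Longrightarrow> zc j \<in> borel_measurable (torus n)"
  unfolding zc_def by measurable

lemma norm_zc [simp]: "cmod (zc j x) = 1"
  by (simp add: zc_def)

lemma monom_measurable [measurable]: "monom n k \<in> borel_measurable (torus n)"
  unfolding monom_def by measurable

lemma norm_monom [simp]: "cmod (monom n k x) = 1"
  by (simp add: monom_def)

lemma monom_0 [simp]: "monom n (\<lambda>_. 0) = (\<lambda>_. 1)"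
  by (simp add: monom_def fun_eq_iff)

lemma monom_add: "monom n (\<lambda>j. k j + l j) x = monom n k x * monom n l x"
  by (simp add: monom_def cis_mult sum.distrib ring_distribs)

lemma cnj_monom: "cnj (monom n k x) = monom n (\<lambda>j. - k j) x"
  by (simp add: monom_def cis_cnj sum_negf)

lemma monom_diff: "monom n (\<lambda>j. k j - l j) x = monom n k x * cnj (monom n l x)"
  by (simp add: cnj_monom flip: monom_add)

lemma monom_unit:
  assumes "j < n"
  shows "monom n (\<lambda>i. if i = j then c else 0) x = cis (of_int c * x j)"
proof -
  have "(\<Sum>i<n. of_int (if i = j then c else 0) * x i) = (\<Sum>i<n. if i = j then of_int c * x i else 0)"
    by (intro sum.cong) auto
  then show ?thesis using assms by (simp add: monom_def)
qed

text \<open>For \<open>m \<noteq> 0\<close> the antiderivative \<open>F\<close> has period 2 pi, so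
  its endpoint values cancel. The fundamental theorem is applied on the closed interval; the extra
  endpoint is a null set.\<close>

lemma integral_circle_cis:
  "(LINT t|uniform_measure lborel {0..<2*pi}. cis (of_int m * t)) = (if m = 0 then 1 else 0)"
proof (cases "m = 0")
  case True
  interpret prob_space "uniform_measure lborel {0..<2*pi}" by (rule prob_space_circle)
  show ?thesis using prob_space by (simp add: True)
next
  case False
  have dens: "uniform_measure lborel {0..<2*pi} =
      density lborel (\<lambda>t. ennreal (indicator {0..<2*pi} t / (2*pi)))"
    unfolding uniform_measure_def
    by (intro density_cong) (auto simp: indicator_def divide_ennreal[symmetric] ennreal_1[symmetric] simp del: ennreal_1)
  define F where "F t = cis (of_int m * t) / (\<i> * of_int m)" for t
  have F: "(F has_vector_derivative cis (of_int m * t)) (at t within S)" for t S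
  proof -
    have "((\<lambda>z. exp (\<i> * of_int m * z) / (\<i> * of_int m)) has_field_derivative exp (\<i> * of_int m * of_real t)) (at (of_real t))"
      using False by (auto intro!: derivative_eq_intros)
    from has_vector_derivative_real_field[OF this, of S] show ?thesis
      by (simp add: F_def[abs_def] cis_conv_exp mult.assoc)
  qed
  have "(LBINT t. indicator {0..2*pi} t *\<^sub>R cis (of_int m * t)) = F (2*pi) - F 0"
    by (rule integral_FTC_Icc) (auto intro!: F continuous_intros)
  also have "\<dots> = 0"
    using cis_multiple_2pi[of "of_int m"] by (simp add: F_def mult_ac)
  finally have *: "(LBINT t. indicator {0..2*pi} t *\<^sub>R cis (of_int m * t)) = 0" .
  have "(LINT t|uniform_measure lborel {0..<2*pi}. cis (of_int m * t))
     = (LBINT t. (indicator {0..<2*pi} t / (2*pi)) *\<^sub>R cis (of_int m * t))"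
    unfolding dens by (subst integral_density) auto
  also have "\<dots> = (LBINT t. (1/(2*pi)) *\<^sub>R (indicator {0..2*pi} t *\<^sub>R cis (of_int m * t)))"
  proof (rule integral_cong_AE)
    show "AE t in lborel. (indicator {0..<2*pi} t / (2*pi)) *\<^sub>R cis (of_int m * t) =
       (1/(2*pi)) *\<^sub>R (indicator {0..2*pi} t *\<^sub>R cis (of_int m * t))"
      using AE_lborel_singleton[of "2*pi"]
      by eventually_elim (auto simp: indicator_def)
  qed auto
  also have "\<dots> = 0"
    by (subst integral_scaleR_right) (simp only: * scaleR_zero_right)
  finally show ?thesis using False by simp
qed

lemma integral_monom:
  "(LINT x|torus n. monom n k x) = (if \<forall>j<n. k j = 0 then 1 else 0)"
proof -
  interpret product_sigma_finite "\<lambda>_::nat. uniform_measure lborel {0..<2*pi}"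
    by (auto simp: product_sigma_finite_def intro!: prob_space_imp_sigma_finite prob_space_circle)
  interpret P: prob_space "uniform_measure lborel {0..<2*pi}" by (rule prob_space_circle)
  have [measurable]: "(\<lambda>t. cis (c * t)) \<in> borel_measurable (uniform_measure lborel {0..<2*pi})" for c
    by measurable
  have "monom n k x = (\<Prod>j<n. cis (of_int (k j) * x j))" for x
    unfolding monom_def by (induction n) (auto simp: cis_mult[symmetric] mult.commute)
  then have "(LINT x|torus n. monom n k x) =
      (\<Prod>j<n. LINT t|uniform_measure lborel {0..<2*pi}. cis (of_int (k j) * t))"
    unfolding torus_def
    by (simp, subst product_integral_prod) (auto intro!: P.integrable_const_bound[of _ 1])
  then show ?thesis
    by (auto simp: integral_circle_cis)
qed

section \<open>Uniqueness of Fourier coefficients\<close>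

lemma integrable_bounded_mult:
  fixes g u :: "'a \<Rightarrow> complex"
  assumes [measurable]: "g \<in> borel_measurable M" and u: "integrable M u"
    and B: "AE x in M. cmod (g x) \<le> B"
  shows "integrable M (\<lambda>x. g x * u x)"
proof (rule Bochner_Integration.integrable_bound)
  show "integrable M (\<lambda>x. B * cmod (u x))" using u by auto
  show "(\<lambda>x. g x * u x) \<in> borel_measurable M" using u by measurable
  show "AE x in M. cmod (g x * u x) \<le> norm (B * cmod (u x))"
    using B
  proof eventually_elim
    case (elim x)
    have "cmod (g x * u x) \<le> B * cmod (u x)"
      using elim by (simp add: norm_mult mult_right_mono)
    then show ?case by simp
  qed
qed

text \<open>The bounded multipliers of an \<open>L\<^sup>1\<close>-closed subspace invariant under the characters form an
  algebra closed under bounded pointwise limits. By Stone-Weierstrass it contains the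
  continuous functions of each coordinate, hence the indicators of boxes, hence all indicators.\<close>

locale L1_module =
  fixes n :: nat and F :: "((nat \<Rightarrow> real) \<Rightarrow> complex) set"
  assumes F_integrable: "u \<in> F \<Longrightarrow> integrable (torus n) u"
    and F_add: "u \<in> F \<Longrightarrow> v \<in> F \<Longrightarrow> (\<lambda>x. u x + v x) \<in> F"
    and F_scale: "u \<in> F \<Longrightarrow> (\<lambda>x. c * u x) \<in> F"
    and F_lim: "(\<And>i::nat. U i \<in> F) \<Longrightarrow> integrable (torus n) u \<Longrightarrow>
       (\<lambda>i. LINT x|torus n. cmod (U i x - u x)) \<longlonglongrightarrow> 0 \<Longrightarrow> u \<in> F"
    and F_cis: "u \<in> F \<Longrightarrow> j < n \<Longrightarrow> (\<lambda>x. cis (x j) * u x) \<in> F"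
    and F_cis_minus: "u \<in> F \<Longrightarrow> j < n \<Longrightarrow> (\<lambda>x. cis (- x j) * u x) \<in> F"
begin

definition multipliers :: "((nat \<Rightarrow> real) \<Rightarrow> complex) set" where
  "multipliers = {g \<in> borel_measurable (torus n). (\<exists>B. \<forall>x. cmod (g x) \<le> B) \<and>
      (\<forall>u\<in>F. (\<lambda>x. g x * u x) \<in> F)}"

lemma multipliers_measurable: "g \<in> multipliers \<Longrightarrow> g \<in> borel_measurable (torus n)"
  by (simp add: multipliers_def)

lemma multipliers_const: "(\<lambda>_. c) \<in> multipliers"
  unfolding multipliers_def using F_scale by auto

lemma multipliers_add: 
  assumes "g \<in> multipliers" "h \<in> multipliers" shows "(\<lambda>x. g x + h x) \<in> multipliers"
proof -
  from assms obtain B C where "\<And>x. cmod (g x) \<le> B" "\<And>x. cmod (h x) \<le> C"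
    unfolding multipliers_def by auto
  then have "\<exists>B. \<forall>x. cmod (g x + h x) \<le> B"
    by (intro exI[of _ "B + C"] allI norm_triangle_mono)
  then show ?thesis
    using assms F_add unfolding multipliers_def by (auto simp: ring_distribs)
qed

lemma multipliers_mult: 
  assumes "g \<in> multipliers" "h \<in> multipliers" shows "(\<lambda>x. g x * h x) \<in> multipliers"
proof -
  from assms obtain B C where BC: "\<And>x. cmod (g x) \<le> B" "\<And>x. cmod (h x) \<le> C"
    unfolding multipliers_def by auto
  then have "\<exists>B. \<forall>x. cmod (g x * h x) \<le> B"
    by (intro exI[of _ "B * C"] allI)
       (auto simp: norm_mult intro!: mult_mono order_trans[OF norm_ge_zero BC(1)])
  then show ?thesis
    using assms unfolding multipliers_def by (auto simp: mult.assoc)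
qed

lemma multipliers_scale: "g \<in> multipliers \<Longrightarrow> (\<lambda>x. c * g x) \<in> multipliers"
  using multipliers_mult[OF multipliers_const] .

lemma multipliers_prod: 
  "finite I \<Longrightarrow> (\<And>i. i \<in> I \<Longrightarrow> g i \<in> multipliers) \<Longrightarrow> (\<lambda>x. \<Prod>i\<in>I. g i x) \<in> multipliers"
  by (induction I rule: finite_induct) (auto intro: multipliers_const multipliers_mult)

text \<open>Dominated convergence with majorant \<open>(B + C) * cmod (u x)\<close> turns pointwise
  convergence of the multipliers into L1 convergence of the products, where \<open>F_lim\<close>
  applies.\<close>

lemma multipliers_lim:
  assumes G: "\<And>i::nat. G i \<in> multipliers" and B: "\<And>i x. cmod (G i x) \<le> B"
    and g: "g \<in> borel_measurable (torus n)" and gB: "\<And>x. cmod (g x) \<le> C"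
    and lim: "AE x in torus n. (\<lambda>i. G i x) \<longlonglongrightarrow> g x"
  shows "g \<in> multipliers"
proof -
  note [measurable] = g multipliers_measurable[OF G]
  have "(\<lambda>x. g x * u x) \<in> F" if u: "u \<in> F" for u
  proof (rule F_lim)
    note [measurable] = borel_measurable_integrable[OF F_integrable[OF u]]
    show "(\<lambda>x. G i x * u x) \<in> F" for i
      using G u unfolding multipliers_def by auto
    show "integrable (torus n) (\<lambda>x. g x * u x)"
      using gB by (intro integrable_bounded_mult F_integrable u) auto
    have "(\<lambda>i. LINT x|torus n. cmod (G i x * u x - g x * u x)) \<longlonglongrightarrow> (LINT x|torus n. 0)"
    proof (rule integral_dominated_convergence)
      show "integrable (torus n) (\<lambda>x. (B + C) * cmod (u x))"
        using F_integrable[OF u] by auto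
      show "AE x in torus n. (\<lambda>i. cmod (G i x * u x - g x * u x)) \<longlonglongrightarrow> 0"
        using lim
      proof eventually_elim
        case (elim x)
        then have "(\<lambda>i. cmod (G i x * u x - g x * u x)) \<longlonglongrightarrow> cmod (g x * u x - g x * u x)"
          by (intro tendsto_intros)
        then show ?case by simp
      qed
      show "AE x in torus n. norm (cmod (G i x * u x - g x * u x)) \<le> (B + C) * cmod (u x)" for i
      proof (rule AE_I2)
        fix x
        have "cmod (G i x - g x) \<le> B + C"
          using B gB by (rule norm_triangle_le_diff[OF add_mono])
        then show "norm (cmod (G i x * u x - g x * u x)) \<le> (B + C) * cmod (u x)"
          by (simp add: norm_mult mult_right_mono flip: left_diff_distrib)
      qed
    qed measurable
    then show "(\<lambda>i. LINT x|torus n. cmod (G i x * u x - g x * u x)) \<longlonglongrightarrow> 0" by simp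
  qed
  then show ?thesis using g gB unfolding multipliers_def by auto
qed

lemma norm_indicator_le_1: "cmod (indicator A x) \<le> 1"
  by (simp add: indicator_def)

text \<open>A constant sequence converges almost everywhere to any function equal to it almost
  everywhere, so this is a case of \<open>multipliers_lim\<close>.\<close>

lemma multipliers_AE_cong:
  assumes "h \<in> multipliers" "g \<in> borel_measurable (torus n)" "\<And>x. cmod (g x) \<le> C"
    "AE x in torus n. h x = g x"
  shows "g \<in> multipliers"
proof -
  from assms obtain B where "\<And>x. cmod (h x) \<le> B"
    unfolding multipliers_def by auto
  then show ?thesis
    using assms by (intro multipliers_lim[of "\<lambda>_. h" B g C]) (auto elim: eventually_mono)
qed

text \<open>Only the linear case has content: on the circle a real-linear form is a combination of
  \<open>cis t\<close> and \<open>cis (- t)\<close>, the two multipliers that the locale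
  provides.\<close>

lemma multipliers_polynomial:
  assumes "real_polynomial_function h" "j < n"
  shows "(\<lambda>x. of_real (h (cis (x j)))) \<in> multipliers"
  using assms(1)
proof induction
  case (linear h)
  interpret bounded_linear h by fact
  have "h (cis t) = cos t * h 1 + sin t * h \<i>" for t
  proof -
    have "cis t = cos t *\<^sub>R 1 + sin t *\<^sub>R \<i>" by (simp add: complex_eq_iff)
    then show ?thesis by (simp only: add scaleR real_scaleR_def)
  qed
  \<comment> \<open>Euler's formulas for cos and sin, collected by exponentials.\<close>
  then have eq: "complex_of_real (h (cis t)) =
     (of_real (h 1) / 2 - \<i> * of_real (h \<i>) / 2) * cis t + (of_real (h 1) / 2 + \<i> * of_real (h \<i>) / 2) * cis (- t)" for t
    by (simp add: complex_eq_iff)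
  have "(\<lambda>x. cis (x j)) \<in> multipliers" "(\<lambda>x. cis (- x j)) \<in> multipliers"
    using \<open>j < n\<close> unfolding multipliers_def by (auto intro!: F_cis F_cis_minus exI[of _ 1])
  then show ?case
    unfolding eq by (intro multipliers_add multipliers_scale)
qed (auto intro: multipliers_const multipliers_add multipliers_mult)

text \<open>Stone-Weierstrass on the circle; approximation errors below 1 give the uniform bound
  \<open>B + 1\<close>.\<close>

lemma multipliers_continuous:
  fixes h :: "complex \<Rightarrow> real"
  assumes h: "continuous_on UNIV h" and j: "j < n"
  shows "(\<lambda>x. of_real (h (cis (x j)))) \<in> multipliers"
proof -
  have hs: "continuous_on (sphere 0 1) h"
    using h continuous_on_subset by blast
  have "\<exists>p. real_polynomial_function p \<and> (\<forall>z\<in>sphere 0 1. \<bar>h z - p z\<bar> < 1 / Suc i)" for i :: nat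
    by (rule Stone_Weierstrass_real_polynomial_function[OF compact_sphere hs, of "1 / Suc i"]) (simp, blast)
  then obtain p where p: "\<And>i. real_polynomial_function (p i)"
    and pe: "\<And>i z. z \<in> sphere 0 1 \<Longrightarrow> \<bar>h z - p i z\<bar> < 1 / Suc i"
    by metis
  obtain B where B: "\<And>z. z \<in> sphere 0 1 \<Longrightarrow> \<bar>h z\<bar> \<le> B"
    using compact_imp_bounded[OF compact_continuous_image[OF hs compact_sphere]]
    by (force simp: bounded_iff)
  note [measurable] = coordinate_measurable[OF j]
  have [measurable]: "h \<in> borel_measurable borel" by (rule borel_measurable_continuous_onI[OF h])
  show ?thesis
  proof (rule multipliers_lim)
    show "(\<lambda>x. of_real (p i (cis (x j)))) \<in> multipliers" for i
      by (rule multipliers_polynomial[OF p j])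
    show "cmod (of_real (p i (cis (x j)))) \<le> B + 1" for i and x :: "nat \<Rightarrow> real"
    proof -
      have "\<bar>h (cis (x j)) - p i (cis (x j))\<bar> < 1 / Suc i" using pe by simp
      also have "\<dots> \<le> 1" by simp
      finally show ?thesis using B[of "cis (x j)"] by simp
    qed
    show "(\<lambda>x. complex_of_real (h (cis (x j)))) \<in> borel_measurable (torus n)"
      by measurable
    show "cmod (of_real (h (cis (x j)))) \<le> B" for x :: "nat \<Rightarrow> real"
      using B by simp
    have "(\<lambda>i. p i (cis (x j))) \<longlonglongrightarrow> h (cis (x j))" for x :: "nat \<Rightarrow> real"
    proof (rule Lim_transform[of "\<lambda>_. h (cis (x j))"])
      show "(\<lambda>i. p i (cis (x j)) - h (cis (x j))) \<longlonglongrightarrow> 0"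
        using pe[of "cis (x j)"]
        by (intro LIMSEQ_norm_0) (auto simp: abs_minus_commute)
    qed auto
    then show "AE x in torus n. (\<lambda>i. complex_of_real (p i (cis (x j)))) \<longlonglongrightarrow> of_real (h (cis (x j)))"
      by (auto intro!: tendsto_of_real)
  qed
qed

text \<open>The indicator of a closed set is the pointwise limit of the continuous tent functions
  \<open>h i\<close>, which fall to 0 at distance \<open>1 / i\<close> from the set.\<close>

lemma multipliers_closed:
  assumes C: "closed C" and j: "j < n"
  shows "(\<lambda>x. indicator C (cis (x j))) \<in> multipliers"
\<comment> \<open>\<open>infdist\<close> to the empty set is 0 by convention, so the tent functions
  would converge to 1 there.\<close>
proof (cases "C = {}")
  case True
  then show ?thesis using multipliers_const[of 0] by simp
next
  case False
  define h where "h i z = max 0 (1 - real i * infdist z C)" for i z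
  have h01: "0 \<le> h i z" "h i z \<le> 1" for i z by (auto simp: h_def infdist_nonneg)
  have lim: "(\<lambda>i. h i z) \<longlonglongrightarrow> indicator C z" for z
  proof (cases "z \<in> C")
    case True
    then show ?thesis using False by (simp add: h_def)
  next
    case z: False
    then have d: "infdist z C > 0"
      using in_closed_iff_infdist_zero[OF C False, of z] infdist_nonneg[of z C] by auto
    then obtain N where N: "real N * infdist z C > 1"
      using reals_Archimedean3 by blast
    have "h i z = 0" if "i \<ge> N" for i
    proof -
      have "real N * infdist z C \<le> real i * infdist z C"
        using that d by (intro mult_right_mono) auto
      then show ?thesis using N by (simp add: h_def)
    qed
    then have "eventually (\<lambda>i. h i z = 0) sequentially"
      by (auto simp: eventually_sequentially)
    then show ?thesis using z by (simp add: tendsto_eventually)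
  qed
  have [measurable]: "C \<in> sets borel" using C by auto
  note [measurable] = coordinate_measurable[OF j]
  show ?thesis
  proof (rule multipliers_lim)
    show "(\<lambda>x. of_real (h i (cis (x j)))) \<in> multipliers" for i
      by (rule multipliers_continuous[OF _ j]) (auto simp: h_def intro!: continuous_intros)
    show "cmod (of_real (h i (cis (x j)))) \<le> 1" for i and x :: "nat \<Rightarrow> real"
      using h01 by simp
    show "(\<lambda>x. indicator C (cis (x j))) \<in> borel_measurable (torus n)"
      by measurable
    show "cmod (indicator C (cis (x j))) \<le> 1" for x :: "nat \<Rightarrow> real"
      by (simp add: indicator_def)
    show "AE x in torus n. (\<lambda>i. complex_of_real (h i (cis (x j)))) \<longlonglongrightarrow> indicator C (cis (x j))"
      using tendsto_of_real[OF lim, where ?'a = complex]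
      by (intro AE_I2) (simp add: of_real_indicator)
  qed
qed

lemma multipliers_compl:
  assumes "(\<lambda>x. indicator A (f x)) \<in> multipliers"
  shows "(\<lambda>x. indicator (- A) (f x)) \<in> multipliers"
proof -
  have "(\<lambda>x. 1 + (-1) * indicator A (f x)) \<in> multipliers"
    by (intro multipliers_add multipliers_scale multipliers_const assms)
  also have "(\<lambda>x. 1 + (-1) * indicator A (f x)) = (\<lambda>x. indicator (- A) (f x) :: complex)"
    by (auto simp: indicator_def)
  finally show ?thesis .
qed

text \<open>By disjointness the partial sums are again indicators, hence bounded by 1. The map
  \<open>f\<close> lets the lemma serve both for sets of coordinates and for subsets of the
  torus.\<close>

lemma multipliers_disjoint_UN:
  assumes A: "\<And>i::nat. (\<lambda>x. indicator (A i) (f x)) \<in> multipliers" and disj: "disjoint_family A"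
    and m: "(\<lambda>x. indicator (\<Union>i. A i) (f x) :: complex) \<in> borel_measurable (torus n)"
  shows "(\<lambda>x. indicator (\<Union>i. A i) (f x)) \<in> multipliers"
proof -
  have eq: "(\<Sum>i<m. indicator (A i) y) = (indicator (\<Union>i<m. A i) y :: complex)" for m y
    using disj by (subst indicator_UN_disjoint) (auto simp: disjoint_family_on_def)
  have 1: "(\<lambda>x. \<Sum>i<m. indicator (A i) (f x)) \<in> multipliers" for m
    by (induction m) (auto intro: multipliers_const multipliers_add A)
  show ?thesis
  proof (rule multipliers_lim)
    show "(\<lambda>x. indicator (\<Union>i<m. A i) (f x)) \<in> multipliers" for m
      using 1[of m] by (simp add: eq)
    show "AE x in torus n. (\<lambda>m. indicator (\<Union>i<m. A i) (f x)) \<longlonglongrightarrow> (indicator (\<Union>i. A i) (f x) :: complex)"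
    proof (rule AE_I2)
      fix x
      show "(\<lambda>m. indicator (\<Union>i<m. A i) (f x)) \<longlonglongrightarrow> (indicator (\<Union>i. A i) (f x) :: complex)"
        by (rule LIMSEQ_indicator_UN)
    qed
  qed (use m in \<open>auto simp: indicator_def\<close>)
qed

text \<open>Half-lines generate the Borel sets. Up to a null set the angle lies in [0, 2 pi), where
  \<open>cis\<close> is injective, so a half-line of angles is the preimage of a closed set of the
  circle.\<close>

lemma multipliers_borel:
  assumes B: "B \<in> sets borel" and j: "j < n"
  shows "(\<lambda>x. indicator B (x j)) \<in> multipliers"
proof -
  note [measurable] = coordinate_measurable[OF j]
  have gen: "sets (borel :: real measure) = sigma_sets UNIV (range (\<lambda>a. {..a}))"
    by (subst borel_eq_atMost) auto
  have st: "Int_stable (range (\<lambda>a::real. {..a}))"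
    by (auto simp: Int_stable_def)
  from B have "B \<in> sigma_sets UNIV (range (\<lambda>a. {..a}))" using gen by simp
  with st subset_UNIV[of "range (\<lambda>a::real. {..a})", folded Pow_UNIV] show ?thesis
  proof (induction rule: sigma_sets_induct_disjoint)
    case (basic A)
    then obtain a where a: "A = {..a}" by auto
    define C where "C = cis ` ({0..2*pi} \<inter> {..a})"
    have "compact ({0..2*pi} \<inter> {..a})" by (intro compact_Int_closed) auto
    then have "closed C"
      unfolding C_def by (intro compact_imp_closed compact_continuous_image continuous_intros)
    \<comment> \<open>Below 2 pi the angles defining \<open>C\<close> never include 2 pi, which
      \<open>cis\<close> would identify with 0; from 2 pi on, the half-line contains almost every
      angle.\<close>
    define C' where "C' = (if a \<ge> 2*pi then UNIV else C)"
    have "closed C'" using \<open>closed C\<close> by (simp add: C'_def)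
    have *: "cis t \<in> C' \<longleftrightarrow> t \<le> a" if t: "0 \<le> t" "t < 2*pi" for t
    proof (cases "a \<ge> 2*pi")
      case False
      have "t = s" if "cis t = cis s" "0 \<le> s" "s \<le> a" for s
      proof -
        have "cos t = cos s" "sin t = sin s" using that by (auto simp: complex_eq_iff)
        then obtain i :: int where i: "t = s + 2 * pi * i"
          using sin_cos_eq_iff[of t s] by auto
        have "\<bar>2*pi * i\<bar> < 2 * pi" using t that False i by auto
        then have "i = 0" by (simp add: abs_mult)
        then show ?thesis using i by simp
      qed
      then show ?thesis using t False by (auto simp: C'_def C_def)
    qed (use t in \<open>auto simp: C'_def\<close>)
    show ?case
    proof (rule multipliers_AE_cong[OF multipliers_closed[OF \<open>closed C'\<close> j]])
      show "AE x in torus n. indicator C' (cis (x j)) = (indicator A (x j) :: complex)"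
        using AE_torus_coordinate[OF j] by eventually_elim (use * a in \<open>auto simp: indicator_def\<close>)
      show "(\<lambda>x. indicator A (x j) :: complex) \<in> borel_measurable (torus n)"
        unfolding a by measurable
    qed (auto simp: indicator_def)
  next
    case empty
    show ?case using multipliers_const[of 0] by simp
  next
    case (compl A)
    then show ?case using multipliers_compl[of A] by (simp add: Compl_eq_Diff_UNIV)
  next
    case (union A)
    then have [measurable]: "A i \<in> sets borel" for i using gen by blast
    have "(\<lambda>x. indicator (\<Union>i. A i) (x j) :: complex) \<in> borel_measurable (torus n)"
      by (rule measurable_compose[OF coordinate_measurable[OF j]]) measurable
    then show ?case using union by (intro multipliers_disjoint_UN) auto
  qed
qed

text \<open>The indicator of a box is the product of its coordinate indicators; boxes form an
  intersection-stable generator, so induction over disjoint unions and complements reaches all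
  measurable sets.\<close>

lemma multipliers_indicator:
  assumes A: "A \<in> sets (torus n)"
  shows "(\<lambda>x. indicator A x) \<in> multipliers"
proof -
  let ?B = "\<lambda>_::nat. borel :: real measure"
  have gen: "sets (torus n) = sigma_sets (space (torus n)) (prod_algebra {..<n} ?B)"
    by (simp add: sets_torus space_torus sets_PiM)
  \<comment> \<open>Complements are relative to the space of extensional functions, whereas
    \<open>multipliers_compl\<close> complements in the whole type; the two agree on the
    space.\<close>
  have space: "(\<lambda>x. indicator (space (torus n) - A) x) \<in> multipliers"
    if "A \<in> sets (torus n)" "(\<lambda>x. indicator A x) \<in> multipliers" for A
  proof (rule multipliers_AE_cong[OF multipliers_compl[OF that(2)]])
    show "(indicator (space (torus n) - A) :: _ \<Rightarrow> complex) \<in> borel_measurable (torus n)"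
      using that(1) by measurable
    show "AE x in torus n. indicator (- A) x = (indicator (space (torus n) - A) x :: complex)"
      by (rule AE_I2) (simp add: indicator_def)
  qed (rule norm_indicator_le_1)
  have sub: "prod_algebra {..<n} ?B \<subseteq> Pow (space (torus n))"
    using prod_algebra_sets_into_space[of "{..<n}" ?B] by (simp add: space_torus)
  from A have "A \<in> sigma_sets (space (torus n)) (prod_algebra {..<n} ?B)" using gen by simp
  with Int_stable_prod_algebra sub show ?thesis
  proof (induction rule: sigma_sets_induct_disjoint)
    case (basic A)
    then obtain X where X: "A = PiE {..<n} X" "\<And>j. j < n \<Longrightarrow> X j \<in> sets borel"
      by (auto simp: prod_algebra_eq_finite)
    have m: "(\<lambda>x. \<Prod>j<n. indicator (X j) (x j)) \<in> multipliers"
      using X by (intro multipliers_prod multipliers_borel) auto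
    have "A \<in> sets (torus n)" using basic gen by auto
    show ?case
    proof (rule multipliers_AE_cong[OF m])
      show "AE x in torus n. (\<Prod>j<n. indicator (X j) (x j)) = (indicator A x :: complex)"
      proof (rule AE_I2)
        fix x assume "x \<in> space (torus n)"
        then show "(\<Prod>j<n. indicator (X j) (x j)) = (indicator A x :: complex)"
          by (auto simp: space_torus X(1) indicator_def PiE_iff intro: prod.neutral)
      qed
    qed (use \<open>A \<in> sets (torus n)\<close> in \<open>auto simp: indicator_def\<close>)
  next
    case empty
    show ?case using multipliers_const[of 0] by simp
  next
    case (compl A)
    then show ?case using space gen by blast
  next
    case (union A)
    then have [measurable]: "A i \<in> sets (torus n)" for i using gen by blast
    show ?case using union by (intro multipliers_disjoint_UN) auto
  qed
qed

lemma mult_indicator_in: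
  "u \<in> F \<Longrightarrow> A \<in> sets (torus n) \<Longrightarrow> (\<lambda>x. indicator A x * u x) \<in> F"
  using multipliers_indicator unfolding multipliers_def by auto

text \<open>Once \<open>F\<close> contains 1 it contains all simple functions, which are dense in
  L1. The factor 3 below comes from the bound \<open>2 * norm (f x)\<close> on the
  approximants.\<close>

lemma integrable_in:
  assumes one: "(\<lambda>_. 1) \<in> F" and u: "integrable (torus n) u"
  shows "u \<in> F"
  using u
proof (induction rule: integrable_induct)
  case (base A c)
  have "(\<lambda>x. c * (indicator A x * 1)) \<in> F"
    using base by (intro F_scale mult_indicator_in one)
  also have "(\<lambda>x. c * (indicator A x * 1)) = (\<lambda>x. indicat_real A x *\<^sub>R c)"
    by (auto simp: indicator_def)
  finally show ?case .
next
  case (add f g)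
  then show ?case by (intro F_add)
next
  case (lim f s)
  show ?case
  proof (rule F_lim[of s])
    show "s i \<in> F" for i by (rule lim)
    note [measurable] = borel_measurable_integrable[OF lim(1)] borel_measurable_integrable[OF lim(4)]
    have "(\<lambda>i. LINT x|torus n. cmod (s i x - f x)) \<longlonglongrightarrow> (LINT x|torus n. 0)"
    proof (rule integral_dominated_convergence)
      show "integrable (torus n) (\<lambda>x. 3 * cmod (f x))" using lim(4) by auto
      show "AE x in torus n. (\<lambda>i. cmod (s i x - f x)) \<longlonglongrightarrow> 0"
        using lim(2) by (auto intro!: AE_I2 tendsto_norm_zero LIM_zero)
      show "AE x in torus n. norm (cmod (s i x - f x)) \<le> 3 * cmod (f x)" for i
      proof (rule AE_I2)
        fix x assume "x \<in> space (torus n)"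
        then have "norm (s i x) \<le> 2 * norm (f x)" by (rule lim(3))
        then show "norm (cmod (s i x - f x)) \<le> 3 * cmod (f x)"
          using norm_triangle_ineq4[of "s i x" "f x"] by simp
      qed
    qed measurable
    then show "(\<lambda>i. LINT x|torus n. cmod (s i x - f x)) \<longlonglongrightarrow> 0" by simp
  qed fact
qed

end

section \<open>Functions with vanishing Fourier coefficients\<close>

lemma integrable_mult_monom:
  "integrable (torus n) u \<Longrightarrow> integrable (torus n) (\<lambda>x. monom n k x * u x)"
  "integrable (torus n) u \<Longrightarrow> integrable (torus n) (\<lambda>x. u x * cnj (monom n k x))"
  using integrable_bounded_mult[of "monom n k" "torus n" u 1]
    integrable_bounded_mult[of "\<lambda>x. cnj (monom n k x)" "torus n" u 1]
  by (auto simp: mult.commute)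

lemma fourier_mult_cis:
  assumes "j < n"
  shows "fourier n (\<lambda>x. cis (x j) * u x) k = fourier n u (\<lambda>i. k i - (if i = j then 1 else 0))"
    and "fourier n (\<lambda>x. cis (- x j) * u x) k = fourier n u (\<lambda>i. k i - (if i = j then -1 else 0))"
  using monom_unit[OF assms, of 1] monom_unit[OF assms, of "-1"]
  unfolding fourier_def by (simp_all add: monom_diff mult_ac cis_cnj)

text \<open>The functions with all coefficients zero form an \<open>L1_module\<close>, since
  multiplying by a character only shifts the coefficients. So \<open>f\<close> times any indicator
  stays in it, and its zeroth coefficient says that \<open>f\<close> has integral 0 over every
  measurable set.\<close>

lemma fourier_zero_imp_AE_zero:
  assumes f: "integrable (torus n) f" and z: "\<And>k. fourier n f k = 0"
  shows "AE x in torus n. f x = 0"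
proof -
  define F where "F = {u. integrable (torus n) u \<and> (\<forall>k. fourier n u k = 0)}"
  interpret L1_module n F
  proof
    fix u v assume "u \<in> F" "v \<in> F"
    then show "(\<lambda>x. u x + v x) \<in> F"
      by (auto simp: F_def fourier_def ring_distribs integrable_mult_monom)
  next
    fix u c assume "u \<in> F" then show "(\<lambda>x. c * u x) \<in> F"
      by (auto simp: F_def fourier_def mult.assoc)
  next
    fix U :: "nat \<Rightarrow> (nat \<Rightarrow> real) \<Rightarrow> complex" and u
    assume U: "\<And>i. U i \<in> F" and u: "integrable (torus n) u"
      and lim: "(\<lambda>i. LINT x|torus n. cmod (U i x - u x)) \<longlonglongrightarrow> 0"
    have Ui: "integrable (torus n) (U i)" for i using U by (simp add: F_def)
    have "fourier n u k = 0" for k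
    proof -
      have "cmod (fourier n u k) \<le> (LINT x|torus n. cmod (U i x - u x))" for i
      proof -
        have "fourier n u k = fourier n u k - fourier n (U i) k" using U by (simp add: F_def)
        also have "\<dots> = (LINT x|torus n. (u x - U i x) * cnj (monom n k x))"
          using Ui u by (simp add: fourier_def left_diff_distrib integrable_mult_monom)
        also have "cmod \<dots> \<le> (LINT x|torus n. cmod ((u x - U i x) * cnj (monom n k x)))"
          by (rule integral_norm_bound)
        finally show ?thesis by (simp add: norm_mult norm_minus_commute)
      qed
      then have "cmod (fourier n u k) \<le> 0"
        by (intro LIMSEQ_le_const[OF lim]) auto
      then show ?thesis by simp
    qed
    then show "u \<in> F" using u by (simp add: F_def)
  next
    fix u j assume "u \<in> F" and j: "j < n"
    then have "integrable (torus n) u" by (simp add: F_def)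
    then have "integrable (torus n) (\<lambda>x. cis (x j) * u x)" "integrable (torus n) (\<lambda>x. cis (- x j) * u x)"
      using j by (auto intro!: integrable_bounded_mult[where B=1])
    then show "(\<lambda>x. cis (x j) * u x) \<in> F" "(\<lambda>x. cis (- x j) * u x) \<in> F"
      using \<open>u \<in> F\<close> j by (auto simp: F_def fourier_mult_cis)
  qed (simp add: F_def)
  have "f \<in> F" using f z by (simp add: F_def)
  show ?thesis
  proof (rule torus.density_zero[OF f])
    fix A assume "A \<in> sets (torus n)"
    then have "(\<lambda>x. indicator A x * f x) \<in> F" by (rule mult_indicator_in[OF \<open>f \<in> F\<close>])
    then have "fourier n (\<lambda>x. indicator A x * f x) (\<lambda>_. 0) = 0" by (simp add: F_def)
    then show "set_lebesgue_integral (torus n) A f = 0"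
      by (simp add: fourier_def set_lebesgue_integral_def scaleR_conv_of_real of_real_indicator)
  qed
qed

section \<open>The Hilbert space structure of \<open>L2\<close>\<close>

lemma L2_measurable [measurable_dest]: "f \<in> L2 n \<Longrightarrow> f \<in> borel_measurable (torus n)"
  by (simp add: L2_def)

lemma L2_square_integrable: "f \<in> L2 n \<Longrightarrow> integrable (torus n) (\<lambda>x. (cmod (f x))\<^sup>2)"
  by (simp add: L2_def)

lemma L2_mult_integrable:
  assumes [measurable]: "f \<in> L2 n" "g \<in> L2 n"
  shows "integrable (torus n) (\<lambda>x. f x * g x)"
proof (rule Bochner_Integration.integrable_bound)
  show "integrable (torus n) (\<lambda>x. (cmod (f x))\<^sup>2 + (cmod (g x))\<^sup>2)"
    using assms by (intro Bochner_Integration.integrable_add L2_square_integrable)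
  have "a * b \<le> a\<^sup>2 + b\<^sup>2" if "a \<ge> 0" "b \<ge> 0" for a b :: real
  proof -
    have "2 * a * b \<le> a\<^sup>2 + b\<^sup>2" "0 \<le> a * b"
      using sum_squares_bound[of a b] that by auto
    then show ?thesis by simp
  qed
  then show "AE x in torus n. cmod (f x * g x) \<le> norm ((cmod (f x))\<^sup>2 + (cmod (g x))\<^sup>2)"
    by (auto simp: norm_mult)
qed measurable

lemma L2_bounded:
  assumes [measurable]: "f \<in> borel_measurable (torus n)" and "AE x in torus n. cmod (f x) \<le> B"
  shows "f \<in> L2 n"
proof -
  have "AE x in torus n. norm ((cmod (f x))\<^sup>2) \<le> B\<^sup>2"
    using assms(2) by eventually_elim (simp add: power_mono)
  then have "integrable (torus n) (\<lambda>x. (cmod (f x))\<^sup>2)"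
    by (intro torus.integrable_const_bound) auto
  then show ?thesis by (simp add: L2_def)
qed

lemma L2_const: "(\<lambda>_. c) \<in> L2 n"
  by (rule L2_bounded[where B="cmod c"]) auto

lemma L2_monom: "monom n k \<in> L2 n"
  by (rule L2_bounded[where B=1]) auto

lemma L2_integrable: "f \<in> L2 n \<Longrightarrow> integrable (torus n) f"
  using L2_mult_integrable[OF _ L2_const[of 1]] by simp

lemma L2_cnj: "f \<in> L2 n \<Longrightarrow> (\<lambda>x. cnj (f x)) \<in> L2 n"
  by (auto simp: L2_def)

lemma L2_scale: "f \<in> L2 n \<Longrightarrow> (\<lambda>x. c * f x) \<in> L2 n"
  by (auto simp: L2_def norm_mult power_mult_distrib)

lemma L2_add:
  assumes "f \<in> L2 n" "g \<in> L2 n"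
  shows "(\<lambda>x. f x + g x) \<in> L2 n"
proof -
  note [measurable] = assms
  have "integrable (torus n) (\<lambda>x. (cmod (f x + g x))\<^sup>2)"
  proof (rule Bochner_Integration.integrable_bound)
    show "integrable (torus n) (\<lambda>x. 2 * (cmod (f x))\<^sup>2 + 2 * (cmod (g x))\<^sup>2)"
      using assms by (intro Bochner_Integration.integrable_add integrable_mult_right L2_square_integrable)
    show "AE x in torus n. norm ((cmod (f x + g x))\<^sup>2) \<le> norm (2 * (cmod (f x))\<^sup>2 + 2 * (cmod (g x))\<^sup>2)"
    proof (rule AE_I2)
      fix x
      have "(cmod (f x + g x))\<^sup>2 \<le> (cmod (f x) + cmod (g x))\<^sup>2"
        by (intro power_mono norm_triangle_ineq) auto
      also have "\<dots> \<le> 2 * (cmod (f x))\<^sup>2 + 2 * (cmod (g x))\<^sup>2"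
        using sum_squares_bound[of "cmod (f x)" "cmod (g x)"] by (simp add: power2_sum)
      finally show "norm ((cmod (f x + g x))\<^sup>2) \<le> norm (2 * (cmod (f x))\<^sup>2 + 2 * (cmod (g x))\<^sup>2)"
        by simp
    qed
  qed measurable
  then show ?thesis by (simp add: L2_def)
qed

lemma L2_diff: "f \<in> L2 n \<Longrightarrow> g \<in> L2 n \<Longrightarrow> (\<lambda>x. f x - g x) \<in> L2 n"
  using L2_add[OF _ L2_scale[of g n "-1"]] by simp

lemma L2_bounded_mult:
  assumes g: "g \<in> borel_measurable (torus n)" "AE x in torus n. cmod (g x) \<le> B" and f: "f \<in> L2 n"
  shows "(\<lambda>x. g x * f x) \<in> L2 n"
proof -
  note [measurable] = g(1) f
  have "integrable (torus n) (\<lambda>x. (cmod (g x * f x))\<^sup>2)"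
  proof (rule Bochner_Integration.integrable_bound)
    show "integrable (torus n) (\<lambda>x. B\<^sup>2 * (cmod (f x))\<^sup>2)"
      using f by (intro integrable_mult_right L2_square_integrable)
    show "AE x in torus n. norm ((cmod (g x * f x))\<^sup>2) \<le> norm (B\<^sup>2 * (cmod (f x))\<^sup>2)"
      using g(2) by eventually_elim (simp add: norm_mult power_mult_distrib mult_right_mono power_mono)
  qed measurable
  then show ?thesis by (simp add: L2_def)
qed

lemma L2_zc_mult: "j < n \<Longrightarrow> f \<in> L2 n \<Longrightarrow> (\<lambda>x. zc j x * f x) \<in> L2 n"
  by (rule L2_bounded_mult[where B=1]) auto

lemma L2_monom_mult: "f \<in> L2 n \<Longrightarrow> (\<lambda>x. monom n k x * f x) \<in> L2 n"
  by (rule L2_bounded_mult[where B=1]) auto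

lemma l2inner_integrable:
  "f \<in> L2 n \<Longrightarrow> g \<in> L2 n \<Longrightarrow> integrable (torus n) (\<lambda>x. f x * cnj (g x))"
  by (intro L2_mult_integrable L2_cnj)

lemma l2inner_add_left:
  "f \<in> L2 n \<Longrightarrow> g \<in> L2 n \<Longrightarrow> h \<in> L2 n \<Longrightarrow> l2inner n (\<lambda>x. f x + g x) h = l2inner n f h + l2inner n g h"
  by (simp add: l2inner_def ring_distribs l2inner_integrable)

lemma l2inner_diff_left:
  "f \<in> L2 n \<Longrightarrow> g \<in> L2 n \<Longrightarrow> h \<in> L2 n \<Longrightarrow> l2inner n (\<lambda>x. f x - g x) h = l2inner n f h - l2inner n g h"
  by (simp add: l2inner_def left_diff_distrib l2inner_integrable)

lemma l2inner_scale_left: "l2inner n (\<lambda>x. c * f x) h = c * l2inner n f h"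
  by (simp add: l2inner_def mult.assoc)

lemma l2inner_commute: "l2inner n g f = cnj (l2inner n f g)"
  unfolding l2inner_def by (subst Bochner_Integration.integral_cnj[symmetric]) (simp add: mult.commute)

lemma l2inner_add_right:
  "f \<in> L2 n \<Longrightarrow> g \<in> L2 n \<Longrightarrow> h \<in> L2 n \<Longrightarrow> l2inner n h (\<lambda>x. f x + g x) = l2inner n h f + l2inner n h g"
  using l2inner_add_left[of f n g h] by (simp add: l2inner_commute[of n h])

lemma l2inner_diff_right:
  "f \<in> L2 n \<Longrightarrow> g \<in> L2 n \<Longrightarrow> h \<in> L2 n \<Longrightarrow> l2inner n h (\<lambda>x. f x - g x) = l2inner n h f - l2inner n h g"
  using l2inner_diff_left[of f n g h] by (simp add: l2inner_commute[of n h])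

lemma l2inner_scale_right: "l2inner n h (\<lambda>x. c * f x) = cnj c * l2inner n h f"
  using l2inner_scale_left[of n c f h] by (simp add: l2inner_commute[of n h])

lemma l2norm_nonneg: "0 \<le> l2norm n f"
  by (simp add: l2norm_def)

lemma l2norm_power2: "(l2norm n f)\<^sup>2 = (LINT x|torus n. (cmod (f x))\<^sup>2)"
  by (simp add: l2norm_def)

lemma l2inner_self: "l2inner n f f = of_real ((l2norm n f)\<^sup>2)"
proof -
  have "f x * cnj (f x) = of_real ((cmod (f x))\<^sup>2)" for x
    using complex_norm_square[of "f x"] by simp
  then show ?thesis
    by (simp add: l2norm_power2 l2inner_def del: of_real_power)
qed

lemma l2norm_scale: "l2norm n (\<lambda>x. c * f x) = cmod c * l2norm n f"
  by (simp add: l2norm_def norm_mult power_mult_distrib real_sqrt_mult)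

lemma l2norm_diff_commute: "l2norm n (\<lambda>x. f x - g x) = l2norm n (\<lambda>x. g x - f x)"
  by (simp add: l2norm_def norm_minus_commute)

lemma l2inner_cong_AE:
  assumes "f \<in> L2 n" "f' \<in> L2 n" "g \<in> L2 n" "g' \<in> L2 n" "aeq n f f'" "aeq n g g'"
  shows "l2inner n f g = l2inner n f' g'"
  unfolding l2inner_def
proof (rule integral_cong_AE)
  show "AE x in torus n. f x * cnj (g x) = f' x * cnj (g' x)"
    using assms(5,6) unfolding aeq_def by eventually_elim simp
qed (use assms in measurable)

lemma l2norm_eq_0_iff:
  assumes "f \<in> L2 n"
  shows "l2norm n f = 0 \<longleftrightarrow> aeq n f (\<lambda>_. 0)"
  unfolding l2norm_def aeq_def real_sqrt_eq_0_iff
  using integral_nonneg_eq_0_iff_AE[OF L2_square_integrable[OF assms]] by simp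

lemma l2norm_add_power2:
  assumes "f \<in> L2 n" "g \<in> L2 n"
  shows "(l2norm n (\<lambda>x. f x + g x))\<^sup>2 = (l2norm n f)\<^sup>2 + 2 * Re (l2inner n f g) + (l2norm n g)\<^sup>2"
proof -
  have "of_real ((l2norm n (\<lambda>x. f x + g x))\<^sup>2) = l2inner n f f + l2inner n f g + (l2inner n g f + l2inner n g g)"
    unfolding l2inner_self[symmetric] using assms by (simp add: l2inner_add_left l2inner_add_right L2_add)
  then have "complex_of_real ((l2norm n (\<lambda>x. f x + g x))\<^sup>2) = of_real ((l2norm n f)\<^sup>2) + l2inner n f g + (cnj (l2inner n f g) + of_real ((l2norm n g)\<^sup>2))"
    by (simp only: l2inner_self l2inner_commute[of n g f])
  from arg_cong[OF this, of Re] show ?thesis by simp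
qed

lemma l2norm_diff_power2:
  assumes "f \<in> L2 n" "g \<in> L2 n"
  shows "(l2norm n (\<lambda>x. f x - g x))\<^sup>2 = (l2norm n f)\<^sup>2 - 2 * Re (l2inner n f g) + (l2norm n g)\<^sup>2"
  using l2norm_add_power2[OF assms(1) L2_scale[OF assms(2), of "-1"]]
  by (simp add: l2inner_scale_right[of n f "-1" g, simplified] l2norm_scale[of n "-1" g, simplified])

text \<open>Pythagoras after removing the component of \<open>f\<close> along \<open>h\<close>. Both
  the Cauchy-Schwarz inequality and the orthogonality of minimal vectors are read off from
  it.\<close>

lemma l2norm_diff_component:
  assumes "f \<in> L2 n" "h \<in> L2 n" "l2norm n h \<noteq> 0"
  shows "(l2norm n (\<lambda>x. f x - l2inner n f h / of_real ((l2norm n h)\<^sup>2) * h x))\<^sup>2 =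
    (l2norm n f)\<^sup>2 - (cmod (l2inner n f h))\<^sup>2 / (l2norm n h)\<^sup>2"
proof -
  define a b where "a = l2inner n f h" and "b = (l2norm n h)\<^sup>2"
  have b: "b \<noteq> 0" using assms by (simp add: b_def)
  have "Re (l2inner n f (\<lambda>x. a / of_real b * h x)) = Re (cnj a * a / of_real b)"
    by (subst l2inner_scale_right) (simp add: a_def)
  also have "\<dots> = (cmod a)\<^sup>2 / b"
    by (simp only: cmod_power2) (simp add: power2_eq_square add_divide_distrib)
  finally have 1: "Re (l2inner n f (\<lambda>x. a / of_real b * h x)) = (cmod a)\<^sup>2 / b" .
  have 2: "(l2norm n (\<lambda>x. a / of_real b * h x))\<^sup>2 = (cmod a)\<^sup>2 / b"
  proof -
    have "(l2norm n (\<lambda>x. a / of_real b * h x))\<^sup>2 = (cmod (a / of_real b))\<^sup>2 * b"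
      by (subst l2norm_scale) (simp add: power_mult_distrib b_def)
    also have "\<dots> = (cmod a)\<^sup>2 / b"
      using b by (simp add: norm_divide power_divide) (simp add: power2_eq_square)
    finally show ?thesis .
  qed
  show ?thesis
    unfolding a_def[symmetric] b_def[symmetric]
    unfolding l2norm_diff_power2[OF assms(1) L2_scale[OF assms(2), of "a / of_real b"]] 1 2 by simp
qed

lemma l2_Cauchy_Schwarz:
  assumes "f \<in> L2 n" "h \<in> L2 n"
  shows "cmod (l2inner n f h) \<le> l2norm n f * l2norm n h"
proof (cases "l2norm n h = 0")
  case True
  then have "aeq n h (\<lambda>_. 0)" using assms by (simp add: l2norm_eq_0_iff)
  then have "l2inner n f h = l2inner n f (\<lambda>_. 0)"
    using assms by (intro l2inner_cong_AE L2_const) (auto simp: aeq_def)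
  then show ?thesis using True by (simp add: l2inner_def)
next
  case False
  then have pos: "(l2norm n h)\<^sup>2 > 0" by simp
  have "0 \<le> (l2norm n f)\<^sup>2 - (cmod (l2inner n f h))\<^sup>2 / (l2norm n h)\<^sup>2"
    using l2norm_diff_component[OF assms False] zero_le_power2 by metis
  then have "(cmod (l2inner n f h))\<^sup>2 \<le> (l2norm n f * l2norm n h)\<^sup>2"
    using pos by (simp add: field_simps)
  then show ?thesis
    by (rule power2_le_imp_le) (simp add: l2norm_nonneg)
qed

text \<open>Taking for \<open>t\<close> the coefficient of \<open>d\<close> along \<open>h\<close>
  would strictly shorten \<open>d\<close> unless the inner product were 0.\<close>

lemma l2inner_eq_0_if_minimal:
  assumes "d \<in> L2 n" "h \<in> L2 n" and min: "\<And>t. l2norm n d \<le> l2norm n (\<lambda>x. d x - t * h x)"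
  shows "l2inner n d h = 0"
proof (cases "l2norm n h = 0")
  case True
  then show ?thesis using l2_Cauchy_Schwarz[OF assms(1,2)] by simp
next
  case False
  have "(l2norm n d)\<^sup>2 \<le> (l2norm n d)\<^sup>2 - (cmod (l2inner n d h))\<^sup>2 / (l2norm n h)\<^sup>2"
    unfolding l2norm_diff_component[OF assms(1,2) False, symmetric]
    by (intro power_mono min l2norm_nonneg)
  then show ?thesis using False by (simp add: divide_le_0_iff)
qed

lemma l2norm_triangle:
  assumes "f \<in> L2 n" "g \<in> L2 n"
  shows "l2norm n (\<lambda>x. f x + g x) \<le> l2norm n f + l2norm n g"
proof (rule power2_le_imp_le)
  have "Re (l2inner n f g) \<le> l2norm n f * l2norm n g"
    using complex_Re_le_cmod l2_Cauchy_Schwarz[OF assms] by (rule order_trans)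
  then show "(l2norm n (\<lambda>x. f x + g x))\<^sup>2 \<le> (l2norm n f + l2norm n g)\<^sup>2"
    by (simp add: l2norm_add_power2[OF assms] power2_sum)
qed (simp add: l2norm_nonneg)

lemma l2norm_triangle_diff:
  assumes "f \<in> L2 n" "g \<in> L2 n" "h \<in> L2 n"
  shows "l2norm n (\<lambda>x. f x - h x) \<le> l2norm n (\<lambda>x. f x - g x) + l2norm n (\<lambda>x. g x - h x)"
  using l2norm_triangle[of "\<lambda>x. f x - g x" n "\<lambda>x. g x - h x"] assms by (simp add: L2_diff)

text \<open>Cauchy-Schwarz against the constant 1, which has norm 1 because the measure is a
  probability.\<close>

lemma l1norm_le_l2norm:
  assumes "f \<in> L2 n"
  shows "l1norm n f \<le> l2norm n f"
proof -
  have abs: "(\<lambda>x. of_real (cmod (f x))) \<in> L2 n"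
    using assms by (auto simp: L2_def)
  have "l2inner n (\<lambda>x. of_real (cmod (f x))) (\<lambda>_. 1) = of_real (l1norm n f)"
    by (simp add: l2inner_def l1norm_def)
  moreover have "l1norm n f \<ge> 0" by (simp add: l1norm_def)
  moreover have "l2norm n (\<lambda>x. of_real (cmod (f x))) = l2norm n f" "l2norm n (\<lambda>_. 1) = 1"
    by (simp_all add: l2norm_def torus.prob_space)
  ultimately show ?thesis using l2_Cauchy_Schwarz[OF abs L2_const[of 1]] by simp
qed

text \<open>Written with the midpoint, because midpoints are what the convex sets below
  contain.\<close>

lemma l2_parallelogram:
  assumes "f \<in> L2 n" "g \<in> L2 n"
  shows "(l2norm n (\<lambda>x. f x - g x))\<^sup>2 =
    2 * (l2norm n f)\<^sup>2 + 2 * (l2norm n g)\<^sup>2 - 4 * (l2norm n (\<lambda>x. 1/2 * (f x + g x)))\<^sup>2"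
  by (simp only: l2norm_scale l2norm_diff_power2[OF assms] power_mult_distrib l2norm_add_power2[OF assms])
     (simp add: power_divide field_simps)

section \<open>Limits and completeness in \<open>L2\<close>\<close>

abbreviation l2lim :: "nat \<Rightarrow> (nat \<Rightarrow> (nat \<Rightarrow> real) \<Rightarrow> complex) \<Rightarrow> ((nat \<Rightarrow> real) \<Rightarrow> complex) \<Rightarrow> bool" where
  "l2lim n F f \<equiv> (\<lambda>k. l2norm n (\<lambda>x. F k x - f x)) \<longlonglongrightarrow> 0"

lemma l2lim_l2inner:
  assumes "\<And>k. F k \<in> L2 n" "f \<in> L2 n" "g \<in> L2 n" "l2lim n F f"
  shows "(\<lambda>k. l2inner n (F k) g) \<longlonglongrightarrow> l2inner n f g"
proof (rule Lim_transform[OF tendsto_const])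
  have "(\<lambda>k. l2norm n (\<lambda>x. F k x - f x) * l2norm n g) \<longlonglongrightarrow> 0"
    using assms(4) by (rule tendsto_mult_left_zero)
  then show "(\<lambda>k. l2inner n (F k) g - l2inner n f g) \<longlonglongrightarrow> 0"
  proof (rule Lim_null_comparison[rotated], intro always_eventually allI)
    fix k show "norm (l2inner n (F k) g - l2inner n f g) \<le> l2norm n (\<lambda>x. F k x - f x) * l2norm n g"
      using l2_Cauchy_Schwarz[OF L2_diff[OF assms(1)[of k] assms(2)] assms(3)] assms
      by (simp add: l2inner_diff_left)
  qed
qed

lemma l2lim_l2norm:
  assumes "\<And>k. F k \<in> L2 n" "f \<in> L2 n" "l2lim n F f"
  shows "(\<lambda>k. l2norm n (F k)) \<longlonglongrightarrow> l2norm n f"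
proof (rule Lim_transform[OF tendsto_const])
  show "(\<lambda>k. l2norm n (F k) - l2norm n f) \<longlonglongrightarrow> 0"
  proof (rule Lim_null_comparison[OF _ assms(3)], intro always_eventually allI)
    fix k 
    have "l2norm n (F k) \<le> l2norm n (\<lambda>x. F k x - f x) + l2norm n f"
      using l2norm_triangle[OF L2_diff[OF assms(1)[of k] assms(2)] assms(2)] by simp
    moreover have "l2norm n f \<le> l2norm n (\<lambda>x. F k x - f x) + l2norm n (F k)"
      using l2norm_triangle[OF L2_diff[OF assms(2) assms(1)[of k]] assms(1)[of k]]
      by (simp add: l2norm_diff_commute)
    ultimately show "norm (l2norm n (F k) - l2norm n f) \<le> l2norm n (\<lambda>x. F k x - f x)"
      by simp
  qed
qed

text \<open>By monotone convergence the sum of the series has finite integral, hence is finite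
  almost everywhere.\<close>

lemma AE_summable_L1:
  fixes G :: "nat \<Rightarrow> 'a \<Rightarrow> real"
  assumes int: "\<And>i. integrable M (G i)" and nonneg: "\<And>i x. 0 \<le> G i x"
    and bnd: "\<And>i. (LINT x|M. G i x) \<le> b i" and b: "summable b"
  shows "AE x in M. summable (\<lambda>i. G i x)"
proof -
  note [measurable] = borel_measurable_integrable[OF int]
  have "(\<integral>\<^sup>+x. (\<Sum>i. ennreal (G i x)) \<partial>M) = (\<Sum>i. \<integral>\<^sup>+x. ennreal (G i x) \<partial>M)"
    by (rule nn_integral_suminf) measurable
  also have "\<dots> = (\<Sum>i. ennreal (LINT x|M. G i x))"
    using int nonneg by (subst nn_integral_eq_integral) auto
  also have "\<dots> \<le> (\<Sum>i. ennreal (b i))"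
    by (intro suminf_le ennreal_leI bnd) auto
  also have "\<dots> = ennreal (\<Sum>i. b i)"
  proof (rule suminf_ennreal2)
    have "0 \<le> (LINT x|M. G i x)" for i using nonneg by (intro Bochner_Integration.integral_nonneg)
    then show "0 \<le> b i" for i using bnd order_trans by blast
  qed fact
  finally have "(\<integral>\<^sup>+x. (\<Sum>i. ennreal (G i x)) \<partial>M) \<noteq> \<infinity>"
    using ennreal_less_top[of "\<Sum>i. b i"] by (auto simp: top_unique)
  then have "AE x in M. (\<Sum>i. ennreal (G i x)) \<noteq> \<infinity>"
    by (intro nn_integral_PInf_AE) measurable
  then show ?thesis
    by eventually_elim (auto intro: summable_suminf_not_top nonneg)
qed

text \<open>Riesz-Fischer: a rapidly convergent subsequence supplies the pointwise limit, and
  Fatou's lemma shows that the whole sequence converges to it in norm.\<close>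

lemma l2_complete:
  assumes F: "\<And>k. F k \<in> L2 n"
    and Cauchy: "\<And>e. e > 0 \<Longrightarrow> \<exists>N. \<forall>i\<ge>N. \<forall>k\<ge>N. l2norm n (\<lambda>x. F i x - F k x) < e"
  obtains f where "f \<in> L2 n" "l2lim n F f"
proof -
  note [measurable] = F
  \<comment> \<open>Increments below \<open>(1/2)^i\<close> are summable. In its construction,
    summing the thresholds and adding \<open>j\<close> makes \<open>r\<close> strictly increasing
    while keeping it above each threshold.\<close>
  obtain r where r: "strict_mono r"
    "\<And>i m k. m \<ge> r i \<Longrightarrow> k \<ge> r i \<Longrightarrow> l2norm n (\<lambda>x. F m x - F k x) < (1/2)^i"
  proof -
    have "\<exists>N. \<forall>i\<ge>N. \<forall>k\<ge>N. l2norm n (\<lambda>x. F i x - F k x) < (1/2)^j" for j :: nat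
      by (rule Cauchy) simp
    then obtain N where N: "\<And>j i k. i \<ge> N j \<Longrightarrow> k \<ge> N j \<Longrightarrow> l2norm n (\<lambda>x. F i x - F k x) < (1/2)^j"
      by metis
    define r where "r j = (\<Sum>i\<le>j. N i) + j" for j
    have "strict_mono r" by (rule strict_monoI_Suc) (simp add: r_def)
    moreover have "N j \<le> r j" for j
      unfolding r_def by (rule trans_le_add1, rule member_le_sum) auto
    ultimately show ?thesis using N by (intro that[of r]) (meson order_trans)+
  qed
  have "AE x in torus n. summable (\<lambda>i. cmod (F (r (Suc i)) x - F (r i) x))"
  proof (rule AE_summable_L1[where b="\<lambda>i. (1/2)^i"])
    show "integrable (torus n) (\<lambda>x. cmod (F (r (Suc i)) x - F (r i) x))" for i
      using F by (intro integrable_norm L2_integrable L2_diff)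
    show "(LINT x|torus n. cmod (F (r (Suc i)) x - F (r i) x)) \<le> (1/2)^i" for i
    proof -
      have "(LINT x|torus n. cmod (F (r (Suc i)) x - F (r i) x)) \<le> l2norm n (\<lambda>x. F (r (Suc i)) x - F (r i) x)"
        using l1norm_le_l2norm[OF L2_diff[OF F F]] by (simp add: l1norm_def)
      also have "\<dots> < (1/2)^i"
        using r(1) by (intro r(2)) (auto simp: strict_mono_less_eq)
      finally show ?thesis by simp
    qed
  qed auto
  then have conv: "AE x in torus n. convergent (\<lambda>i. F (r i) x)"
  proof eventually_elim
    case (elim x)
    then have "summable (\<lambda>i. F (r (Suc i)) x - F (r i) x)" by (rule summable_norm_cancel)
    then have "convergent (\<lambda>m. \<Sum>i<m. F (r (Suc i)) x - F (r i) x)"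
      by (simp add: summable_iff_convergent)
    then have "convergent (\<lambda>m. F (r m) x - F (r 0) x)"
      using sum_lessThan_telescope[of "\<lambda>i. F (r i) x"] by simp
    then have "convergent (\<lambda>m. (F (r m) x - F (r 0) x) + F (r 0) x)"
      by (intro convergent_add convergent_const)
    then show ?case by simp
  qed
  \<comment> \<open>Where the subsequence diverges \<open>lim\<close> is unspecified, but this is a
    null set.\<close>
  define f where "f x = lim (\<lambda>i. F (r i) x)" for x
  have f[measurable]: "f \<in> borel_measurable (torus n)"
    unfolding f_def by measurable
  have lim: "AE x in torus n. (\<lambda>i. F (r i) x) \<longlonglongrightarrow> f x"
    using conv by eventually_elim (simp add: f_def convergent_LIMSEQ_iff)
  \<comment> \<open>Fatou along the subsequence, with \<open>m\<close> any index beyond the Cauchy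
    threshold; finiteness of the integral also gives membership in \<open>L2\<close>.\<close>
  have key: "(\<lambda>x. F m x - f x) \<in> L2 n \<and> l2norm n (\<lambda>x. F m x - f x) \<le> e"
    if m: "m \<ge> N" and N: "\<And>i k. i \<ge> N \<Longrightarrow> k \<ge> N \<Longrightarrow> l2norm n (\<lambda>x. F i x - F k x) < e" for m N e
  proof -
    have e: "e > 0" using N[of N N] l2norm_nonneg[of n] by (meson le_less_trans order_refl)
    have "(\<integral>\<^sup>+x. ennreal ((cmod (F m x - f x))\<^sup>2) \<partial>torus n) =
       (\<integral>\<^sup>+x. liminf (\<lambda>i. ennreal ((cmod (F m x - F (r i) x))\<^sup>2)) \<partial>torus n)"
    proof (rule nn_integral_cong_AE)
      show "AE x in torus n. ennreal ((cmod (F m x - f x))\<^sup>2) = liminf (\<lambda>i. ennreal ((cmod (F m x - F (r i) x))\<^sup>2))"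
        using lim
      proof eventually_elim
        case (elim x)
        then have "(\<lambda>i. ennreal ((cmod (F m x - F (r i) x))\<^sup>2)) \<longlonglongrightarrow> ennreal ((cmod (F m x - f x))\<^sup>2)"
          by (intro tendsto_intros tendsto_ennrealI)
        then show ?case by (intro lim_imp_Liminf[symmetric]) auto
      qed
    qed
    also have "\<dots> \<le> liminf (\<lambda>i. \<integral>\<^sup>+x. ennreal ((cmod (F m x - F (r i) x))\<^sup>2) \<partial>torus n)"
      by (rule nn_integral_liminf) measurable
    also have "\<dots> \<le> liminf (\<lambda>i. ennreal (e\<^sup>2))"
    proof (rule Liminf_mono)
      show "\<forall>\<^sub>F i in sequentially. (\<integral>\<^sup>+x. ennreal ((cmod (F m x - F (r i) x))\<^sup>2) \<partial>torus n) \<le> ennreal (e\<^sup>2)"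
        using eventually_ge_at_top[of N]
      proof eventually_elim
        case (elim i)
        then have "r i \<ge> N" using seq_suble[OF r(1), of i] by simp
        have "(\<integral>\<^sup>+x. ennreal ((cmod (F m x - F (r i) x))\<^sup>2) \<partial>torus n) = ennreal ((l2norm n (\<lambda>x. F m x - F (r i) x))\<^sup>2)"
          unfolding l2norm_power2
          by (intro nn_integral_eq_integral L2_square_integrable L2_diff F) auto
        also have "\<dots> \<le> ennreal (e\<^sup>2)"
          using N[OF m \<open>r i \<ge> N\<close>] by (intro ennreal_leI power_mono l2norm_nonneg) auto
        finally show ?case .
      qed
    qed
    also have "\<dots> = ennreal (e\<^sup>2)" by (simp add: Liminf_const)
    finally have le: "(\<integral>\<^sup>+x. ennreal ((cmod (F m x - f x))\<^sup>2) \<partial>torus n) \<le> ennreal (e\<^sup>2)" .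
    then have "(\<integral>\<^sup>+x. ennreal ((cmod (F m x - f x))\<^sup>2) \<partial>torus n) < \<infinity>"
      unfolding infinity_ennreal_def by (rule le_less_trans[OF _ ennreal_less_top])
    then have "integrable (torus n) (\<lambda>x. (cmod (F m x - f x))\<^sup>2)"
      by (intro integrableI_bounded) auto
    then have L: "(\<lambda>x. F m x - f x) \<in> L2 n" by (simp add: L2_def)
    have "ennreal ((l2norm n (\<lambda>x. F m x - f x))\<^sup>2) \<le> ennreal (e\<^sup>2)"
      using le unfolding l2norm_power2
      using nn_integral_eq_integral[OF L2_square_integrable[OF L]] by simp
    then have "(l2norm n (\<lambda>x. F m x - f x))\<^sup>2 \<le> e\<^sup>2" by simp
    then have "l2norm n (\<lambda>x. F m x - f x) \<le> e" by (rule power2_le_imp_le[OF _ less_imp_le[OF e]])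
    with L show ?thesis by simp
  qed
  show ?thesis
  proof
    obtain N where "\<And>i k. i \<ge> N \<Longrightarrow> k \<ge> N \<Longrightarrow> l2norm n (\<lambda>x. F i x - F k x) < 1"
      using Cauchy[of 1] by auto
    then have "(\<lambda>x. F N x - f x) \<in> L2 n" using key[of N N] by blast
    from L2_diff[OF F[of N] this] show "f \<in> L2 n" by simp
    show "l2lim n F f"
    proof (rule LIMSEQ_I)
      fix e :: real assume "e > 0"
      then obtain N where N: "\<And>i k. i \<ge> N \<Longrightarrow> k \<ge> N \<Longrightarrow> l2norm n (\<lambda>x. F i x - F k x) < e / 2"
        using Cauchy[of "e / 2"] by auto
      have "l2norm n (\<lambda>x. F m x - f x) < e" if "m \<ge> N" for m
        using key[OF that N] \<open>e > 0\<close> by fastforce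
      then show "\<exists>N. \<forall>m\<ge>N. norm (l2norm n (\<lambda>x. F m x - f x) - 0) < e"
        by (auto simp: l2norm_nonneg intro!: exI[of _ N])
    qed
  qed
qed

section \<open>Convex sets and projections\<close>

text \<open>The infima \<open>s m\<close> of the squared norms increase and are bounded, hence form
  a Cauchy sequence; by the parallelogram law near-minimizers are then Cauchy as well. The sets need
  not be closed, so the limit is delivered together with the approximating points.\<close>

lemma l2_nested_convex:
  fixes C :: "nat \<Rightarrow> ((nat \<Rightarrow> real) \<Rightarrow> complex) set"
  assumes L2: "\<And>m. C m \<subseteq> L2 n" and dec: "decseq C" and ne: "\<And>m. C m \<noteq> {}"
    and mid: "\<And>m f g. f \<in> C m \<Longrightarrow> g \<in> C m \<Longrightarrow> (\<lambda>x. 1/2 * (f x + g x)) \<in> C m"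
    and bnd: "\<And>f. f \<in> C 0 \<Longrightarrow> l2norm n f \<le> B"
  obtains c d where "\<And>m. c m \<in> C m" "d \<in> L2 n" "l2lim n c d"
proof -
  define s where "s m = (INF f\<in>C m. (l2norm n f)\<^sup>2)" for m
  have bdd: "bdd_below ((\<lambda>f. (l2norm n f)\<^sup>2) ` C m)" for m
    by (rule bdd_belowI[of _ 0]) auto
  have s_le: "s m \<le> (l2norm n f)\<^sup>2" if "f \<in> C m" for f m
    unfolding s_def by (rule cINF_lower[OF bdd that])
  have "\<exists>f\<in>C m. (l2norm n f)\<^sup>2 < s m + 1 / Suc m" for m
    using cInf_lessD[of "(\<lambda>f. (l2norm n f)\<^sup>2) ` C m" "s m + 1 / Suc m"] ne[of m]
    unfolding s_def by auto
  then obtain c where c: "\<And>m. c m \<in> C m" and cs: "\<And>m. (l2norm n (c m))\<^sup>2 < s m + 1 / Suc m"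
    by metis
  have sub: "C k \<subseteq> C m" if "m \<le> k" for m k using dec that by (auto simp: decseq_def)
  have "incseq s"
    unfolding incseq_def s_def using sub ne bdd by (auto intro!: cINF_superset_mono)
  moreover have "s m \<le> B\<^sup>2" for m
  proof -
    have "s m \<le> (l2norm n (c m))\<^sup>2" by (rule s_le[OF c])
    also have "\<dots> \<le> B\<^sup>2"
      using bnd[of "c m"] c[of m] sub[of 0 m] by (intro power_mono l2norm_nonneg) auto
    finally show ?thesis .
  qed
  ultimately have "convergent s"
    unfolding convergent_def using incseq_convergent[of s "B\<^sup>2"] by metis
  then have Cs: "Cauchy s" by (rule convergent_Cauchy)
  have cL: "c m \<in> L2 n" for m using c L2 by auto
  \<comment> \<open>For \<open>m \<le> k\<close> both points lie in \<open>C m\<close>, so their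
    midpoint has squared norm at least \<open>s m\<close>. The tolerances \<open>1 / Suc m\<close>
    and \<open>1 / Suc k\<close>, each doubled, add up to at most \<open>4 / Suc m\<close>.\<close>
  have est: "(l2norm n (\<lambda>x. c m x - c k x))\<^sup>2 \<le> 2 * (s k - s m) + 4 / Suc m" if "m \<le> k" for m k
  proof -
    have "c k \<in> C m" using c[of k] sub[OF that] by auto
    then have "s m \<le> (l2norm n (\<lambda>x. 1/2 * (c m x + c k x)))\<^sup>2"
      by (intro s_le mid c)
    moreover have "1 / real (Suc k) \<le> 1 / real (Suc m)"
      using that by (simp add: frac_le)
    \<comment> \<open>The arithmetic is stated for plain real variables so that linear reasoning
      does not meet the norms.\<close>
    moreover have "t \<le> 2 * (u - v) + 4 * e" 
      if "v \<le> h" "e' \<le> e" "t = 2 * a + 2 * b - 4 * h" "a < v + e" "b < u + e'"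
      for v h e e' t a b u :: real
      using that by argo
    ultimately have "(l2norm n (\<lambda>x. c m x - c k x))\<^sup>2 \<le> 2 * (s k - s m) + 4 * (1 / Suc m)"
      using l2_parallelogram[OF cL[of m] cL[of k]] cs[of m] cs[of k] by blast
    then show ?thesis by simp
  qed
  have cau: "\<exists>N. \<forall>i\<ge>N. \<forall>k\<ge>N. l2norm n (\<lambda>x. c i x - c k x) < e" if e: "e > 0" for e
  proof -
    have e2: "e\<^sup>2 > 0" using e by simp
    obtain N1 where N1: "\<And>i k. i \<ge> N1 \<Longrightarrow> k \<ge> N1 \<Longrightarrow> \<bar>s i - s k\<bar> < e\<^sup>2 / 4"
      using Cs e2 unfolding Cauchy_def dist_real_def by (meson zero_less_divide_iff zero_less_numeral)
    obtain N2 where N2: "inverse (real (Suc N2)) < e\<^sup>2 / 8"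
      using reals_Archimedean[of "e\<^sup>2 / 8"] e2 by auto
    have *: "l2norm n (\<lambda>x. c m x - c k x) < e" if "m \<le> k" "m \<ge> max N1 N2" for m k
    proof -
      have "4 / real (Suc m) \<le> 4 * inverse (real (Suc N2))"
        using that by (simp add: divide_inverse)
      then have "(l2norm n (\<lambda>x. c m x - c k x))\<^sup>2 < e\<^sup>2"
      proof -
        have "s k - s m < e\<^sup>2 / 4" by (rule le_less_trans[OF abs_ge_self N1]) (use that in auto)
        moreover have "t < E" if "t \<le> 2 * d + q" "q \<le> 4 * i" "d < E / 4" "i < E / 8" for t d q i E :: real
          using that by argo
        ultimately show ?thesis
          using est[OF that(1)] N2 \<open>4 / real (Suc m) \<le> 4 * inverse (real (Suc N2))\<close> by blast
      qed
      then show ?thesis by (rule power2_less_imp_less[OF _ less_imp_le[OF e]])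
    qed
    show ?thesis
    proof (intro exI[of _ "max N1 N2"] allI impI)
      fix i k assume "max N1 N2 \<le> i" "max N1 N2 \<le> k"
      then show "l2norm n (\<lambda>x. c i x - c k x) < e"
        using *[of i k] *[of k i] l2norm_diff_commute[of n "c i" "c k"] by (cases "i \<le> k") auto
    qed
  qed
  obtain d where "d \<in> L2 n" "l2lim n c d"
    by (rule l2_complete[OF cL cau])
  then show ?thesis using c that by blast
qed

text \<open>The points of \<open>C\<close> with norm within \<open>1 / Suc m\<close> of the infimum
  form nested convex sets, to which the preceding lemma applies. The minimizer \<open>d\<close>
  belongs to the closure of \<open>C\<close> and possibly not to \<open>C\<close>.\<close>

lemma l2_minimal_norm:
  assumes L2: "C \<subseteq> L2 n" and ne: "C \<noteq> {}"
    and mid: "\<And>f g. f \<in> C \<Longrightarrow> g \<in> C \<Longrightarrow> (\<lambda>x. 1/2 * (f x + g x)) \<in> C"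
  obtains c d where "\<And>m. c m \<in> C" "d \<in> L2 n" "l2lim n c d" "\<And>f. f \<in> C \<Longrightarrow> l2norm n d \<le> l2norm n f"
proof -
  define s where "s = (INF f\<in>C. l2norm n f)"
  have bdd: "bdd_below (l2norm n ` C)"
    by (rule bdd_belowI[of _ 0]) (auto simp: l2norm_nonneg)
  have s_le: "s \<le> l2norm n f" if "f \<in> C" for f
    unfolding s_def by (rule cINF_lower[OF bdd that])
  define D where "D m = {f \<in> C. l2norm n f \<le> s + 1 / Suc m}" for m :: nat
  have ne: "D m \<noteq> {}" for m
  proof -
    have "\<exists>f\<in>C. l2norm n f < s + 1 / Suc m"
      using cInf_lessD[of "l2norm n ` C" "s + 1 / Suc m"] ne unfolding s_def by auto
    then show ?thesis by (force simp: D_def)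
  qed
  have sub: "D m \<subseteq> L2 n" for m using L2 by (auto simp: D_def)
  have dec: "decseq D"
  proof (rule decseq_SucI)
    fix m
    have "1 / real (Suc (Suc m)) \<le> 1 / real (Suc m)" by (simp add: frac_le)
    then show "D (Suc m) \<le> D m" unfolding D_def by force
  qed
  have mid: "(\<lambda>x. 1/2 * (f x + g x)) \<in> D m" if "f \<in> D m" "g \<in> D m" for f g m
  proof -
    have "l2norm n (\<lambda>x. 1/2 * (f x + g x)) = 1/2 * l2norm n (\<lambda>x. f x + g x)"
      by (subst l2norm_scale) simp
    also have "\<dots> \<le> 1/2 * (l2norm n f + l2norm n g)"
      using that L2 by (intro mult_left_mono l2norm_triangle) (auto simp: D_def)
    finally show ?thesis using that mid by (auto simp: D_def)
  qed
  have bnd: "l2norm n f \<le> s + 1" if "f \<in> D 0" for f using that by (simp add: D_def)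
  obtain c d where c: "\<And>m. c m \<in> D m" and d: "d \<in> L2 n" "l2lim n c d"
    using l2_nested_convex[OF sub dec ne mid bnd] by blast
  have cC: "c m \<in> C" for m using c[of m] by (simp add: D_def)
  have "(\<lambda>m. l2norm n (c m)) \<longlonglongrightarrow> l2norm n d"
    using cC L2 d by (intro l2lim_l2norm) auto
  moreover have "(\<lambda>m. s + 1 / Suc m) \<longlonglongrightarrow> s + 0"
    by (intro tendsto_intros LIMSEQ_Suc lim_const_over_n)
  ultimately have "l2norm n d \<le> s + 0"
    by (rule LIMSEQ_le) (use c in \<open>auto simp: D_def\<close>)
  then have "l2norm n d \<le> l2norm n f" if "f \<in> C" for f using s_le[OF that] by simp
  then show ?thesis using that[of c d] cC d by blast
qed

section \<open>Closed subspaces and orthogonal projections\<close>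

lemma closed_subspaceD:
  assumes "closed_subspace n V"
  shows "V \<subseteq> L2 n" "(\<lambda>_. 0) \<in> V"
    "f \<in> V \<Longrightarrow> g \<in> V \<Longrightarrow> (\<lambda>x. f x + g x) \<in> V"
    "f \<in> V \<Longrightarrow> (\<lambda>x. c * f x) \<in> V"
    "f \<in> V \<Longrightarrow> g \<in> L2 n \<Longrightarrow> aeq n f g \<Longrightarrow> g \<in> V"
    "(\<And>k. F k \<in> V) \<Longrightarrow> f \<in> L2 n \<Longrightarrow> l2lim n F f \<Longrightarrow> f \<in> V"
  using assms unfolding closed_subspace_def by blast+

lemma closed_subspace_diff:
  assumes "closed_subspace n V" "f \<in> V" "g \<in> V"
  shows "(\<lambda>x. f x - g x) \<in> V"
  using closed_subspaceD(3)[OF assms(1,2) closed_subspaceD(4)[OF assms(1,3), of "-1"]] by simp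

text \<open>The vector of minimal norm in the closure of \<open>f - V\<close> is the residual:
  closedness of \<open>V\<close> puts \<open>f - d\<close> into \<open>V\<close>, and minimality
  along directions in \<open>V\<close> gives orthogonality.\<close>

lemma projection_exists:
  assumes V: "closed_subspace n V" and f: "f \<in> L2 n"
  obtains p where "is_proj n V f p"
proof -
  note VD = closed_subspaceD[OF V]
  define C where "C = (\<lambda>v x. f x - v x) ` V"
  have sub: "C \<subseteq> L2 n" using VD(1) f by (auto simp: C_def intro!: L2_diff)
  have ne: "C \<noteq> {}" using VD(2) by (auto simp: C_def)
  have mid: "(\<lambda>x. 1/2 * (a x + b x)) \<in> C" if ab: "a \<in> C" "b \<in> C" for a b
  proof -
    obtain v w where vw: "v \<in> V" "w \<in> V" "a = (\<lambda>x. f x - v x)" "b = (\<lambda>x. f x - w x)"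
      using ab by (auto simp: C_def)
    then have "(\<lambda>x. 1/2 * (v x + w x)) \<in> V" by (intro VD(3,4))
    then show ?thesis unfolding C_def
      by (rule rev_image_eqI) (auto simp: vw field_simps)
  qed
  obtain c d where c: "\<And>m. c m \<in> C" and d: "d \<in> L2 n" "l2lim n c d"
    and min: "\<And>g. g \<in> C \<Longrightarrow> l2norm n d \<le> l2norm n g"
    using l2_minimal_norm[OF sub ne mid] by blast
  obtain v where v: "\<And>m. v m \<in> V" "\<And>m. c m = (\<lambda>x. f x - v m x)"
    using c unfolding C_def image_iff by metis
  have "(\<lambda>x. f x - d x) \<in> V"
  proof (rule VD(6)[of v])
    have "l2norm n (\<lambda>x. v m x - (f x - d x)) = l2norm n (\<lambda>x. c m x - d x)" for m
      unfolding v(2) l2norm_def by (simp add: norm_minus_commute algebra_simps)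
    then show "l2lim n v (\<lambda>x. f x - d x)" using d by simp
  qed (use v d f in \<open>auto intro: L2_diff\<close>)
  moreover have "l2inner n d h = 0" if h: "h \<in> V" for h
  proof (rule l2inner_eq_0_if_minimal)
    show "l2norm n d \<le> l2norm n (\<lambda>x. d x - t * h x)" for t
    proof (rule min)
      have "(\<lambda>x. (f x - d x) + t * h x) \<in> V" by (intro VD(3,4) \<open>(\<lambda>x. f x - d x) \<in> V\<close> h)
      then show "(\<lambda>x. d x - t * h x) \<in> C"
        unfolding C_def by (rule rev_image_eqI) auto
    qed
  qed (use d h VD(1) in auto)
  ultimately show ?thesis by (intro that[of "\<lambda>x. f x - d x"]) (simp add: is_proj_def)
qed

lemma is_projD:
  assumes "closed_subspace n V" "is_proj n V f p" "f \<in> L2 n"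
  shows "p \<in> V" "p \<in> L2 n" "h \<in> V \<Longrightarrow> l2inner n (\<lambda>x. f x - p x) h = 0" "h \<in> V \<Longrightarrow> l2inner n p h = l2inner n f h"
proof -
  show p: "p \<in> V" "p \<in> L2 n" using assms closed_subspaceD(1)[OF assms(1)] by (auto simp: is_proj_def)
  show 0: "h \<in> V \<Longrightarrow> l2inner n (\<lambda>x. f x - p x) h = 0" using assms by (simp add: is_proj_def)
  then show "h \<in> V \<Longrightarrow> l2inner n p h = l2inner n f h"
    using p assms closed_subspaceD(1)[OF assms(1)] by (auto simp: l2inner_diff_left)
qed

lemma l2_diff_orthogonal_imp_aeq:
  assumes "f \<in> L2 n" "g \<in> L2 n" "l2inner n (\<lambda>x. f x - g x) (\<lambda>x. f x - g x) = 0"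
  shows "aeq n f g"
proof -
  have "l2norm n (\<lambda>x. f x - g x) = 0" using assms(3) by (simp add: l2inner_self)
  then have "aeq n (\<lambda>x. f x - g x) (\<lambda>_. 0)" using assms by (simp add: l2norm_eq_0_iff L2_diff)
  then show ?thesis by (simp add: aeq_def)
qed

lemma is_proj_unique:
  assumes V: "closed_subspace n V" and f: "f \<in> L2 n" and p: "is_proj n V f p" "is_proj n V f q"
  shows "aeq n p q"
proof (rule l2_diff_orthogonal_imp_aeq)
  note P = is_projD[OF V p(1) f] and Q = is_projD[OF V p(2) f]
  show "p \<in> L2 n" "q \<in> L2 n" by fact+
  have "(\<lambda>x. p x - q x) \<in> V" using P Q by (intro closed_subspace_diff[OF V])
  then show "l2inner n (\<lambda>x. p x - q x) (\<lambda>x. p x - q x) = 0"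
    using P Q by (simp add: l2inner_diff_left L2_diff)
qed

section \<open>Fourier coefficients as inner products\<close>

lemma fourier_eq_l2inner: "fourier n f k = l2inner n f (monom n k)"
  by (simp add: fourier_def l2inner_def)

lemma fourier_monom: "fourier n (monom n l) k = (if \<forall>j<n. l j = k j then 1 else 0)"
  unfolding fourier_def by (simp add: integral_monom flip: monom_diff)

lemma fourier_diff: "f \<in> L2 n \<Longrightarrow> g \<in> L2 n \<Longrightarrow> fourier n (\<lambda>x. f x - g x) k = fourier n f k - fourier n g k"
  by (simp add: fourier_eq_l2inner l2inner_diff_left L2_monom)

lemma fourier_cnj: "fourier n (\<lambda>x. cnj (f x)) k = cnj (fourier n f (\<lambda>j. - k j))"
  unfolding fourier_def by (subst Bochner_Integration.integral_cnj[symmetric]) (simp add: cnj_monom)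

lemma fourier_mult_monom: "fourier n (\<lambda>x. monom n l x * f x) k = fourier n f (\<lambda>j. k j - l j)"
  unfolding fourier_def by (simp add: monom_diff mult_ac)

lemma zc_eq_monom: "j < n \<Longrightarrow> zc j x = monom n (\<lambda>i. if i = j then 1 else 0) x"
  by (simp add: monom_unit zc_def)

text \<open>A common form for \<open>H2 n\<close> and for the auxiliary space in
  \<open>disjoint_spectra_orthogonal\<close>, so that closedness is proved once.\<close>

definition spectrum_off :: "nat \<Rightarrow> (nat \<Rightarrow> int) set \<Rightarrow> ((nat \<Rightarrow> real) \<Rightarrow> complex) set" where
  "spectrum_off n S = {f \<in> L2 n. \<forall>k\<in>S. fourier n f k = 0}"

lemma closed_subspace_orthogonal:
  assumes V: "closed_subspace n V" and S: "S \<subseteq> L2 n"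
  shows "closed_subspace n {f \<in> V. \<forall>g\<in>S. l2inner n f g = 0}"
  unfolding closed_subspace_def
proof (intro conjI ballI allI impI)
  note VD = closed_subspaceD[OF V]
  show "{f \<in> V. \<forall>g\<in>S. l2inner n f g = 0} \<subseteq> L2 n" using VD(1-2) by auto
  show "(\<lambda>_. 0) \<in> {f \<in> V. \<forall>g\<in>S. l2inner n f g = 0}" using VD(1-2) by (simp add: l2inner_def)
  fix f assume f: "f \<in> {f \<in> V. \<forall>g\<in>S. l2inner n f g = 0}"
  then have fL: "f \<in> L2 n" using VD(1-2) by auto
  show "(\<lambda>x. c * f x) \<in> {f \<in> V. \<forall>g\<in>S. l2inner n f g = 0}" for c
    using f VD(4) by (simp add: l2inner_scale_left)
  show "(\<lambda>x. f x + g x) \<in> {f \<in> V. \<forall>g\<in>S. l2inner n f g = 0}"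
    if g: "g \<in> {f \<in> V. \<forall>g\<in>S. l2inner n f g = 0}" for g
  proof -
    have "g \<in> L2 n" using g VD(1) by auto
    then show ?thesis using f g fL VD(3) S by (simp add: l2inner_add_left subset_iff)
  qed
  show "g \<in> {f \<in> V. \<forall>g\<in>S. l2inner n f g = 0}" if g: "g \<in> L2 n" "aeq n f g" for g
  proof -
    have "l2inner n g h = l2inner n f h" if "h \<in> S" for h
      using g fL that S by (intro l2inner_cong_AE) (auto simp: aeq_def)
    moreover have "g \<in> V" using VD(5)[OF _ g] f by blast
    ultimately show ?thesis using f by simp
  qed
next
  note VD = closed_subspaceD[OF V]
  fix F f assume F: "\<forall>k. F k \<in> {f \<in> V. \<forall>g\<in>S. l2inner n f g = 0}" and f: "f \<in> L2 n" "l2lim n F f"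
  have "f \<in> V" using VD(6)[OF _ f] F by blast
  moreover have "l2inner n f g = 0" if g: "g \<in> S" for g
  proof -
    have "(\<lambda>k. l2inner n (F k) g) \<longlonglongrightarrow> l2inner n f g"
      using F f g S VD(1) by (intro l2lim_l2inner) auto
    moreover have "(\<lambda>k. l2inner n (F k) g) = (\<lambda>_. 0)" using F g by auto
    ultimately show ?thesis using LIMSEQ_unique tendsto_const by metis
  qed
  ultimately show "f \<in> {f \<in> V. \<forall>g\<in>S. l2inner n f g = 0}" by simp
qed

lemma closed_subspace_L2: "closed_subspace n (L2 n)"
  by (simp add: closed_subspace_def L2_const L2_add L2_scale)

lemma closed_subspace_spectrum_off: "closed_subspace n (spectrum_off n S)"
  using closed_subspace_orthogonal[OF closed_subspace_L2, of "monom n ` S" n] L2_monom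
  by (auto simp: spectrum_off_def fourier_eq_l2inner)

lemma H2_eq_spectrum_off: "H2 n = spectrum_off n {k. \<exists>j<n. k j < 0}"
  by (auto simp: H2_def spectrum_off_def)

lemma closed_subspace_H2: "closed_subspace n (H2 n)"
  unfolding H2_eq_spectrum_off by (rule closed_subspace_spectrum_off)

lemma H2_L2: "f \<in> H2 n \<Longrightarrow> f \<in> L2 n"
  by (simp add: H2_def)

lemma fourier_zero_imp_aeq:
  "f \<in> L2 n \<Longrightarrow> (\<And>k. fourier n f k = 0) \<Longrightarrow> aeq n f (\<lambda>_. 0)"
  unfolding aeq_def by (intro fourier_zero_imp_AE_zero L2_integrable)

text \<open>Project \<open>g\<close> onto the functions whose spectrum lies in that of \<open>f\<close>: the
  projection has no Fourier coefficients left, so it vanishes.\<close>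

lemma disjoint_spectra_orthogonal:
  assumes f: "f \<in> L2 n" and g: "g \<in> L2 n"
    and disj: "\<And>k. fourier n f k = 0 \<or> fourier n g k = 0"
  shows "l2inner n f g = 0"
proof -
  define V where "V = spectrum_off n {k. fourier n f k = 0}"
  have V: "closed_subspace n V" unfolding V_def by (rule closed_subspace_spectrum_off)
  have fV: "f \<in> V" using f by (simp add: V_def spectrum_off_def)
  obtain p where p: "is_proj n V g p" using projection_exists[OF V g] .
  note P = is_projD[OF V p g]
  have "fourier n p k = 0" for k
  proof (cases "fourier n f k = 0")
    case True
    then show ?thesis using P(1) by (simp add: V_def spectrum_off_def)
  next
    case False
    have "fourier n (monom n k) l = 0" if "fourier n f l = 0" for l
    proof (rule ccontr)
      assume "fourier n (monom n k) l \<noteq> 0"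
      then have "\<forall>j<n. k j = l j" by (auto simp: fourier_monom split: if_splits)
      then have "monom n k = monom n l" by (auto simp: monom_def fun_eq_iff)
      then show False using False that by (simp add: fourier_eq_l2inner)
    qed
    then have "monom n k \<in> V" by (simp add: V_def spectrum_off_def L2_monom)
    then show ?thesis using P(4) disj[of k] False by (simp add: fourier_eq_l2inner)
  qed
  then have "aeq n p (\<lambda>_. 0)" by (rule fourier_zero_imp_aeq[OF P(2)])
  then have "l2inner n p f = l2inner n (\<lambda>_. 0) f"
    using P(2) f by (intro l2inner_cong_AE L2_const) (auto simp: aeq_def)
  then have "l2inner n g f = 0" using P(4)[OF fV] by (simp add: l2inner_def)
  then show ?thesis by (simp add: l2inner_commute[of n f g])
qed

section \<open>Hardy spaces and Fejer means\<close>

text \<open>Multi-indices are functions on all naturals; their values from \<open>n\<close> on are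
  irrelevant.\<close>

lemma fourier_cong: "(\<And>j. j < n \<Longrightarrow> k j = l j) \<Longrightarrow> fourier n f k = fourier n f l"
  unfolding fourier_def monom_def by simp

text \<open>Induction on the total degree. It matches the hypotheses on quotient modules and module
  maps, which speak of single coordinates only.\<close>

lemma nonneg_monom_induct:
  assumes "\<forall>j<n. 0 \<le> k j" and base: "P (\<lambda>_. 1)"
    and step: "\<And>f j. j < n \<Longrightarrow> P f \<Longrightarrow> P (\<lambda>x. zc j x * f x)"
  shows "P (monom n k)"
  using assms(1)
proof (induction "\<Sum>j<n. nat (k j)" arbitrary: k)
  case 0
  then have "k j = 0" if "j < n" for j using that by force
  then have "monom n k = (\<lambda>_. 1)" by (simp add: monom_def fun_eq_iff)
  then show ?case using base by simp
next
  case (Suc m)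
  then have "\<exists>j<n. nat (k j) \<noteq> 0"
    by (metis lessThan_iff sum.neutral nat.distinct(1))
  then obtain j where j: "j < n" "k j > 0" by auto
  define l where "l = k(j := k j - 1)"
  have "(\<Sum>i<n. nat (k i)) = nat (k j) + (\<Sum>i\<in>{..<n} - {j}. nat (k i))"
    using j by (intro sum.remove) auto
  moreover have "(\<Sum>i<n. nat (l i)) = nat (l j) + (\<Sum>i\<in>{..<n} - {j}. nat (l i))"
    using j by (intro sum.remove) auto
  moreover have "(\<Sum>i\<in>{..<n} - {j}. nat (l i)) = (\<Sum>i\<in>{..<n} - {j}. nat (k i))"
    by (intro sum.cong) (auto simp: l_def)
  ultimately have "m = (\<Sum>i<n. nat (l i))" using Suc(2) j by (simp add: l_def)
  then have "P (monom n l)" using Suc j by (auto simp: l_def)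
  then have "P (\<lambda>x. zc j x * monom n l x)" by (rule step[OF j(1)])
  moreover have "monom n k = (\<lambda>x. zc j x * monom n l x)"
    unfolding zc_eq_monom[OF j(1)] monom_add[symmetric]
    by (rule ext, rule arg_cong[where f="\<lambda>k. monom n k _"]) (auto simp: l_def)
  ultimately show ?case by simp
qed

lemma fourier_H2_eq_0: "f \<in> H2 n \<Longrightarrow> j < n \<Longrightarrow> k j < 0 \<Longrightarrow> fourier n f k = 0"
  unfolding H2_def by blast

lemma H2_monom: "\<forall>j<n. 0 \<le> k j \<Longrightarrow> monom n k \<in> H2 n"
  by (force simp: H2_def L2_monom fourier_monom)

lemma H2_one: "(\<lambda>_. 1) \<in> H2 n"
  using H2_monom[of n "\<lambda>_. 0"] by simp

lemma H2_zc_mult: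
  assumes "j < n" "f \<in> H2 n"
  shows "(\<lambda>x. zc j x * f x) \<in> H2 n"
proof -
  have "fourier n (\<lambda>x. zc j x * f x) k = 0" if k: "\<exists>i<n. k i < 0" for k
  proof -
    have "\<exists>i<n. k i - (if i = j then 1 else 0) < 0" using k by force
    then show ?thesis
      using assms unfolding zc_eq_monom[OF assms(1)] fourier_mult_monom by (auto simp: H2_def)
  qed
  then show ?thesis using assms by (simp add: H2_def L2_zc_mult)
qed

lemma Hinf_ballD:
  assumes "\<phi> \<in> Hinf_ball n"
  shows "\<phi> \<in> H2 n" "\<phi> \<in> L2 n" "\<phi> \<in> borel_measurable (torus n)" "AE x in torus n. cmod (\<phi> x) \<le> 1"
  using assms by (auto simp: Hinf_ball_def H2_def L2_def)

lemma L2_Hinf_mult: "\<phi> \<in> Hinf_ball n \<Longrightarrow> f \<in> L2 n \<Longrightarrow> (\<lambda>x. \<phi> x * f x) \<in> L2 n"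
  by (intro L2_bounded_mult[where B=1] Hinf_ballD(3,4))

text \<open>The coefficient at \<open>k\<close> is the inner product of \<open>f\<close> shifted by
  \<open>- k\<close> with the conjugate of \<phi>. If \<open>k i < 0\<close>, the first has only
  positive exponents in coordinate \<open>i\<close> and the second only nonpositive ones.\<close>

lemma H2_Hinf_mult:
  assumes \<phi>: "\<phi> \<in> Hinf_ball n" and f: "f \<in> H2 n"
  shows "(\<lambda>x. \<phi> x * f x) \<in> H2 n"
proof -
  have "fourier n (\<lambda>x. \<phi> x * f x) k = 0" if k: "\<exists>i<n. k i < 0" for k
  proof -
    obtain i where i: "i < n" "k i < 0" using k by auto
    have "l2inner n (\<lambda>x. monom n (\<lambda>j. - k j) x * f x) (\<lambda>x. cnj (\<phi> x)) = 0"
    proof (rule disjoint_spectra_orthogonal)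
      fix l
      show "fourier n (\<lambda>x. monom n (\<lambda>j. - k j) x * f x) l = 0 \<or> fourier n (\<lambda>x. cnj (\<phi> x)) l = 0"
      proof (cases "l i > 0")
        case True
        then have "fourier n \<phi> (\<lambda>j. - l j) = 0"
          using fourier_H2_eq_0[OF Hinf_ballD(1)[OF \<phi>] i(1), of "\<lambda>j. - l j"] by simp
        then show ?thesis by (simp add: fourier_cnj)
      next
        case False
        then have "l i - - k i < 0" using i by simp
        then have "fourier n f (\<lambda>j. l j - - k j) = 0"
          using fourier_H2_eq_0[OF f i(1), of "\<lambda>j. l j - - k j"] by simp
        then show ?thesis unfolding fourier_mult_monom by simp
      qed
    qed (use \<phi> f in \<open>auto intro: L2_monom_mult L2_cnj H2_L2 Hinf_ballD(2)\<close>)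
    then show ?thesis
      by (simp add: fourier_def l2inner_def cnj_monom mult_ac)
  qed
  then show ?thesis using L2_Hinf_mult[OF \<phi> H2_L2[OF f]] by (simp add: H2_def)
qed

text \<open>The integral is the inner product of \<open>f\<close> with the conjugate of
  \<open>g\<close>; conjugation reflects the spectrum, so the hypothesis on \<open>g\<close> makes
  the two spectra disjoint.\<close>

lemma integral_H2_mult_eq_0:
  assumes f: "f \<in> H2 n" and g: "g \<in> L2 n" and z: "\<And>l. \<forall>j<n. l j \<le> 0 \<Longrightarrow> fourier n g l = 0"
  shows "(LINT x|torus n. f x * g x) = 0"
proof -
  have "l2inner n f (\<lambda>x. cnj (g x)) = 0"
  proof (rule disjoint_spectra_orthogonal)
    fix k show "fourier n f k = 0 \<or> fourier n (\<lambda>x. cnj (g x)) k = 0"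
    proof (cases "\<exists>j<n. k j < 0")
      case False
      then have "\<forall>j<n. - k j \<le> 0" by auto
      from z[OF this] show ?thesis by (simp add: fourier_cnj)
    qed (use f in \<open>auto simp: H2_def\<close>)
  qed (use f g in \<open>auto intro: H2_L2 L2_cnj\<close>)
  then show ?thesis by (simp add: l2inner_def)
qed

lemma integral_H2_mult_Mn: "f \<in> H2 n \<Longrightarrow> m \<in> Mn n \<Longrightarrow> (LINT x|torus n. f x * m x) = 0"
  by (rule integral_H2_mult_eq_0) (auto simp: Mn_def)

lemma integral_H2_mult_H2_0:
  assumes "f \<in> H2 n" "h \<in> H2_0 n" shows "(LINT x|torus n. f x * h x) = 0"
proof (rule integral_H2_mult_eq_0)
  show "h \<in> L2 n" using assms by (auto simp: H2_0_def H2_def)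
  fix l assume l: "\<forall>j<n. l j \<le> (0::int)"
  show "fourier n h l = 0"
  proof (cases "\<exists>j<n. l j < 0")
    case False
    then have "fourier n h l = fourier n h (\<lambda>_. 0)"
      using l by (intro fourier_cong) force
    then show ?thesis using assms by (simp add: H2_0_def)
  qed (use assms in \<open>auto simp: H2_0_def H2_def\<close>)
qed fact

text \<open>Reduces the functional on \<open>MQ n Q\<close> to inner products with \<open>Q\<close>,
  so two analytic symbols with equal inner products there define the same functional.\<close>

lemma integral_H2_mult_MQ:
  assumes g: "g \<in> H2 n" and q: "q \<in> L2 n" and m: "m \<in> Mn n" and h: "h \<in> H2_0 n"
  shows "(LINT x|torus n. g x * (cnj (q x) + m x + h x)) = l2inner n g q"
proof -
  have "m \<in> L2 n" "h \<in> L2 n" "g \<in> L2 n" using assms by (auto simp: Mn_def H2_0_def H2_def)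
  then have "(LINT x|torus n. g x * (cnj (q x) + m x + h x)) =
      l2inner n g q + (LINT x|torus n. g x * m x) + (LINT x|torus n. g x * h x)"
    using q by (simp add: l2inner_def ring_distribs L2_mult_integrable l2inner_integrable)
  then show ?thesis using integral_H2_mult_Mn[OF g m] integral_H2_mult_H2_0[OF g h] by simp
qed

section \<open>Weak convergence of bounded functions\<close>

lemma cmod_integral_bounded_mult:
  assumes "g \<in> borel_measurable (torus n)" "AE x in torus n. cmod (g x) \<le> 1" "integrable (torus n) u"
  shows "cmod (LINT x|torus n. g x * u x) \<le> (LINT x|torus n. cmod (u x))"
proof -
  have "cmod (LINT x|torus n. g x * u x) \<le> (LINT x|torus n. cmod (g x * u x))"
    by (rule integral_norm_bound)
  also have "\<dots> \<le> (LINT x|torus n. cmod (u x))"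
  proof (rule integral_mono_AE)
    show "AE x in torus n. cmod (g x * u x) \<le> cmod (u x)"
      using assms(2) by eventually_elim (simp add: norm_mult mult_left_le_one_le)
  qed (use assms in \<open>auto intro!: integrable_norm integrable_bounded_mult[where B=1]\<close>)
  finally show ?thesis .
qed

text \<open>The test functions for which convergence holds form an \<open>L1_module\<close>:
  closedness in L1 comes from the uniform bound 1 by an epsilon/3 argument. The hypothesis on
  coefficients puts 1 into it, hence every integrable function.\<close>

lemma bounded_weak_convergence:
  fixes S :: "nat \<Rightarrow> (nat \<Rightarrow> real) \<Rightarrow> complex"
  assumes S[measurable]: "\<And>N. S N \<in> borel_measurable (torus n)" and S1: "\<And>N. AE x in torus n. cmod (S N x) \<le> 1"
    and \<phi>[measurable]: "\<phi> \<in> borel_measurable (torus n)" and \<phi>1: "AE x in torus n. cmod (\<phi> x) \<le> 1"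
    and lim: "\<And>k. (\<lambda>N. fourier n (S N) k) \<longlonglongrightarrow> fourier n \<phi> k"
    and u: "integrable (torus n) u"
  shows "(\<lambda>N. LINT x|torus n. S N x * u x) \<longlonglongrightarrow> (LINT x|torus n. \<phi> x * u x)"
proof -
  define I where "I g k u = (LINT x|torus n. g x * (monom n k x * u x))" for g k and u :: "(nat \<Rightarrow> real) \<Rightarrow> complex"
  \<comment> \<open>Quantifying over all characters \<open>k\<close> builds invariance under shifts
    into the definition.\<close>
  define F where "F = {u. integrable (torus n) u \<and> (\<forall>k. (\<lambda>N. I (S N) k u) \<longlonglongrightarrow> I \<phi> k u)}"
  have int: "integrable (torus n) (\<lambda>x. g x * (monom n k x * u x))"
    if "g \<in> borel_measurable (torus n)" "AE x in torus n. cmod (g x) \<le> 1" "integrable (torus n) u" for g k u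
    using that by (intro integrable_bounded_mult[where B=1] integrable_mult_monom)
  have I_add: "I g k (\<lambda>x. u x + v x) = I g k u + I g k v"
    if "g \<in> borel_measurable (torus n)" "AE x in torus n. cmod (g x) \<le> 1" "integrable (torus n) u" "integrable (torus n) v" for g k u v
    unfolding I_def ring_distribs using that by (intro Bochner_Integration.integral_add int)
  have I_diff: "I g k (\<lambda>x. u x - v x) = I g k u - I g k v"
    if "g \<in> borel_measurable (torus n)" "AE x in torus n. cmod (g x) \<le> 1" "integrable (torus n) u" "integrable (torus n) v" for g k u v
    unfolding I_def right_diff_distrib using that by (intro Bochner_Integration.integral_diff int)
  have I_scale: "I g k (\<lambda>x. c * u x) = c * I g k u" for g k c u
    by (simp add: I_def mult.left_commute)
  have I_bound: "cmod (I g k u) \<le> (LINT x|torus n. cmod (u x))"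
    if "g \<in> borel_measurable (torus n)" "AE x in torus n. cmod (g x) \<le> 1" "integrable (torus n) u" for g k u
    using cmod_integral_bounded_mult[OF that(1,2) integrable_mult_monom(1)[OF that(3), of k]]
    by (simp add: I_def norm_mult)
  have shift: "(\<lambda>x. cis (of_int c * x j) * u x) \<in> F" if uF: "u \<in> F" and j: "j < n" for u j c
  proof -
    have eq: "I g k (\<lambda>x. cis (of_int c * x j) * u x) = I g (\<lambda>i. k i + (if i = j then c else 0)) u" for g k
      unfolding I_def monom_add monom_unit[OF j] by (simp add: mult_ac)
    have "integrable (torus n) (\<lambda>x. cis (of_int c * x j) * u x)"
      unfolding monom_unit[OF j, symmetric] using uF by (intro integrable_mult_monom) (simp add: F_def)
    then show ?thesis using uF by (simp add: F_def eq)
  qed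
  interpret L1_module n F
  proof
    fix u v assume uv: "u \<in> F" "v \<in> F"
    have "(\<lambda>N. I (S N) k u + I (S N) k v) \<longlonglongrightarrow> I \<phi> k u + I \<phi> k v" for k
      using uv by (intro tendsto_add) (auto simp: F_def)
    then show "(\<lambda>x. u x + v x) \<in> F" using uv by (simp add: F_def I_add[OF S S1] I_add[OF \<phi> \<phi>1])
  next
    fix u c assume "u \<in> F" then show "(\<lambda>x. c * u x) \<in> F"
      by (auto simp: F_def I_scale intro: tendsto_mult_left)
  next
    fix U :: "nat \<Rightarrow> (nat \<Rightarrow> real) \<Rightarrow> complex" and u
    assume U: "\<And>i. U i \<in> F" and u: "integrable (torus n) u"
      and Ulim: "(\<lambda>i. LINT x|torus n. cmod (U i x - u x)) \<longlonglongrightarrow> 0"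
    have Ui: "integrable (torus n) (U i)" for i using U by (simp add: F_def)
    have "(\<lambda>N. I (S N) k u) \<longlonglongrightarrow> I \<phi> k u" for k
    proof (rule LIMSEQ_I)
      fix e :: real assume e: "e > 0"
      then have "\<exists>M. \<forall>i\<ge>M. norm ((LINT x|torus n. cmod (U i x - u x)) - 0) < e / 3"
        by (intro LIMSEQ_D[OF Ulim]) auto
      then obtain i where i: "(LINT x|torus n. cmod (U i x - u x)) < e / 3" by force
      have "\<exists>M. \<forall>N\<ge>M. norm (I (S N) k (U i) - I \<phi> k (U i)) < e / 3"
        using U[of i] e by (intro LIMSEQ_D) (auto simp: F_def)
      then obtain M where M: "\<And>N. N \<ge> M \<Longrightarrow> norm (I (S N) k (U i) - I \<phi> k (U i)) < e / 3" by auto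
      have "norm (I (S N) k u - I \<phi> k u) < e" if "N \<ge> M" for N
      proof -
        have 1: "cmod (I (S N) k (U i) - I (S N) k u) < e / 3"
          using I_bound[OF S S1 Bochner_Integration.integrable_diff[OF Ui[of i] u], of N k] i
          by (simp add: I_diff[OF S S1 Ui u])
        have 2: "cmod (I \<phi> k (U i) - I \<phi> k u) < e / 3"
          using I_bound[OF \<phi> \<phi>1 Bochner_Integration.integrable_diff[OF Ui[of i] u], of k] i
          by (simp add: I_diff[OF \<phi> \<phi>1 Ui u])
        have tri: "cmod (c - d) < e"
          if "cmod (a - b) < e / 3" "cmod (a - c) < e / 3" "cmod (b - d) < e / 3" for a b c d :: complex
        proof -
          have "dist c d \<le> dist a c + (dist a b + dist b d)"
            using dist_triangle[of c d a] dist_triangle[of a d b] dist_commute[of c a] by argo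
          then show ?thesis using that unfolding dist_norm by argo
        qed
        show ?thesis by (rule tri[OF M[OF that] 1 2])
      qed
      then show "\<exists>M. \<forall>N\<ge>M. norm (I (S N) k u - I \<phi> k u) < e" by blast
    qed
    then show "u \<in> F" using u by (simp add: F_def)
  next
    fix u j assume "u \<in> F" "j < n"
    then show "(\<lambda>x. cis (x j) * u x) \<in> F" "(\<lambda>x. cis (- x j) * u x) \<in> F"
      using shift[of u j 1] shift[of u j "-1"] by simp_all
  qed (simp add: F_def)
  have "(\<lambda>_. 1) \<in> F"
  proof -
    have "I g k (\<lambda>_. 1) = fourier n g (\<lambda>j. - k j)" for g k
      by (simp add: I_def fourier_def cnj_monom)
    then show ?thesis using lim by (simp add: F_def)
  qed
  then have "u \<in> F" using u by (rule integrable_in)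
  then have "(\<lambda>N. I (S N) (\<lambda>_. 0) u) \<longlonglongrightarrow> I \<phi> (\<lambda>_. 0) u" unfolding F_def by blast
  then show ?thesis by (simp add: I_def)
qed

section \<open>Fejer means\<close>

lemma integral_double_sum:
  fixes f :: "'a \<Rightarrow> 'b \<Rightarrow> 'c \<Rightarrow> complex"
  assumes "\<And>a b. integrable M (f a b)"
  shows "(LINT x|M. (\<Sum>a\<in>A. \<Sum>b\<in>B. f a b x)) = (\<Sum>a\<in>A. \<Sum>b\<in>B. LINT x|M. f a b x)"
  using assms by (simp add: Bochner_Integration.integral_sum Bochner_Integration.integrable_sum)

text \<open>Only differences of two elements are used: \<open>k\<close> arises from as many pairs as
  the Fejer weight at \<open>k\<close> prescribes.\<close>

definition index_box :: "nat \<Rightarrow> nat \<Rightarrow> (nat \<Rightarrow> int) set" where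
  "index_box n N = PiE {..<n} (\<lambda>_. {0..<int N})"

lemma finite_index_box: "finite (index_box n N)"
  unfolding index_box_def by (intro finite_PiE) auto

lemma card_index_box: "card (index_box n N) = N ^ n"
  by (simp add: index_box_def card_PiE)

lemma index_box_eq_iff:
  assumes "a \<in> index_box n N" "b \<in> index_box n N"
  shows "(\<forall>j<n. a j - b j = 0) \<longleftrightarrow> a = b"
proof
  assume "\<forall>j<n. a j - b j = 0"
  then have "a j = b j" if "j \<in> {..<n}" for j using that by auto
  then show "a = b" using assms unfolding index_box_def by (intro PiE_ext)
qed auto

text \<open>Grouping pairs by their difference \<open>k\<close> gives the usual product of the
  weights \<open>1 - |k j| / N\<close>, cut off at 0. The ungrouped double sum is kept because it
  exhibits the kernel as a square modulus.\<close>

definition fejer_mean :: "nat \<Rightarrow> ((nat \<Rightarrow> real) \<Rightarrow> complex) \<Rightarrow> nat \<Rightarrow> (nat \<Rightarrow> real) \<Rightarrow> complex" where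
  "fejer_mean n f N x = (\<Sum>a\<in>index_box n N. \<Sum>b\<in>index_box n N.
      fourier n f (\<lambda>j. a j - b j) * monom n (\<lambda>j. a j - b j) x) / of_nat (N ^ n)"

lemma fejer_mean_measurable [measurable]: "fejer_mean n f N \<in> borel_measurable (torus n)"
  unfolding fejer_mean_def by measurable

text \<open>The Fejer kernel is a normalised square modulus, so averaging against it does not
  increase the supremum norm.\<close>

lemma fejer_mean_bound:
  assumes f[measurable]: "f \<in> borel_measurable (torus n)" and f1: "AE x in torus n. cmod (f x) \<le> 1"
  shows "cmod (fejer_mean n f N x) \<le> 1"
proof -
  \<comment> \<open>The Dirichlet-type sum at the difference of \<open>x\<close> and
    \<open>y\<close>; its square modulus is the Fejer kernel before division by
    \<open>N ^ n\<close>.\<close>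
  define E where "E y = (\<Sum>a\<in>index_box n N. monom n a x * cnj (monom n a y))" for y
  have [measurable]: "E \<in> borel_measurable (torus n)" unfolding E_def by measurable
  have sq: "of_real ((cmod (E y))\<^sup>2) = (\<Sum>a\<in>index_box n N. \<Sum>b\<in>index_box n N.
      monom n (\<lambda>j. a j - b j) x * cnj (monom n (\<lambda>j. a j - b j) y))" for y
    unfolding complex_norm_square E_def cnj_sum sum_product
    by (intro sum.cong refl) (simp add: monom_diff mult_ac)
  have key: "(LINT y|torus n. g y * of_real ((cmod (E y))\<^sup>2)) =
      (\<Sum>a\<in>index_box n N. \<Sum>b\<in>index_box n N. fourier n g (\<lambda>j. a j - b j) * monom n (\<lambda>j. a j - b j) x)"
    if g: "integrable (torus n) g" for g
  proof -
    have int: "integrable (torus n) (\<lambda>y. monom n k x * (g y * cnj (monom n k y)))" for k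
      by (intro integrable_mult_right integrable_mult_monom g)
    have "(LINT y|torus n. g y * of_real ((cmod (E y))\<^sup>2)) =
      (LINT y|torus n. (\<Sum>a\<in>index_box n N. \<Sum>b\<in>index_box n N.
         monom n (\<lambda>j. a j - b j) x * (g y * cnj (monom n (\<lambda>j. a j - b j) y))))"
      unfolding sq sum_distrib_left by (simp add: mult_ac)
    also have "\<dots> = (\<Sum>a\<in>index_box n N. \<Sum>b\<in>index_box n N.
         LINT y|torus n. monom n (\<lambda>j. a j - b j) x * (g y * cnj (monom n (\<lambda>j. a j - b j) y)))"
      by (rule integral_double_sum) (rule int)
    finally show ?thesis by (simp add: fourier_def mult.commute)
  qed
  have E_int: "integrable (torus n) (\<lambda>y. of_real ((cmod (E y))\<^sup>2) :: complex)"
    unfolding sq cnj_monom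
    by (intro Bochner_Integration.integrable_sum integrable_mult_right L2_integrable L2_monom)
  \<comment> \<open>The formula \<open>key\<close> for \<open>g = 1\<close> gives the total mass of
    the kernel; for \<open>g = f\<close> it gives the mean itself.\<close>
  have "of_real (LINT y|torus n. (cmod (E y))\<^sup>2) = (LINT y|torus n. 1 * complex_of_real ((cmod (E y))\<^sup>2))"
    by (simp del: of_real_power)
  also have "\<dots> = (\<Sum>a\<in>index_box n N. \<Sum>b\<in>index_box n N. fourier n (\<lambda>_. 1) (\<lambda>j. a j - b j) * monom n (\<lambda>j. a j - b j) x)"
    by (rule key) simp
  also have "\<dots> = (\<Sum>a\<in>index_box n N. \<Sum>b\<in>index_box n N. if a = b then 1 else 0)"
  proof (intro sum.cong refl)
    fix a b assume ab: "a \<in> index_box n N" "b \<in> index_box n N"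
    have "fourier n (\<lambda>_. 1) (\<lambda>j. a j - b j) = (if a = b then 1 else 0)"
      using fourier_monom[of n "\<lambda>_. 0" "\<lambda>j. a j - b j"] index_box_eq_iff[OF ab]
      by auto
    then show "fourier n (\<lambda>_. 1) (\<lambda>j. a j - b j) * monom n (\<lambda>j. a j - b j) x = (if a = b then 1 else 0)"
      by (auto simp: monom_def)
  qed
  also have "\<dots> = of_nat (N ^ n)"
    by (simp add: finite_index_box card_index_box)
  finally have total: "(LINT y|torus n. (cmod (E y))\<^sup>2) = real (N ^ n)"
    by (metis of_real_eq_iff of_real_of_nat_eq)
  have "fejer_mean n f N x = (LINT y|torus n. f y * of_real ((cmod (E y))\<^sup>2)) / of_nat (N ^ n)"
    unfolding fejer_mean_def
    by (subst key) (auto intro!: torus.integrable_const_bound[of _ 1] f1)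
  moreover have "cmod (LINT y|torus n. f y * of_real ((cmod (E y))\<^sup>2)) \<le> real (N ^ n)"
    using cmod_integral_bounded_mult[OF f f1 E_int] total by (simp add: norm_power)
  ultimately show ?thesis
    by (auto simp: norm_divide norm_power divide_le_eq_1)
qed

text \<open>Counts the pairs with difference \<open>k\<close>: \<open>b\<close> is determined by
  \<open>a\<close>, and the admissible \<open>a\<close> fill the box \<open>A\<close> with sides
  \<open>N - |k j|\<close>, empty if some side is not positive.\<close>

lemma sum_index_box_diff:
  "(\<Sum>a\<in>index_box n N. \<Sum>b\<in>index_box n N. if \<forall>j<n. a j - b j = k j then 1 else 0 :: complex) =
    of_nat (\<Prod>j<n. nat (int N - \<bar>k j\<bar>))"
proof -
  define A where "A = PiE {..<n} (\<lambda>j. {max 0 (k j)..<min (int N) (int N + k j)})"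
  have fin: "finite A" unfolding A_def by (intro finite_PiE) auto
  have "(\<Sum>b\<in>index_box n N. if \<forall>j<n. a j - b j = k j then 1 else 0 :: complex) = (if a \<in> A then 1 else 0 :: complex)"
    if a: "a \<in> index_box n N" for a
  proof -
    \<comment> \<open>Restricted because elements of \<open>index_box\<close> are undefined outside
      \<open>{..<n}\<close>.\<close>
    define b0 where "b0 = restrict (\<lambda>j. a j - k j) {..<n}"
    have "(\<forall>j<n. a j - b j = k j) \<longleftrightarrow> b = b0" if "b \<in> index_box n N" for b
    proof
      assume *: "\<forall>j<n. a j - b j = k j"
      have "b j = b0 j" for j
      proof (cases "j < n")
        case True
        then have "a j - b j = k j" using * by blast
        then show ?thesis using True by (simp add: b0_def)
      next
        case False
        then have "b j = undefined" using PiE_arb[OF that[unfolded index_box_def], of j] by simp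
        then show ?thesis using False by (simp add: b0_def)
      qed
      then show "b = b0" by (rule ext)
    qed (auto simp: b0_def)
    then have "(\<Sum>b\<in>index_box n N. if \<forall>j<n. a j - b j = k j then 1 else 0 :: complex) = (\<Sum>b\<in>index_box n N. if b = b0 then 1 else 0 :: complex)"
      by (intro sum.cong) auto
    also have "\<dots> = (if b0 \<in> index_box n N then 1 else 0 :: complex)"
      by (simp add: finite_index_box)
    also have "b0 \<in> index_box n N \<longleftrightarrow> a \<in> A"
    proof
      assume b0: "b0 \<in> index_box n N"
      have "a j - k j \<in> {0..<int N}" if "j < n" for j
        using PiE_mem[OF b0[unfolded index_box_def], of j] that by (simp add: b0_def)
      moreover have "a j \<in> {0..<int N}" if "j < n" for j
        using PiE_mem[OF a[unfolded index_box_def], of j] that by simp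
      ultimately show "a \<in> A"
        using a unfolding A_def index_box_def PiE_iff by fastforce
    next
      assume A: "a \<in> A"
      have "a j - k j \<in> {0..<int N}" if "j < n" for j
        using PiE_mem[OF A[unfolded A_def], of j] that by auto
      then show "b0 \<in> index_box n N" by (simp add: b0_def index_box_def)
    qed
    finally show ?thesis .
  qed
  then have "(\<Sum>a\<in>index_box n N. \<Sum>b\<in>index_box n N. if \<forall>j<n. a j - b j = k j then 1 else 0 :: complex) =
      (\<Sum>a\<in>index_box n N. if a \<in> A then 1 else 0 :: complex)"
    by (intro sum.cong) auto
  also have "\<dots> = of_nat (card (index_box n N \<inter> A))"
    by (simp add: finite_index_box flip: sum.inter_restrict)
  also have "index_box n N \<inter> A = A"
    unfolding index_box_def A_def by (intro Int_absorb1 PiE_mono) auto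
  also have "card A = (\<Prod>j<n. nat (int N - \<bar>k j\<bar>))"
    unfolding A_def by (subst card_PiE) (auto intro!: prod.cong)
  finally show ?thesis .
qed

lemma fourier_fejer_mean:
  "fourier n (fejer_mean n f N) k = fourier n f k * of_real (\<Prod>j<n. real (nat (int N - \<bar>k j\<bar>)) / real N)"
proof -
  have int: "integrable (torus n) (\<lambda>x. fourier n f l * monom n l x * cnj (monom n k x))" for l
    by (rule torus.integrable_const_bound[of _ "cmod (fourier n f l)"]) (auto simp: norm_mult)
  have "fourier n (fejer_mean n f N) k =
     (LINT x|torus n. (\<Sum>a\<in>index_box n N. \<Sum>b\<in>index_box n N.
        fourier n f (\<lambda>j. a j - b j) * monom n (\<lambda>j. a j - b j) x * cnj (monom n k x)) / of_nat (N ^ n))"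
    unfolding fourier_def[of n "fejer_mean n f N"] fejer_mean_def
    by (simp add: sum_distrib_right)
  also have "\<dots> = (\<Sum>a\<in>index_box n N. \<Sum>b\<in>index_box n N.
        fourier n f (\<lambda>j. a j - b j) * fourier n (monom n (\<lambda>j. a j - b j)) k) / of_nat (N ^ n)"
  proof -
    have "(LINT x|torus n. (\<Sum>a\<in>index_box n N. \<Sum>b\<in>index_box n N.
        fourier n f (\<lambda>j. a j - b j) * monom n (\<lambda>j. a j - b j) x * cnj (monom n k x))) =
      (\<Sum>a\<in>index_box n N. \<Sum>b\<in>index_box n N. LINT x|torus n.
        fourier n f (\<lambda>j. a j - b j) * monom n (\<lambda>j. a j - b j) x * cnj (monom n k x))"
      by (rule integral_double_sum) (rule int)
    then show ?thesis by (simp add: fourier_def[of n "monom n _"] mult.assoc)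
  qed
  also have "(\<Sum>a\<in>index_box n N. \<Sum>b\<in>index_box n N.
        fourier n f (\<lambda>j. a j - b j) * fourier n (monom n (\<lambda>j. a j - b j)) k) =
      (\<Sum>a\<in>index_box n N. \<Sum>b\<in>index_box n N. fourier n f k * (if \<forall>j<n. a j - b j = k j then 1 else 0))"
  proof (intro sum.cong refl)
    fix a b
    show "fourier n f (\<lambda>j. a j - b j) * fourier n (monom n (\<lambda>j. a j - b j)) k =
        fourier n f k * (if \<forall>j<n. a j - b j = k j then 1 else 0)"
      using fourier_cong[of n "\<lambda>j. a j - b j" k f] by (simp add: fourier_monom)
  qed
  also have "\<dots> = fourier n f k * of_nat (\<Prod>j<n. nat (int N - \<bar>k j\<bar>))"
    unfolding sum_index_box_diff[symmetric] sum_distrib_left ..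
  finally show ?thesis by (simp add: prod_dividef)
qed

lemma fourier_fejer_mean_tendsto:
  "(\<lambda>N. fourier n (fejer_mean n f N) k) \<longlonglongrightarrow> fourier n f k"
proof -
  have "(\<lambda>N. real (nat (int N - m)) / real N) \<longlonglongrightarrow> 1" if "m \<ge> 0" for m
  proof (rule Lim_transform_eventually)
    show "(\<lambda>N. 1 - of_int m / real N) \<longlonglongrightarrow> 1"
      using tendsto_diff[OF tendsto_const[of 1] lim_const_over_n[of "real_of_int m"]] by simp
    show "\<forall>\<^sub>F N in sequentially. 1 - of_int m / real N = real (nat (int N - m)) / real N"
      using eventually_ge_at_top[of "nat m + 1"]
      by eventually_elim (use that in \<open>auto simp: field_simps\<close>)
  qed
  then have "(\<lambda>N. \<Prod>j<n. real (nat (int N - \<bar>k j\<bar>)) / real N) \<longlonglongrightarrow> (\<Prod>j<n. 1)"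
    by (intro tendsto_prod) auto
  then have "(\<lambda>N. fourier n f k * of_real (\<Prod>j<n. real (nat (int N - \<bar>k j\<bar>)) / real N)) \<longlonglongrightarrow> fourier n f k * of_real (\<Prod>j<n. 1)"
    by (intro tendsto_mult tendsto_const tendsto_of_real)
  then show ?thesis by (simp add: fourier_fejer_mean)
qed

text \<open>The Fejer means of \<phi> are analytic polynomials, for which the claim is the
  hypothesis; they converge weakly against the merely integrable \<open>u\<close>.\<close>

lemma integral_Hinf_mult_eq_0:
  assumes \<phi>: "\<phi> \<in> Hinf_ball n" and u: "integrable (torus n) u"
    and z: "\<And>k. \<forall>j<n. 0 \<le> k j \<Longrightarrow> (LINT x|torus n. monom n k x * u x) = 0"
  shows "(LINT x|torus n. \<phi> x * u x) = 0"
proof -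
  have "(LINT x|torus n. fejer_mean n \<phi> N x * u x) = 0" for N
  proof -
    define c where "c k = fourier n \<phi> k / of_nat (N ^ n)" for k
    \<comment> \<open>Either \<open>k\<close> is nonnegative and the hypothesis applies, or the
      coefficient of \<phi> vanishes.\<close>
    have 0: "c k * (LINT x|torus n. monom n k x * u x) = 0" for k
      using z[of k] Hinf_ballD(1)[OF \<phi>] by (force simp: c_def H2_def not_less)
    have "(LINT x|torus n. fejer_mean n \<phi> N x * u x) =
       (LINT x|torus n. (\<Sum>a\<in>index_box n N. \<Sum>b\<in>index_box n N. c (\<lambda>j. a j - b j) * (monom n (\<lambda>j. a j - b j) x * u x)))"
      by (simp add: fejer_mean_def c_def sum_divide_distrib sum_distrib_right mult.assoc)
    also have "\<dots> = (\<Sum>a\<in>index_box n N. \<Sum>b\<in>index_box n N. LINT x|torus n. c (\<lambda>j. a j - b j) * (monom n (\<lambda>j. a j - b j) x * u x))"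
      by (rule integral_double_sum) (intro integrable_mult_right integrable_mult_monom u)
    also have "\<dots> = 0" by (simp only: Bochner_Integration.integral_mult_right_zero 0 sum.neutral_const)
    finally show ?thesis .
  qed
  moreover have "(\<lambda>N. LINT x|torus n. fejer_mean n \<phi> N x * u x) \<longlonglongrightarrow> (LINT x|torus n. \<phi> x * u x)"
    using Hinf_ballD[OF \<phi>] u fejer_mean_bound
    by (intro bounded_weak_convergence fourier_fejer_mean_tendsto) auto
  ultimately show ?thesis by (simp add: LIMSEQ_const_iff)
qed

section \<open>Quotient modules\<close>

text \<open>First-order condition along the segment from \<open>d\<close> to \<open>c\<close>.
  Minimality is assumed on this segment only, because \<open>d\<close> will lie in the closure of a
  convex set and not necessarily in the set.\<close>

lemma l2_minimal_variational:
  assumes d: "d \<in> L2 n" and c: "c \<in> L2 n"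
    and min: "\<And>t. 0 < t \<Longrightarrow> t \<le> 1 \<Longrightarrow> l2norm n d \<le> l2norm n (\<lambda>x. of_real (1 - t) * d x + of_real t * c x)"
  shows "(l2norm n d)\<^sup>2 \<le> Re (l2inner n d c)"
proof -
  define e where "e = (\<lambda>x. c x - d x)"
  have e: "e \<in> L2 n" unfolding e_def using c d by (rule L2_diff)
  define r s where "r = Re (l2inner n d e)" and "s = (l2norm n e)\<^sup>2"
  have s0: "s \<ge> 0" by (simp add: s_def)
  have *: "0 \<le> 2 * r + t * s" if t: "0 < t" "t \<le> 1" for t
  proof -
    have "(\<lambda>x. of_real (1 - t) * d x + of_real t * c x) = (\<lambda>x. d x + of_real t * e x)"
      by (simp add: e_def fun_eq_iff algebra_simps)
    then have "l2norm n d \<le> l2norm n (\<lambda>x. d x + of_real t * e x)"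
      using min[OF t] by simp
    then have "(l2norm n d)\<^sup>2 \<le> (l2norm n (\<lambda>x. d x + of_real t * e x))\<^sup>2"
      by (intro power_mono l2norm_nonneg)
    also have "\<dots> = (l2norm n d)\<^sup>2 + 2 * (t * r) + t\<^sup>2 * s"
      unfolding l2norm_add_power2[OF d L2_scale[OF e]] l2norm_scale l2inner_scale_right r_def s_def
      by (simp add: power_mult_distrib)
    finally have "0 \<le> t * (2 * r + t * s)" by (simp add: algebra_simps power2_eq_square)
    then show ?thesis using t by (simp add: zero_le_mult_iff)
  qed
  have "0 \<le> r"
  proof (rule ccontr)
    assume "\<not> 0 \<le> r"
    \<comment> \<open>Chosen so that \<open>t * s \<le> - r\<close>, whence
      \<open>2 * r + t * s \<le> r < 0\<close>; the summand 1 keeps the denominator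
      positive.\<close>
    define t where "t = min 1 (- r / (s + 1))"
    have t: "0 < t" "t \<le> 1" using \<open>\<not> 0 \<le> r\<close> s0 by (auto simp: t_def divide_neg_pos)
    have "t * s \<le> (- r / (s + 1)) * s" using s0 by (intro mult_right_mono) (auto simp: t_def)
    also have "\<dots> \<le> - r"
      using s0 \<open>\<not> 0 \<le> r\<close> by (simp add: field_simps)
    finally show False using *[OF t] \<open>\<not> 0 \<le> r\<close> by linarith
  qed
  then show ?thesis
    unfolding r_def e_def using c d by (simp add: l2inner_diff_right l2inner_self)
qed

lemma l2lim_affine:
  assumes "l2lim n c d"
  shows "l2lim n (\<lambda>m x. a * c m x + h x) (\<lambda>x. a * d x + h x)"
proof -
  have "l2norm n (\<lambda>x. a * c m x + h x - (a * d x + h x)) = cmod a * l2norm n (\<lambda>x. c m x - d x)" for m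
    unfolding l2norm_scale[symmetric] by (simp add: algebra_simps)
  then show ?thesis using tendsto_mult_right_zero[OF assms, of "cmod a"] by simp
qed

text \<open>L2 convergence implies L1 convergence, which gives almost everywhere convergence of a
  subsequence.\<close>

lemma unit_ball_closed:
  assumes F: "\<And>k. F k \<in> L2 n" and F1: "\<And>k. AE x in torus n. cmod (F k x) \<le> 1"
    and f: "f \<in> L2 n" and lim: "l2lim n F f"
  shows "AE x in torus n. cmod (f x) \<le> 1"
proof -
  have "(\<lambda>k. LINT x|torus n. cmod (F k x - f x)) \<longlonglongrightarrow> 0"
  proof (rule tendsto_sandwich[OF _ _ tendsto_const lim])
    show "\<forall>\<^sub>F k in sequentially. 0 \<le> (LINT x|torus n. cmod (F k x - f x))"
      by (intro always_eventually allI Bochner_Integration.integral_nonneg) auto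
    show "\<forall>\<^sub>F k in sequentially. (LINT x|torus n. cmod (F k x - f x)) \<le> l2norm n (\<lambda>x. F k x - f x)"
      using l1norm_le_l2norm[OF L2_diff[OF F f]] by (simp add: l1norm_def)
  qed
  then obtain r where r: "AE x in torus n. (\<lambda>k. F (r k) x - f x) \<longlonglongrightarrow> 0"
    using tendsto_L1_AE_subseq[of "torus n" "\<lambda>k x. F k x - f x"] L2_integrable[OF L2_diff[OF F f]] by blast
  have "AE x in torus n. \<forall>k. cmod (F k x) \<le> 1" using F1 by (simp add: AE_all_countable)
  with r show ?thesis
  proof eventually_elim
    case (elim x)
    then have "(\<lambda>k. F (r k) x) \<longlonglongrightarrow> f x" by (simp add: LIM_zero_iff)
    then have "(\<lambda>k. cmod (F (r k) x)) \<longlonglongrightarrow> cmod (f x)" by (rule tendsto_norm)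
    then show ?case using elim(2) by (intro LIMSEQ_le_const2) auto
  qed
qed

lemma l2norm_le_1:
  assumes "f \<in> L2 n" "AE x in torus n. cmod (f x) \<le> 1"
  shows "l2norm n f \<le> 1"
proof -
  have "(LINT x|torus n. (cmod (f x))\<^sup>2) \<le> (LINT x|torus n. 1)"
  proof (rule integral_mono_AE)
    show "AE x in torus n. (cmod (f x))\<^sup>2 \<le> 1"
      using assms(2) by eventually_elim (simp add: power_le_one)
  qed (use assms in \<open>auto simp: L2_square_integrable\<close>)
  then show ?thesis by (simp add: l2norm_def torus.prob_space)
qed

section \<open>The complementary submodule and the construction of a symbol\<close>

locale quotient_mod =
  fixes n :: nat and Q :: "((nat \<Rightarrow> real) \<Rightarrow> complex) set"
  assumes quotient: "quotient_module n Q"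
begin

lemma Q_closed: "closed_subspace n Q" and Q_H2: "q \<in> Q \<Longrightarrow> q \<in> H2 n" and Q_L2: "q \<in> Q \<Longrightarrow> q \<in> L2 n"
  using quotient by (auto simp: quotient_module_def H2_def)

lemma adjoint_shift:
  assumes "j < n" "q \<in> Q"
  obtains q' where "q' \<in> Q" "\<And>h. h \<in> H2 n \<Longrightarrow> l2inner n (\<lambda>x. zc j x * h x) q = l2inner n h q'"
proof -
  obtain q' where q': "q' \<in> Q" "\<And>h. h \<in> H2 n \<Longrightarrow> l2inner n q' h = l2inner n q (\<lambda>x. zc j x * h x)"
    using quotient assms unfolding quotient_module_def by blast
  show ?thesis
  proof (rule that[OF q'(1)])
    fix h assume "h \<in> H2 n"
    then show "l2inner n (\<lambda>x. zc j x * h x) q = l2inner n h q'"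
      using q'(2)[of h] l2inner_commute[of n "\<lambda>x. zc j x * h x" q] l2inner_commute[of n h q'] by simp
  qed
qed

text \<open>The submodule \<open>H2 n\<close> minus \<open>Q\<close> in the orthogonal sense; it is
  invariant under the shifts because \<open>Q\<close> is invariant under their adjoints.\<close>

definition perp :: "((nat \<Rightarrow> real) \<Rightarrow> complex) set" where
  "perp = {g \<in> H2 n. \<forall>q\<in>Q. l2inner n g q = 0}"

lemma perp_H2: "g \<in> perp \<Longrightarrow> g \<in> H2 n" and perp_L2: "g \<in> perp \<Longrightarrow> g \<in> L2 n"
  by (auto simp: perp_def H2_def)

lemma perp_zc:
  assumes "j < n" "g \<in> perp"
  shows "(\<lambda>x. zc j x * g x) \<in> perp"
proof -
  have "l2inner n (\<lambda>x. zc j x * g x) q = 0" if q: "q \<in> Q" for q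
  proof -
    obtain q' where "q' \<in> Q" "l2inner n (\<lambda>x. zc j x * g x) q = l2inner n g q'"
      using adjoint_shift[OF assms(1) q] perp_H2[OF assms(2)] by metis
    then show ?thesis using assms(2) by (simp add: perp_def)
  qed
  then show ?thesis using H2_zc_mult[OF assms(1) perp_H2[OF assms(2)]] by (simp add: perp_def)
qed

lemma perp_monom:
  assumes "\<forall>j<n. 0 \<le> k j" "g \<in> perp"
  shows "(\<lambda>x. monom n k x * g x) \<in> perp"
proof (rule nonneg_monom_induct[OF assms(1), where P="\<lambda>f. (\<lambda>x. f x * g x) \<in> perp"])
  show "(\<lambda>x. 1 * g x) \<in> perp" using assms(2) by simp
next
  fix f :: "(nat \<Rightarrow> real) \<Rightarrow> complex" and j
  assume "j < n" "(\<lambda>x. f x * g x) \<in> perp"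
  then show "(\<lambda>x. zc j x * f x * g x) \<in> perp"
    using perp_zc[of j "\<lambda>x. f x * g x"] by (simp add: mult.assoc)
qed

text \<open>Invariance under nonnegative monomials extends to \<phi> through
  \<open>integral_Hinf_mult_eq_0\<close>, with the integrable product of \<open>g\<close> and the
  conjugate of \<open>q\<close> as test function.\<close>

lemma perp_Hinf:
  assumes \<phi>: "\<phi> \<in> Hinf_ball n" and g: "g \<in> perp" and q: "q \<in> Q"
  shows "l2inner n (\<lambda>x. \<phi> x * g x) q = 0"
proof -
  have "(LINT x|torus n. \<phi> x * (g x * cnj (q x))) = 0"
  proof (rule integral_Hinf_mult_eq_0[OF \<phi>])
    show "integrable (torus n) (\<lambda>x. g x * cnj (q x))"
      by (rule l2inner_integrable[OF perp_L2[OF g] Q_L2[OF q]])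
    fix k :: "nat \<Rightarrow> int" assume "\<forall>j<n. 0 \<le> k j"
    then have "l2inner n (\<lambda>x. monom n k x * g x) q = 0"
      using perp_monom[OF _ g, of k] q by (simp add: perp_def)
    then show "(LINT x|torus n. monom n k x * (g x * cnj (q x))) = 0"
      by (simp add: l2inner_def mult.assoc)
  qed
  then show ?thesis by (simp add: l2inner_def mult.assoc)
qed

lemma perp_diff_proj:
  assumes "f \<in> H2 n" "is_proj n Q f P"
  shows "(\<lambda>x. f x - P x) \<in> perp"
  using assms is_projD[OF Q_closed assms(2) H2_L2[OF assms(1)]]
    closed_subspace_diff[OF closed_subspace_H2 assms(1) Q_H2]
  by (simp add: perp_def)

text \<open>Split \<open>d\<close> into its projection \<open>d1\<close> on \<open>H2 n\<close> and
  a rest \<open>d2\<close>. Orthogonality forces \<open>d1\<close> into \<open>Q\<close>. The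
  conjugate of \<open>d2\<close> has no nonpositive frequencies, so its analytic part lies in
  \<open>H2_0 n\<close> and what remains lies in \<open>Mn n\<close>.\<close>

lemma orthogonal_perp_imp_cnj_MQ:
  assumes d: "d \<in> L2 n" and orth: "\<And>g. g \<in> perp \<Longrightarrow> l2inner n d g = 0"
  shows "(\<lambda>x. cnj (d x)) \<in> MQ n Q"
proof -
  obtain d1 where d1: "is_proj n (H2 n) d d1"
    using projection_exists[OF closed_subspace_H2 d] .
  note D1 = is_projD[OF closed_subspace_H2 d1 d]
  define d2 where "d2 = (\<lambda>x. d x - d1 x)"
  have d2: "d2 \<in> L2 n" unfolding d2_def by (rule L2_diff[OF d D1(2)])
  have d2H: "l2inner n d2 h = 0" if "h \<in> H2 n" for h
    unfolding d2_def by (rule D1(3)[OF that])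
  obtain q where q: "is_proj n Q d1 q"
    using projection_exists[OF Q_closed D1(2)] .
  note QQ = is_projD[OF Q_closed q D1(2)]
  define e where "e = (\<lambda>x. d1 x - q x)"
  have e: "e \<in> perp" unfolding e_def by (rule perp_diff_proj[OF D1(1) q])
  have eL: "e \<in> L2 n" by (rule perp_L2[OF e])
  \<comment> \<open>\<open>e\<close> is orthogonal to \<open>q\<close> as an element of
    \<open>perp\<close>, and to \<open>d1\<close> because \<open>d1\<close> and \<open>d\<close>
    have the same inner products with \<open>H2 n\<close>; hence it is orthogonal to itself.\<close>
  have "l2inner n q e = 0"
    using e QQ(1) l2inner_commute[of n q e] by (simp add: perp_def)
  moreover have "l2inner n d1 e = 0"
    using D1(4)[OF perp_H2[OF e]] orth[OF e] by simp
  ultimately have "l2inner n (\<lambda>x. d1 x - q x) (\<lambda>x. d1 x - q x) = 0"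
    unfolding e_def[symmetric] by (subst e_def) (simp add: l2inner_diff_left D1(2) QQ(2) eL)
  then have "aeq n d1 q" by (rule l2_diff_orthogonal_imp_aeq[OF D1(2) QQ(2)])
  then have "aeq n q d1" unfolding aeq_def by (auto elim: eventually_mono)
  then have d1Q: "d1 \<in> Q" by (rule closed_subspaceD(5)[OF Q_closed QQ(1) D1(2)])
  have cd2: "(\<lambda>x. cnj (d2 x)) \<in> L2 n" by (rule L2_cnj[OF d2])
  obtain h where h: "is_proj n (H2 n) (\<lambda>x. cnj (d2 x)) h"
    using projection_exists[OF closed_subspace_H2 cd2] .
  note H = is_projD[OF closed_subspace_H2 h cd2]
  \<comment> \<open>Conjugation reflects \<open>k\<close> to a nonnegative index, whose monomial
    lies in \<open>H2 n\<close>.\<close>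
  have cd2_0: "fourier n (\<lambda>x. cnj (d2 x)) k = 0" if "\<forall>j<n. k j \<le> 0" for k
    using d2H[OF H2_monom[of n "\<lambda>j. - k j"]] that by (simp add: fourier_cnj fourier_eq_l2inner)
  have "fourier n h (\<lambda>_. 0) = fourier n (\<lambda>x. cnj (d2 x)) (\<lambda>_. 0)"
    unfolding fourier_eq_l2inner by (rule H(4)[OF H2_monom]) simp
  then have h0: "fourier n h (\<lambda>_. 0) = 0" using cd2_0 by simp
  then have hH: "h \<in> H2_0 n" using H(1) by (simp add: H2_0_def)
  define m where "m = (\<lambda>x. cnj (d2 x) - h x)"
  have mL: "m \<in> L2 n" unfolding m_def by (rule L2_diff[OF cd2 H(2)])
  have "fourier n m k = 0" if k: "(\<forall>j<n. 0 \<le> k j) \<or> (\<forall>j<n. k j \<le> 0)" for k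
    using k
  proof
    assume "\<forall>j<n. 0 \<le> k j"
    then show ?thesis unfolding m_def fourier_eq_l2inner by (intro H(3) H2_monom)
  next
    assume k: "\<forall>j<n. k j \<le> 0"
    have "fourier n h k = 0"
    proof (cases "\<exists>j<n. k j < 0")
      case True
      then show ?thesis using fourier_H2_eq_0[OF H(1)] by blast
    next
      case False
      then have "fourier n h k = fourier n h (\<lambda>_. 0)" using k by (intro fourier_cong) force
      then show ?thesis using h0 by simp
    qed
    then show ?thesis unfolding m_def fourier_diff[OF cd2 H(2)] using cd2_0[OF k] by simp
  qed
  then have "m \<in> Mn n" using mL by (simp add: Mn_def)
  moreover have "(\<lambda>x. cnj (d x)) = (\<lambda>x. cnj (d1 x) + m x + h x)"
    by (simp add: m_def d2_def)
  ultimately show ?thesis unfolding MQ_def using d1Q hH by blast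
qed

lemma symbol_exists:
  assumes \<psi>: "\<psi> \<in> Q"
    and contr: "\<And>f. f \<in> MQ n Q \<Longrightarrow> cmod (LINT x|torus n. \<psi> x * f x) \<le> l1norm n f"
  obtains \<phi> where "\<phi> \<in> Hinf_ball n" "\<And>q. q \<in> Q \<Longrightarrow> l2inner n \<phi> q = l2inner n \<psi> q"
proof -
  define K where "K = {k \<in> L2 n. AE x in torus n. cmod (k x) \<le> 1}"
  \<comment> \<open>The translate \<psi> + \<open>perp\<close>, described by inner products.\<close>
  define A where "A = {a \<in> H2 n. \<forall>q\<in>Q. l2inner n a q = l2inner n \<psi> q}"
  define C where "C = {c. \<exists>k\<in>K. \<exists>a\<in>A. c = (\<lambda>x. k x - a x)}"
  have KL: "k \<in> L2 n" if "k \<in> K" for k using that by (simp add: K_def)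
  have AL: "a \<in> L2 n" if "a \<in> A" for a using that by (simp add: A_def H2_def)
  have \<psi>A: "\<psi> \<in> A" using \<psi> Q_H2 by (simp add: A_def)
  have K0: "(\<lambda>_. 0) \<in> K" by (simp add: K_def L2_const)
  have K_conv: "(\<lambda>x. of_real (1 - t) * k x + of_real t * l x) \<in> K"
    if k: "k \<in> K" and l: "l \<in> K" and t: "0 \<le> t" "t \<le> 1" for k l and t :: real
  proof -
    have "AE x in torus n. cmod (k x) \<le> 1" "AE x in torus n. cmod (l x) \<le> 1"
      using k l by (auto simp: K_def)
    then have "AE x in torus n. cmod (of_real (1 - t) * k x + of_real t * l x) \<le> 1"
    proof eventually_elim
      case (elim x)
      have "cmod (of_real (1 - t) * k x + of_real t * l x) \<le> (1 - t) * cmod (k x) + t * cmod (l x)"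
        by (rule order_trans[OF norm_triangle_ineq]) (use t in \<open>simp add: norm_mult del: of_real_diff\<close>)
      also have "\<dots> \<le> (1 - t) * 1 + t * 1"
        using elim t by (intro add_mono mult_left_mono) auto
      finally show ?case by simp
    qed
    then show ?thesis using KL[OF k] KL[OF l] unfolding K_def by (auto intro: L2_add L2_scale)
  qed
  have A_conv: "(\<lambda>x. of_real (1 - t) * a x + of_real t * b x) \<in> A"
    if "a \<in> A" "b \<in> A" for a b and t :: real
  proof -
    note H2D = closed_subspaceD[OF closed_subspace_H2]
    have ab: "a \<in> H2 n" "b \<in> H2 n" using that by (auto simp: A_def)
    have "(\<lambda>x. of_real (1 - t) * a x + of_real t * b x) \<in> H2 n" using ab by (intro H2D(3,4))
    moreover have "l2inner n (\<lambda>x. of_real (1 - t) * a x + of_real t * b x) q = l2inner n \<psi> q" if q: "q \<in> Q" for q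
    proof -
      have "l2inner n (\<lambda>x. of_real (1 - t) * a x + of_real t * b x) q =
          of_real (1 - t) * l2inner n a q + of_real t * l2inner n b q"
        unfolding l2inner_scale_left[symmetric]
        by (rule l2inner_add_left[OF L2_scale L2_scale Q_L2]) (use ab q H2_L2 in auto)
      also have "\<dots> = of_real (1 - t) * l2inner n \<psi> q + of_real t * l2inner n \<psi> q"
        using \<open>a \<in> A\<close> \<open>b \<in> A\<close> q by (simp add: A_def)
      finally show ?thesis by (simp add: algebra_simps)
    qed
    ultimately show ?thesis by (simp add: A_def)
  qed
  have CI: "(\<lambda>x. k x - a x) \<in> C" if "k \<in> K" "a \<in> A" for k a
    unfolding C_def using that by blast
  have C_conv: "(\<lambda>x. of_real (1 - t) * c x + of_real t * c' x) \<in> C"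
    if c: "c \<in> C" "c' \<in> C" and t: "0 \<le> t" "t \<le> 1" for c c' and t :: real
  proof -
    obtain k a k' a' where *: "k \<in> K" "a \<in> A" "c = (\<lambda>x. k x - a x)" "k' \<in> K" "a' \<in> A" "c' = (\<lambda>x. k' x - a' x)"
      using c unfolding C_def by blast
    have "(\<lambda>x. of_real (1 - t) * c x + of_real t * c' x) =
        (\<lambda>x. (of_real (1 - t) * k x + of_real t * k' x) - (of_real (1 - t) * a x + of_real t * a' x))"
      unfolding * by (simp add: algebra_simps)
    then show ?thesis using CI[OF K_conv[OF *(1,4) t] A_conv[OF *(2,5), of t]] by simp
  qed
  have half: "(\<lambda>x. 1/2 * (f x + g x)) = (\<lambda>x. of_real (1 - 1/2) * f x + of_real (1/2) * g x)"
    for f g :: "(nat \<Rightarrow> real) \<Rightarrow> complex"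
    by (simp add: field_simps)
  have C_sub: "C \<subseteq> L2 n" unfolding C_def by (auto intro: L2_diff KL AL)
  have C_ne: "C \<noteq> {}" unfolding C_def using K0 \<psi>A by blast
  have C_mid: "(\<lambda>x. 1/2 * (f x + g x)) \<in> C" if "f \<in> C" "g \<in> C" for f g
    unfolding half by (rule C_conv[OF that]) auto
  obtain c d where c: "\<And>m. c m \<in> C" and d: "d \<in> L2 n" "l2lim n c d"
    and min: "\<And>f. f \<in> C \<Longrightarrow> l2norm n d \<le> l2norm n f"
    using l2_minimal_norm[OF C_sub C_ne C_mid] by blast
  have cL: "c m \<in> L2 n" for m using c C_sub by blast
  \<comment> \<open>The limit \<open>d\<close> may lie outside \<open>C\<close>, so competitors
    built from \<open>d\<close> are approached by competitors built from the points
    \<open>c m\<close>.\<close>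
  have min': "l2norm n d \<le> l2norm n (\<lambda>x. \<alpha> * d x + h x)"
    if h: "h \<in> L2 n" and ch: "\<And>m. (\<lambda>x. \<alpha> * c m x + h x) \<in> C" for \<alpha> h
  proof (rule LIMSEQ_le_const)
    show "(\<lambda>m. l2norm n (\<lambda>x. \<alpha> * c m x + h x)) \<longlonglongrightarrow> l2norm n (\<lambda>x. \<alpha> * d x + h x)"
      by (rule l2lim_l2norm[OF _ _ l2lim_affine[OF d(2)]]) (intro L2_add L2_scale cL d h)+
    show "\<exists>N. \<forall>m\<ge>N. l2norm n d \<le> l2norm n (\<lambda>x. \<alpha> * c m x + h x)"
      using min[OF ch] by blast
  qed
  have "l2inner n d g = 0" if g: "g \<in> perp" for g
  proof (rule l2inner_eq_0_if_minimal[OF d(1) perp_L2[OF g]])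
    fix t
    \<comment> \<open>Translation along \<open>g\<close> is absorbed by the point of
      \<open>A\<close>. The factor 1 gives the shape required by \<open>min'\<close>.\<close>
    have "(\<lambda>x. 1 * c m x + - t * g x) \<in> C" for m
    proof -
      obtain k a where ka: "k \<in> K" "a \<in> A" "c m = (\<lambda>x. k x - a x)"
        using c[of m] unfolding C_def by blast
      have "(\<lambda>x. a x + t * g x) \<in> A"
      proof -
        have "(\<lambda>x. a x + t * g x) \<in> H2 n"
          using ka(2) perp_H2[OF g] by (intro closed_subspaceD(3,4)[OF closed_subspace_H2]) (simp_all add: A_def)
        moreover have "l2inner n (\<lambda>x. a x + t * g x) q = l2inner n \<psi> q" if "q \<in> Q" for q
          using l2inner_add_left[OF AL[OF ka(2)] L2_scale[OF perp_L2[OF g], of t] Q_L2[OF that]] ka(2) g that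
          by (simp add: A_def perp_def l2inner_scale_left)
        ultimately show ?thesis by (simp add: A_def)
      qed
      from CI[OF ka(1) this] show ?thesis by (simp add: ka(3) algebra_simps)
    qed
    from min'[OF L2_scale[OF perp_L2[OF g]] this] show "l2norm n d \<le> l2norm n (\<lambda>x. d x - t * g x)" by simp
  qed
  then have dM: "(\<lambda>x. cnj (d x)) \<in> MQ n Q" by (rule orthogonal_perp_imp_cnj_MQ[OF d(1)])
  \<comment> \<open>Minus the phase of \<open>d\<close>, so that its inner product with
    \<open>d\<close> is minus the L1 norm; where \<open>d\<close> vanishes, division by zero gives
    0.\<close>
  define k0 where "k0 = (\<lambda>x. - (d x / of_real (cmod (d x))))"
  have "k0 \<in> borel_measurable (torus n)" unfolding k0_def using L2_measurable[OF d(1)] by measurable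
  moreover have "cmod (k0 x) \<le> 1" for x by (simp add: k0_def norm_divide)
  ultimately have k0: "k0 \<in> K" unfolding K_def by (simp add: L2_bounded[where B=1])
  have c0C: "(\<lambda>x. k0 x - \<psi> x) \<in> C" by (rule CI[OF k0 \<psi>A])
  have "(l2norm n d)\<^sup>2 \<le> Re (l2inner n d (\<lambda>x. k0 x - \<psi> x))"
  proof (rule l2_minimal_variational[OF d(1)])
    show c0L: "(\<lambda>x. k0 x - \<psi> x) \<in> L2 n" using c0C C_sub by blast
    fix t :: real assume t: "0 < t" "t \<le> 1"
    show "l2norm n d \<le> l2norm n (\<lambda>x. of_real (1 - t) * d x + of_real t * (k0 x - \<psi> x))"
    proof (rule min'[OF L2_scale[OF c0L]])
      show "(\<lambda>x. of_real (1 - t) * c m x + of_real t * (k0 x - \<psi> x)) \<in> C" for m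
        by (rule C_conv[OF c c0C less_imp_le[OF t(1)] t(2)])
    qed
  qed
  also have "\<dots> = Re (l2inner n (\<lambda>x. k0 x - \<psi> x) d)"
    by (subst l2inner_commute) simp
  also have "\<dots> = Re (l2inner n k0 d) - Re (l2inner n \<psi> d)"
    by (simp add: l2inner_diff_left KL[OF k0] AL[OF \<psi>A] d(1))
  also have "l2inner n k0 d = of_real (- l1norm n d)"
  proof -
    have "k0 x * cnj (d x) = of_real (- cmod (d x))" for x
      using complex_norm_square[of "d x"] by (cases "d x = 0") (simp_all add: k0_def field_simps power2_eq_square)
    then show ?thesis unfolding l2inner_def l1norm_def by simp
  qed
  also have "Re (of_real (- l1norm n d)) - Re (l2inner n \<psi> d) \<le> 0"
  proof -
    have "cmod (l2inner n \<psi> d) \<le> l1norm n d"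
      using contr[OF dM] by (simp add: l2inner_def l1norm_def)
    then show ?thesis using abs_Re_le_cmod[of "l2inner n \<psi> d"] by simp
  qed
  finally have d0: "l2norm n d = 0" by simp
  have c0: "(\<lambda>m. l2norm n (c m)) \<longlonglongrightarrow> 0"
    using l2lim_l2norm[OF cL d] d0 by simp
  \<comment> \<open>\<open>C\<close> need not be closed, so 0 is only a limit of differences. The
    points of the ball within \<open>1 / Suc m\<close> of \<open>A\<close> replace the intersection
    still to be found.\<close>
  define D where "D m = {k \<in> K. \<exists>a\<in>A. l2norm n (\<lambda>x. k x - a x) \<le> 1 / Suc m}" for m :: nat
  have DI: "k \<in> D m" if "k \<in> K" "a \<in> A" "l2norm n (\<lambda>x. k x - a x) \<le> 1 / Suc m" for k a m
    unfolding D_def using that by blast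
  have D_sub: "D m \<subseteq> L2 n" for m using KL by (auto simp: D_def)
  have D_dec: "decseq D"
  proof (rule decseq_SucI)
    fix m
    have "1 / real (Suc (Suc m)) \<le> 1 / real (Suc m)" by (simp add: frac_le)
    then show "D (Suc m) \<le> D m" unfolding D_def by (blast intro: order_trans)
  qed
  have D_ne: "D m \<noteq> {}" for m
  proof -
    have "\<exists>N. \<forall>i\<ge>N. norm (l2norm n (c i) - 0) < 1 / Suc m"
      by (rule LIMSEQ_D[OF c0]) simp
    then obtain i where i: "l2norm n (c i) < 1 / Suc m" by (force simp: l2norm_nonneg)
    obtain k a where ka: "k \<in> K" "a \<in> A" "c i = (\<lambda>x. k x - a x)"
      using c[of i] unfolding C_def by blast
    have "k \<in> D m" unfolding D_def using ka(1,2) less_imp_le[OF i[unfolded ka(3)]] by blast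
    then show ?thesis by blast
  qed
  have D_mid: "(\<lambda>x. 1/2 * (f x + g x)) \<in> D m" if fg: "f \<in> D m" "g \<in> D m" for f g m
  proof -
    obtain a b where ab: "a \<in> A" "b \<in> A" "l2norm n (\<lambda>x. f x - a x) \<le> 1 / Suc m" "l2norm n (\<lambda>x. g x - b x) \<le> 1 / Suc m"
      using fg unfolding D_def by blast
    have K: "f \<in> K" "g \<in> K" using fg by (auto simp: D_def)
    have "l2norm n (\<lambda>x. 1/2 * (f x + g x) - 1/2 * (a x + b x)) = 1/2 * l2norm n (\<lambda>x. (f x - a x) + (g x - b x))"
      using l2norm_scale[of n "1/2" "\<lambda>x. (f x - a x) + (g x - b x)"] by (simp add: algebra_simps)
    also have "\<dots> \<le> 1/2 * (l2norm n (\<lambda>x. f x - a x) + l2norm n (\<lambda>x. g x - b x))"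
      using K ab by (intro mult_left_mono l2norm_triangle L2_diff KL AL) auto
    also have "\<dots> \<le> 1 / Suc m" using ab(3,4) by argo
    finally have "l2norm n (\<lambda>x. 1/2 * (f x + g x) - 1/2 * (a x + b x)) \<le> 1 / Suc m" .
    from DI[OF _ _ this] show ?thesis
      unfolding half using K_conv[OF K, of "1/2"] A_conv[OF ab(1,2), of "1/2"] by simp
  qed
  have D_bnd: "l2norm n f \<le> 1" if "f \<in> D 0" for f
    using that by (intro l2norm_le_1) (auto simp: D_def K_def)
  obtain k \<phi> where k: "\<And>m. k m \<in> D m" and \<phi>: "\<phi> \<in> L2 n" "l2lim n k \<phi>"
    using l2_nested_convex[OF D_sub D_dec D_ne D_mid D_bnd] by blast
  have kK: "k m \<in> K" for m using k[of m] by (simp add: D_def)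
  have "AE x in torus n. cmod (\<phi> x) \<le> 1"
    by (rule unit_ball_closed[OF _ _ \<phi>]) (use kK in \<open>auto simp: K_def\<close>)
  obtain a where a: "\<And>m. a m \<in> A" "\<And>m. l2norm n (\<lambda>x. k m x - a m x) \<le> 1 / Suc m"
    using k unfolding D_def by (simp, metis)
  \<comment> \<open>The companions in \<open>A\<close> have the same limit, so \<phi> inherits
    analyticity and the inner products with \<open>Q\<close> from them and the bound 1 from the
    \<open>k m\<close>.\<close>
  have a\<phi>: "l2lim n a \<phi>"
  proof (rule tendsto_sandwich[OF _ _ tendsto_const])
    show "\<forall>\<^sub>F m in sequentially. 0 \<le> l2norm n (\<lambda>x. a m x - \<phi> x)" by (simp add: l2norm_nonneg)
    show "\<forall>\<^sub>F m in sequentially. l2norm n (\<lambda>x. a m x - \<phi> x) \<le> 1 / Suc m + l2norm n (\<lambda>x. k m x - \<phi> x)"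
    proof (intro always_eventually allI)
      fix m
      show "l2norm n (\<lambda>x. a m x - \<phi> x) \<le> 1 / Suc m + l2norm n (\<lambda>x. k m x - \<phi> x)"
        using l2norm_triangle_diff[OF AL[OF a(1)[of m]] KL[OF kK[of m]] \<phi>(1)] a(2)[of m]
        unfolding l2norm_diff_commute[of n "a m" "k m"] by linarith
    qed
    show "(\<lambda>m. 1 / real (Suc m) + l2norm n (\<lambda>x. k m x - \<phi> x)) \<longlonglongrightarrow> 0"
      using tendsto_add[OF LIMSEQ_Suc[OF lim_const_over_n[of 1]] \<phi>(2)] by simp
  qed
  have "\<phi> \<in> H2 n"
    by (rule closed_subspaceD(6)[OF closed_subspace_H2 _ \<phi>(1) a\<phi>]) (use a in \<open>simp add: A_def\<close>)
  moreover have "l2inner n \<phi> q = l2inner n \<psi> q" if q: "q \<in> Q" for q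
  proof -
    have "(\<lambda>m. l2inner n (a m) q) \<longlonglongrightarrow> l2inner n \<phi> q"
      by (rule l2lim_l2inner[OF AL[OF a(1)] \<phi>(1) Q_L2[OF q] a\<phi>])
    moreover have "l2inner n (a m) q = l2inner n \<psi> q" for m using a(1)[of m] q by (simp add: A_def)
    ultimately show ?thesis by (simp add: LIMSEQ_const_iff)
  qed
  ultimately show ?thesis
    using \<open>AE x in torus n. cmod (\<phi> x) \<le> 1\<close> by (intro that[of \<phi>]) (simp_all add: Hinf_ball_def)
qed

end

section \<open>Lifting\<close>

lemma is_proj_norm_le:
  assumes V: "closed_subspace n V" and p: "is_proj n V f p" and f: "f \<in> L2 n"
  shows "l2norm n p \<le> l2norm n f"
proof -
  note P = is_projD[OF V p f]
  have "of_real ((l2norm n p)\<^sup>2) = l2inner n f p"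
    using P(4)[OF P(1)] by (simp add: l2inner_self)
  then have "(l2norm n p)\<^sup>2 = cmod (l2inner n f p)"
    by (metis abs_power2 norm_of_real)
  also have "\<dots> \<le> l2norm n f * l2norm n p" by (rule l2_Cauchy_Schwarz[OF f P(2)])
  finally show ?thesis
    using l2norm_nonneg[of n p] l2norm_nonneg[of n f]
    by (cases "l2norm n p = 0") (auto simp: power2_eq_square)
qed

lemma is_proj_lincomb:
  assumes V: "closed_subspace n V" and f: "f \<in> L2 n" "is_proj n V f p" and g: "g \<in> L2 n" "is_proj n V g q"
  shows "is_proj n V (\<lambda>x. c * f x + g x) (\<lambda>x. c * p x + q x)"
proof -
  note P = is_projD[OF V f(2,1)] and Q = is_projD[OF V g(2,1)]
  have "(\<lambda>x. c * p x + q x) \<in> V" using P(1) Q(1) by (intro closed_subspaceD(3,4)[OF V])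
  moreover have "l2inner n (\<lambda>x. c * f x + g x - (c * p x + q x)) h = 0" if h: "h \<in> V" for h
  proof -
    have hL: "h \<in> L2 n" using h closed_subspaceD(1)[OF V] by blast
    have "(\<lambda>x. c * f x + g x - (c * p x + q x)) = (\<lambda>x. c * (f x - p x) + (g x - q x))"
      by (simp add: algebra_simps)
    then show ?thesis
      using l2inner_add_left[OF L2_scale[OF L2_diff[OF f(1) P(2)], of c] L2_diff[OF g(1) Q(2)] hL]
        P(3)[OF h] Q(3)[OF h] by (simp add: l2inner_scale_left)
  qed
  ultimately show ?thesis by (simp add: is_proj_def)
qed

lemma l2inner_Hinf_mult: "l2inner n (\<lambda>x. \<phi> x * f x) q = l2inner n f (\<lambda>x. cnj (\<phi> x) * q x)"
  by (simp add: l2inner_def mult_ac)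

context quotient_mod
begin

text \<open>The constant 1 need not belong to \<open>Q\<close>; \<open>1 - p\<close> lies in
  \<open>perp\<close>, and \<open>perp_Hinf\<close> shows that replacing 1 by \<open>p\<close> does
  not change the projection of \<phi>.\<close>

lemma lift_imp_contractive:
  assumes \<phi>: "\<phi> \<in> Hinf_ball n" and lift: "\<And>f. f \<in> Q \<Longrightarrow> is_proj n Q (\<lambda>x. \<phi> x * f x) (X f)"
    and p: "is_proj n Q (\<lambda>_. 1) p" and f: "f \<in> MQ n Q"
  shows "cmod (LINT x|torus n. X p x * f x) \<le> l1norm n f"
proof -
  note PP = is_projD[OF Q_closed p L2_const]
  note \<phi>D = Hinf_ballD[OF \<phi>]
  have \<phi>p: "(\<lambda>x. \<phi> x * p x) \<in> L2 n" by (rule L2_Hinf_mult[OF \<phi> PP(2)])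
  note XP = is_projD[OF Q_closed lift[OF PP(1)] \<phi>p]
  obtain q m h where f_eq: "f = (\<lambda>x. cnj (q x) + m x + h x)" and q: "q \<in> Q" and m: "m \<in> Mn n" and h: "h \<in> H2_0 n"
    using f unfolding MQ_def by blast
  have fL: "f \<in> L2 n" unfolding f_eq
    using m h by (intro L2_add L2_cnj Q_L2[OF q]) (auto simp: Mn_def H2_0_def H2_def)
  have "l2inner n (\<lambda>x. \<phi> x * (1 - p x)) q = 0"
    by (rule perp_Hinf[OF \<phi> perp_diff_proj[OF H2_one p] q])
  moreover have "l2inner n (\<lambda>x. \<phi> x * (1 - p x)) q = l2inner n \<phi> q - l2inner n (\<lambda>x. \<phi> x * p x) q"
    using l2inner_diff_left[OF \<phi>D(2) \<phi>p Q_L2[OF q]] by (simp add: right_diff_distrib)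
  ultimately have "l2inner n (X p) q = l2inner n \<phi> q" using XP(4)[OF q] by simp
  then have "(LINT x|torus n. X p x * f x) = (LINT x|torus n. \<phi> x * f x)"
    unfolding f_eq integral_H2_mult_MQ[OF Q_H2[OF XP(1)] Q_L2[OF q] m h]
      integral_H2_mult_MQ[OF \<phi>D(1) Q_L2[OF q] m h] .
  also have "cmod \<dots> \<le> l1norm n f"
    unfolding l1norm_def by (rule cmod_integral_bounded_mult[OF \<phi>D(3,4) L2_integrable[OF fL]])
  finally show ?thesis .
qed

text \<open>The identity is proved on all of \<open>H2 n\<close>, in the form that \<open>X\<close>
  after projection equals projection after multiplication by \<phi>, because monomials generally lie
  outside \<open>Q\<close>.\<close>

lemma symbol_lifts:
  assumes X: "contraction_on n Q X" and mod: "module_map n Q X" and p: "is_proj n Q (\<lambda>_. 1) p"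
    and \<phi>: "\<phi> \<in> Hinf_ball n" and sym: "\<And>q. q \<in> Q \<Longrightarrow> l2inner n \<phi> q = l2inner n (X p) q"
    and f: "f \<in> Q"
  shows "is_proj n Q (\<lambda>x. \<phi> x * f x) (X f)"
proof -
  note \<phi>D = Hinf_ballD[OF \<phi>]
  note H2D = closed_subspaceD[OF closed_subspace_H2]
  have XQ: "X g \<in> Q" if "g \<in> Q" for g using X that unfolding contraction_on_def by blast
  have XL: "X g \<in> L2 n" if "g \<in> Q" for g by (rule Q_L2[OF XQ[OF that]])
  have Xlin: "aeq n (X (\<lambda>x. c * g x + h x)) (\<lambda>x. c * X g x + X h x)" if "g \<in> Q" "h \<in> Q" for g h c
    using X that unfolding contraction_on_def by blast
  have Xn: "l2norm n (X g) \<le> l2norm n g" if "g \<in> Q" for g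
    using X that unfolding contraction_on_def by blast
  have Xlin_inner: "l2inner n (X (\<lambda>x. c * g x + h x)) q = c * l2inner n (X g) q + l2inner n (X h) q"
    if g: "g \<in> Q" and h: "h \<in> Q" and q: "q \<in> Q" for g h q c
  proof -
    have "(\<lambda>x. c * g x + h x) \<in> Q" using g h by (intro closed_subspaceD(3,4)[OF Q_closed])
    then have "l2inner n (X (\<lambda>x. c * g x + h x)) q = l2inner n (\<lambda>x. c * X g x + X h x) q"
      using g h q by (intro l2inner_cong_AE Xlin L2_add L2_scale XL Q_L2) (auto simp: aeq_def)
    then show ?thesis
      using l2inner_add_left[OF L2_scale[OF XL[OF g]] XL[OF h] Q_L2[OF q], of c]
      by (simp add: l2inner_scale_left)
  qed
  have Xdiff: "l2norm n (\<lambda>x. X g x - X h x) \<le> l2norm n (\<lambda>x. g x - h x)" if g: "g \<in> Q" and h: "h \<in> Q" for g h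
  proof -
    have d: "(\<lambda>x. -1 * h x + g x) \<in> Q" using g h by (intro closed_subspaceD(3,4)[OF Q_closed])
    have "(l2norm n (\<lambda>x. X g x - X h x)) = l2norm n (X (\<lambda>x. -1 * h x + g x))"
      unfolding l2norm_def
    proof (intro arg_cong[where f=sqrt] integral_cong_AE)
      show "AE x in torus n. (cmod (X g x - X h x))\<^sup>2 = (cmod (X (\<lambda>x. -1 * h x + g x) x))\<^sup>2"
        using Xlin[OF h g, of "-1"] unfolding aeq_def by eventually_elim simp
    qed (use L2_measurable[OF XL[OF g]] L2_measurable[OF XL[OF h]] L2_measurable[OF XL[OF d]] in measurable)
    also have "\<dots> \<le> l2norm n (\<lambda>x. -1 * h x + g x)" by (rule Xn[OF d])
    finally show ?thesis by simp
  qed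
  \<comment> \<open>\<open>X\<close> acts on representatives; that it respects almost everywhere
    equality follows from linearity and contractivity.\<close>
  have Xcong: "l2inner n (X g) q = l2inner n (X h) q"
    if g: "g \<in> Q" and h: "h \<in> Q" and gh: "aeq n g h" and q: "q \<in> Q" for g h q
  proof -
    have "l2norm n (\<lambda>x. g x - h x) = 0"
      using gh g h by (simp add: l2norm_eq_0_iff L2_diff Q_L2 aeq_def)
    then have "l2norm n (\<lambda>x. X g x - X h x) = 0"
      using Xdiff[OF g h] l2norm_nonneg[of n "\<lambda>x. X g x - X h x"] by simp
    then have "l2inner n (\<lambda>x. X g x - X h x) q = 0"
      using l2_Cauchy_Schwarz[OF L2_diff[OF XL[OF g] XL[OF h]] Q_L2[OF q]] by simp
    then show ?thesis using l2inner_diff_left[OF XL[OF g] XL[OF h] Q_L2[OF q]] by simp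
  qed
  \<comment> \<open>Projections are unique only almost everywhere, hence the quantifier over all
    \<open>P\<close> and the formulation through inner products.\<close>
  define Z where "Z = {f \<in> H2 n. \<forall>P. is_proj n Q f P \<longrightarrow> (\<forall>q\<in>Q. l2inner n (X P) q = l2inner n (\<lambda>x. \<phi> x * f x) q)}"
  have ZI: "f \<in> Z" if "f \<in> H2 n" "is_proj n Q f P" "\<And>q. q \<in> Q \<Longrightarrow> l2inner n (X P) q = l2inner n (\<lambda>x. \<phi> x * f x) q" for f P
  proof -
    have "l2inner n (X P') q = l2inner n (\<lambda>x. \<phi> x * f x) q" if "is_proj n Q f P'" "q \<in> Q" for P' q
    proof -
      have "aeq n P' P" by (rule is_proj_unique[OF Q_closed H2_L2[OF \<open>f \<in> H2 n\<close>] that(1) \<open>is_proj n Q f P\<close>])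
      then show ?thesis
        using Xcong[of P' P q] that \<open>is_proj n Q f P\<close> \<open>\<And>q. q \<in> Q \<Longrightarrow> l2inner n (X P) q = l2inner n (\<lambda>x. \<phi> x * f x) q\<close>
        by (auto simp: is_proj_def)
    qed
    then show ?thesis using that(1) by (simp add: Z_def)
  qed
  have ZD: "f \<in> H2 n" "is_proj n Q f P \<Longrightarrow> q \<in> Q \<Longrightarrow> l2inner n (X P) q = l2inner n (\<lambda>x. \<phi> x * f x) q"
    if "f \<in> Z" for f P q
    using that unfolding Z_def by auto
  have one: "(\<lambda>_. 1) \<in> Z"
    by (rule ZI[OF H2_one p]) (simp add: sym)
  have shift: "(\<lambda>x. zc j x * f x) \<in> Z" if j: "j < n" and f: "f \<in> Z" for f j
  proof -
    have fH: "f \<in> H2 n" by (rule ZD(1)[OF f])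
    have zf: "(\<lambda>x. zc j x * f x) \<in> H2 n" by (rule H2_zc_mult[OF j fH])
    obtain P where P: "is_proj n Q f P" using projection_exists[OF Q_closed H2_L2[OF fH]] .
    obtain P' where P': "is_proj n Q (\<lambda>x. zc j x * f x) P'" using projection_exists[OF Q_closed H2_L2[OF zf]] .
    have PQ: "P \<in> Q" "P' \<in> Q" using P P' by (auto simp: is_proj_def)
    have zP: "(\<lambda>x. zc j x * P x) \<in> H2 n" by (rule H2_zc_mult[OF j Q_H2[OF PQ(1)]])
    have zX: "(\<lambda>x. zc j x * X P x) \<in> H2 n" by (rule H2_zc_mult[OF j Q_H2[OF XQ[OF PQ(1)]]])
    \<comment> \<open>Replacing \<open>f\<close> by its projection changes the product with
      \<open>zc j\<close> by an element of \<open>perp\<close>. This brings the situation into the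
      form required by \<open>module_map\<close>.\<close>
    have "is_proj n Q (\<lambda>x. zc j x * P x) P'"
    proof -
      have "l2inner n (\<lambda>x. zc j x * P x - P' x) h = 0" if h: "h \<in> Q" for h
      proof -
        have "l2inner n (\<lambda>x. zc j x * (f x - P x)) h = 0"
          using perp_zc[OF j perp_diff_proj[OF fH P]] h by (simp add: perp_def)
        then have "l2inner n (\<lambda>x. zc j x * f x) h = l2inner n (\<lambda>x. zc j x * P x) h"
          using l2inner_diff_left[OF H2_L2[OF zf] H2_L2[OF zP] Q_L2[OF h]] by (simp add: right_diff_distrib)
        then show ?thesis
          using is_projD(4)[OF Q_closed P' H2_L2[OF zf] h] l2inner_diff_left[OF H2_L2[OF zP] Q_L2[OF PQ(2)] Q_L2[OF h]]
          by simp
      qed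
      then show ?thesis using PQ by (simp add: is_proj_def)
    qed
    moreover obtain R where R: "is_proj n Q (\<lambda>x. zc j x * X P x) R"
      using projection_exists[OF Q_closed H2_L2[OF zX]] .
    ultimately have XR: "aeq n (X P') R" using mod j PQ(1) unfolding module_map_def by blast
    note RD = is_projD[OF Q_closed R H2_L2[OF zX]]
    show ?thesis
    proof (rule ZI[OF zf P'])
      fix q assume q: "q \<in> Q"
      \<comment> \<open>The adjoint shift moves \<open>zc j\<close> onto the test vector, where
        membership of \<open>f\<close> in \<open>Z\<close> can be used, and then back.\<close>
      obtain q' where q': "q' \<in> Q" "\<And>h. h \<in> H2 n \<Longrightarrow> l2inner n (\<lambda>x. zc j x * h x) q = l2inner n h q'"
        using adjoint_shift[OF j q] by blast
      have "l2inner n (X P') q = l2inner n R q"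
        by (rule l2inner_cong_AE[OF XL[OF PQ(2)] RD(2) Q_L2[OF q] Q_L2[OF q] XR]) (simp add: aeq_def)
      also have "\<dots> = l2inner n (\<lambda>x. zc j x * X P x) q" by (rule RD(4)[OF q])
      also have "\<dots> = l2inner n (X P) q'" by (rule q'(2)[OF Q_H2[OF XQ[OF PQ(1)]]])
      also have "\<dots> = l2inner n (\<lambda>x. \<phi> x * f x) q'" by (rule ZD(2)[OF f P q'(1)])
      also have "\<dots> = l2inner n (\<lambda>x. zc j x * (\<phi> x * f x)) q" by (rule q'(2)[OF H2_Hinf_mult[OF \<phi> fH], symmetric])
      finally show "l2inner n (X P') q = l2inner n (\<lambda>x. \<phi> x * (zc j x * f x)) q" by (simp add: mult_ac)
    qed
  qed
  have lincomb: "(\<lambda>x. c * f x + g x) \<in> Z" if f: "f \<in> Z" and g: "g \<in> Z" for f g c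
  proof -
    have fH: "f \<in> H2 n" and gH: "g \<in> H2 n" using ZD(1) f g by auto
    obtain P where P: "is_proj n Q f P" using projection_exists[OF Q_closed H2_L2[OF fH]] .
    obtain R where R: "is_proj n Q g R" using projection_exists[OF Q_closed H2_L2[OF gH]] .
    have PQ: "P \<in> Q" "R \<in> Q" using P R by (auto simp: is_proj_def)
    show ?thesis
    proof (rule ZI[OF _ is_proj_lincomb[OF Q_closed H2_L2[OF fH] P H2_L2[OF gH] R]])
      show "(\<lambda>x. c * f x + g x) \<in> H2 n" using fH gH by (intro H2D(3,4))
      fix q assume q: "q \<in> Q"
      have "l2inner n (X (\<lambda>x. c * P x + R x)) q = c * l2inner n (\<lambda>x. \<phi> x * f x) q + l2inner n (\<lambda>x. \<phi> x * g x) q"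
        unfolding Xlin_inner[OF PQ q] ZD(2)[OF f P q] ZD(2)[OF g R q] ..
      also have "\<dots> = l2inner n (\<lambda>x. c * (\<phi> x * f x) + \<phi> x * g x) q"
        using l2inner_add_left[OF L2_scale[OF L2_Hinf_mult[OF \<phi> H2_L2[OF fH]]] L2_Hinf_mult[OF \<phi> H2_L2[OF gH]] Q_L2[OF q], of c]
        by (simp add: l2inner_scale_left)
      finally show "l2inner n (X (\<lambda>x. c * P x + R x)) q = l2inner n (\<lambda>x. \<phi> x * (c * f x + g x)) q"
        by (simp add: algebra_simps)
    qed
  qed
  have zero: "(\<lambda>_. 0) \<in> Z" using lincomb[OF one one, of "-1"] by simp
  have Z: "closed_subspace n Z"
    unfolding closed_subspace_def
  proof (intro conjI ballI allI impI)
    show "Z \<subseteq> L2 n" using ZD(1) H2_L2 by blast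
    show "(\<lambda>_. 0) \<in> Z" by (rule zero)
    show "(\<lambda>x. f x + g x) \<in> Z" if "f \<in> Z" "g \<in> Z" for f g using lincomb[OF that, of 1] by simp
    show "(\<lambda>x. c * f x) \<in> Z" if "f \<in> Z" for f c using lincomb[OF that zero, of c] by simp
  next
    fix f g assume f: "f \<in> Z" and g: "g \<in> L2 n" and fg: "aeq n f g"
    have fH: "f \<in> H2 n" by (rule ZD(1)[OF f])
    have gH: "g \<in> H2 n" by (rule H2D(5)[OF fH g fg])
    obtain P where P: "is_proj n Q f P" using projection_exists[OF Q_closed H2_L2[OF fH]] .
    have PQ: "P \<in> Q" using P by (simp add: is_proj_def)
    show "g \<in> Z"
    proof (rule ZI[OF gH])
      have "l2inner n (\<lambda>x. f x - P x) q = l2inner n (\<lambda>x. g x - P x) q" if "q \<in> Q" for q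
      proof (rule l2inner_cong_AE)
        show "aeq n (\<lambda>x. f x - P x) (\<lambda>x. g x - P x)"
          using fg unfolding aeq_def by eventually_elim simp
      qed (use that H2_L2[OF fH] g Q_L2[OF PQ] Q_L2 in \<open>auto intro: L2_diff simp: aeq_def\<close>)
      then show "is_proj n Q g P" using P by (simp add: is_proj_def)
      fix q assume q: "q \<in> Q"
      have "l2inner n (\<lambda>x. \<phi> x * f x) q = l2inner n (\<lambda>x. \<phi> x * g x) q"
      proof (rule l2inner_cong_AE)
        show "aeq n (\<lambda>x. \<phi> x * f x) (\<lambda>x. \<phi> x * g x)"
          using fg unfolding aeq_def by eventually_elim simp
      qed (use L2_Hinf_mult[OF \<phi> H2_L2[OF fH]] L2_Hinf_mult[OF \<phi> g] Q_L2[OF q] in \<open>auto simp: aeq_def\<close>)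
      then show "l2inner n (X P) q = l2inner n (\<lambda>x. \<phi> x * g x) q"
        using ZD(2)[OF f P q] by simp
    qed
  next
    fix F f assume FZ: "\<forall>k. F k \<in> Z" and f: "f \<in> L2 n" and lim: "l2lim n F f"
    have FH: "F k \<in> H2 n" for k using FZ ZD(1) by blast
    have FL: "F k \<in> L2 n" for k by (rule H2_L2[OF FH])
    have fH: "f \<in> H2 n" by (rule H2D(6)[OF FH f lim])
    obtain P where P: "is_proj n Q f P" using projection_exists[OF Q_closed f] .
    have "\<exists>R. is_proj n Q (F k) R" for k using projection_exists[OF Q_closed FL[of k]] by blast
    then obtain R where R: "\<And>k. is_proj n Q (F k) (R k)" by metis
    have PQ: "P \<in> Q" "\<And>k. R k \<in> Q" using P R by (auto simp: is_proj_def)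
    show "f \<in> Z"
    proof (rule ZI[OF fH P])
      fix q assume q: "q \<in> Q"
      \<comment> \<open>Projection and \<open>X\<close> are both contractive, so the convergence of
        \<open>F\<close> carries over.\<close>
      have XRP: "l2lim n (\<lambda>k. X (R k)) (X P)"
      proof (rule tendsto_sandwich[OF _ _ tendsto_const lim])
        show "\<forall>\<^sub>F k in sequentially. 0 \<le> l2norm n (\<lambda>x. X (R k) x - X P x)" by (simp add: l2norm_nonneg)
        show "\<forall>\<^sub>F k in sequentially. l2norm n (\<lambda>x. X (R k) x - X P x) \<le> l2norm n (\<lambda>x. F k x - f x)"
        proof (intro always_eventually allI)
          fix k
          have "is_proj n Q (\<lambda>x. -1 * f x + F k x) (\<lambda>x. -1 * P x + R k x)"
            by (rule is_proj_lincomb[OF Q_closed f P FL R])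
          from is_proj_norm_le[OF Q_closed this L2_add[OF L2_scale[OF f] FL]]
          have "l2norm n (\<lambda>x. R k x - P x) \<le> l2norm n (\<lambda>x. F k x - f x)" by simp
          then show "l2norm n (\<lambda>x. X (R k) x - X P x) \<le> l2norm n (\<lambda>x. F k x - f x)"
            using Xdiff[OF PQ(2)[of k] PQ(1)] by simp
        qed
      qed
      have "(\<lambda>k. l2inner n (X (R k)) q) \<longlonglongrightarrow> l2inner n (X P) q"
        by (rule l2lim_l2inner[OF XL[OF PQ(2)] XL[OF PQ(1)] Q_L2[OF q] XRP])
      moreover have "(\<lambda>k. l2inner n (X (R k)) q) \<longlonglongrightarrow> l2inner n (\<lambda>x. \<phi> x * f x) q"
      proof -
        have "(\<lambda>x. cnj (\<phi> x) * q x) \<in> L2 n"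
          using \<phi>D(3,4) by (intro L2_bounded_mult[where B=1] Q_L2[OF q]) auto
        from l2lim_l2inner[OF FL f this lim]
        have "(\<lambda>k. l2inner n (\<lambda>x. \<phi> x * F k x) q) \<longlonglongrightarrow> l2inner n (\<lambda>x. \<phi> x * f x) q"
          unfolding l2inner_Hinf_mult .
        moreover have "l2inner n (X (R k)) q = l2inner n (\<lambda>x. \<phi> x * F k x) q" for k
          using ZD(2)[OF _ R q] FZ by blast
        ultimately show ?thesis by simp
      qed
      ultimately show "l2inner n (X P) q = l2inner n (\<lambda>x. \<phi> x * f x) q" by (rule LIMSEQ_unique)
    qed
  qed
  have mon: "monom n k \<in> Z" if "\<forall>j<n. 0 \<le> k j" for k
    by (rule nonneg_monom_induct[OF that one shift])
  have fH: "f \<in> H2 n" and fL: "f \<in> L2 n" using Q_H2 Q_L2 f by auto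
  \<comment> \<open>Density of polynomials in \<open>H2 n\<close>: the residual of \<open>f\<close>
    modulo \<open>Z\<close> is analytic and orthogonal to every nonnegative monomial, so all its
    coefficients vanish.\<close>
  obtain z where z: "is_proj n Z f z" using projection_exists[OF Z fL] .
  note zD = is_projD[OF Z z fL]
  have dH: "(\<lambda>x. f x - z x) \<in> H2 n" by (rule closed_subspace_diff[OF closed_subspace_H2 fH ZD(1)[OF zD(1)]])
  have "fourier n (\<lambda>x. f x - z x) k = 0" for k
  proof (cases "\<exists>j<n. k j < 0")
    case True
    then show ?thesis using fourier_H2_eq_0[OF dH] by blast
  next
    case False
    then have "monom n k \<in> Z" by (intro mon) auto
    then show ?thesis unfolding fourier_eq_l2inner by (rule zD(3))
  qed
  then have "aeq n (\<lambda>x. f x - z x) (\<lambda>_. 0)" by (rule fourier_zero_imp_aeq[OF L2_diff[OF fL zD(2)]])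
  then have "aeq n z f" unfolding aeq_def by eventually_elim simp
  then have fZ: "f \<in> Z" by (rule closed_subspaceD(5)[OF Z zD(1) fL])
  have "is_proj n Q f f" using f by (simp add: is_proj_def l2inner_def)
  then have "l2inner n (X f) q = l2inner n (\<lambda>x. \<phi> x * f x) q" if "q \<in> Q" for q
    using ZD(2)[OF fZ _ that] by blast
  then have "l2inner n (\<lambda>x. \<phi> x * f x - X f x) q = 0" if "q \<in> Q" for q
    using l2inner_diff_left[OF L2_Hinf_mult[OF \<phi> fL] XL[OF f] Q_L2[OF that]] that by simp
  then show ?thesis using XQ[OF f] by (simp add: is_proj_def)
qed

end

theorem theorem4p1:
  fixes n :: nat and Q :: "((nat \<Rightarrow> real) \<Rightarrow> complex) set"
    and X :: "((nat \<Rightarrow> real) \<Rightarrow> complex) \<Rightarrow> ((nat \<Rightarrow> real) \<Rightarrow> complex)"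
    and p :: "(nat \<Rightarrow> real) \<Rightarrow> complex"
  assumes "n \<ge> 1"
    and "quotient_module n Q"
    and "contraction_on n Q X"
    and "module_map n Q X"
    and "is_proj n Q (\<lambda>_. 1) p"
  shows "liftable n Q X \<longleftrightarrow>
         (\<forall>f\<in>MQ n Q. cmod (LINT x|torus n. X p x * f x) \<le> l1norm n f)"
proof -
  interpret quotient_mod n Q by standard fact
  show ?thesis
  proof
    assume "liftable n Q X"
    then show "\<forall>f\<in>MQ n Q. cmod (LINT x|torus n. X p x * f x) \<le> l1norm n f"
      unfolding liftable_def using lift_imp_contractive[OF _ _ assms(5)] by blast
  next
    assume contr: "\<forall>f\<in>MQ n Q. cmod (LINT x|torus n. X p x * f x) \<le> l1norm n f"
    have "X p \<in> Q" using assms(3,5) by (simp add: contraction_on_def is_proj_def)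
    then obtain \<phi> where "\<phi> \<in> Hinf_ball n" "\<And>q. q \<in> Q \<Longrightarrow> l2inner n \<phi> q = l2inner n (X p) q"
      using symbol_exists[of "X p"] contr by blast
    then show "liftable n Q X"
      unfolding liftable_def using symbol_lifts[OF assms(3-5)] by blast
  qed
qed

end
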